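(* Let $\mathbb{G}$ be a homogeneous group with a multiradial distance $d$, and let $\Sigma\subset\mathbb{G}$ be an $n$-dimensional submanifold of class $C^1$ and of degree $N$. Let $\mathcal{S}^N$ be the $N$-dimensional spherical measure constructed with $d$. Let $n_1,\dots,n_\iota$ be fixed integers and assume: (I) for every $p\in\Sigma$ of maximum degree $N$ (i.e. $d_\Sigma(p)=N$) one has $\theta^N(\mu_\Sigma,p)=\beta_d(A_p\Sigma)$; (II) the set of points of $\Sigma$ having degree less than $N$ is $\mathcal{S}^N$-negligible; (III) $A_p\Sigma\in\mathcal{F}_{n_1,\dots,n_\iota}$ for every point $p\in\Sigma$ of maximum degree. Let $\omega_d(\mathcal{F}_{n_1,\dots,n_\iota})$ be the constant value of $\beta_d$ on $\mathcal{F}_{n_1,\dots,n_\iota}$ and set $\mathcal{S}^N_d=\omega_d(\mathcal{F}_{n_1,\dots,n_\iota})\,\mathcal{S}^N$. Then for every Borel set $B\subset\Sigma$, $$\mathcal{S}_d^N(B)=\int_B\|\tau^{\tilde g}_{\Sigma,N}(p)\|_g\,d\sigma_{\tilde g}(p).$$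
   Context: **Homogeneous groups.** A graded group of step $\iota$ is a connected, simply connected, nilpotent Lie group whose Lie algebra is a direct sum $H_1\oplus\cdots\oplus H_\iota$ with $[H_i,H_j]\subset H_{i+j}$ ($H_k=\{0\}$ for $k>\iota$) and $H_\iota\neq\{0\}$. Through the exponential map it is identified with its Lie algebra, so $\mathbb{G}=H_1\oplus\cdots\oplus H_\iota$ is a finite-dimensional real vector space with the group product given by the Baker–Campbell–Hausdorff formula; the unit is $0$. $P_{H_j}:\mathbb{G}\to H_j$ are the linear projections. Dilations $\delta_r$, $r>0$, are the linear maps acting as multiplication by $r^i$ on $H_i$; with them $\mathbb{G}$ is a homogeneous group. A homogeneous distance $d$ is a distance with $d(zx,zy)=d(x,y)$ and $d(\delta_rx,\delta_ry)=r\,d(x,y)$ for all $x,y,z\in\mathbb{G}$, $r>0$. $\mathbb{B}(x,r)=\{y: d(x,y)\le r\}$. A scalar product on $\mathbb{G}$ making the layers $H_i$ mutually orthogonal is fixed, with norm $|\cdot|$; $\mathcal{H}^k_{|\cdot|}$ is the $k$-dimensional Euclidean Hausdorff measure (normalized to agree with Lebesgue measure on $k$-planes), and $g$ is the left invariant Riemannian metric extending the scalar product from $T_0\mathbb{G}\cong\mathbb{G}$. A homogeneous subspace is a linear subspace invariant under all $\delta_r$. **Multiradial distance.** A homogeneous distance $d$ is multiradial if there is a continuous $\varphi:[0,+\infty)^\iota\to[0,+\infty)$, nondecreasing in each variable, with $\varphi(0)=0$, $\varphi(t)\to+\infty$ as $|t|\to+\infty$, and $\mathbb{B}(0,1)=\{x\in\mathbb{G}:\varphi(|P_{H_1}(x)|,\dots,|P_{H_\iota}(x)|)\le1\}$.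 **Spherical factor.** For a linear subspace $V\subset\mathbb{G}$ of dimension $n$, $\beta_d(V)=\max_{z\in\mathbb{B}(0,1)}\mathcal{H}^n_{|\cdot|}(V\cap\mathbb{B}(z,1))$. $\mathcal{F}_{n_1,\dots,n_\iota}$ is the family of all homogeneous subspaces $V=V_1\oplus\cdots\oplus V_\iota$ with $V_i\subset H_i$, $\dim V_i=n_i$. For a multiradial distance $d$, $\beta_d$ is constant on $\mathcal{F}_{n_1,\dots,n_\iota}$. **Spherical measure.** $\mathcal{S}^\alpha(A)=\sup_{\delta>0}\inf\{\sum_j(\operatorname{diam}(B_j)/2)^\alpha: A\subset\bigcup_jB_j,\ B_j\text{ closed metric balls of positive radius},\ \operatorname{diam}(B_j)\le\delta\}$ (countable coverings, diameters with respect to $d$). **Degree.** Fix a basis $e_1,\dots,e_{\mathrm q}$ of $\mathbb{G}$ that is the union of bases of the layers; let $d_i=j$ if $e_i\in H_j$, and let $X_i$ be the left invariant vector field with $X_i(0)=e_i$. For $I=(i_1<\dots<i_n)$ put $X_I=X_{i_1}\wedge\cdots\wedge X_{i_n}$ and $d(I)=d_{i_1}+\cdots+d_{i_n}$. For $p\in\mathbb{G}$ and $M\in\mathbb{N}$, $\pi_{p,M}$ is the linear projection of $\Lambda_n(T_p\mathbb{G})$ onto $\operatorname{span}\{X_I(p):d(I)=M\}$ that kills $X_I(p)$ for $d(I)\ne M$. If $\Sigma$ is an (embedded) $C^1$ submanifold of dimension $n$ and $\tau_\Sigma(p)$ is a nonzero simple $n$-vector orienting $T_p\Sigma$, the degree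 of $\Sigma$ at $p$ is $d_\Sigma(p)=\max\{M:\pi_{p,M}(\tau_\Sigma(p))\neq0\}$, and the degree of $\Sigma$ is $N=\max_{p\in\Sigma}d_\Sigma(p)$. Points with $d_\Sigma(p)=N$ are points of maximum degree. **Homogeneous tangent space.** If $d_\Sigma(p)=N$, let $\xi\in\Lambda_n\mathbb{G}$ be the $n$-vector at $0$ whose left invariant extension takes the value $\pi_{p,N}(\tau_\Sigma(p))$ at $p$. Then $A_p\Sigma=\{v\in\mathbb{G}: v\wedge\xi=0\}$, a homogeneous subspace of dimension $n$. **Intrinsic measure.** $\tilde g$ is any fixed Riemannian metric on $\mathbb{G}$, $\sigma_{\tilde g}$ is the $n$-dimensional Riemannian surface measure induced by $\tilde g$ on $\Sigma$, $\tau^{\tilde g}_\Sigma(p)$ is a simple tangent $n$-vector to $\Sigma$ at $p$ of unit length with respect to $\tilde g$, $\tau^{\tilde g}_{\Sigma,N}(p)=\pi_{p,N}(\tau^{\tilde g}_\Sigma(p))$, and $\|\cdot\|_g$ is the norm on $n$-vectors induced by $g$. Define $\mu_\Sigma(B)=\int_{B\cap\Sigma}\|\tau^{\tilde g}_{\Sigma,N}\|_g\,d\sigma_{\tilde g}$ for Borel $B\subset\mathbb{G}$ (this does not depend on $\tilde g$). **Federer density.** $\theta^N(\mu,x)=\inf_{\varepsilon>0}\sup\{\mu(B)/(\operatorname{diam}(B)/2)^N: B\text{ a closed ball of positive radius},\ x\in B,\ \operatorname{diam}(B)<\varepsilon\}$. *)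

theory Defs
  imports "HOL-Analysis.Analysis"
begin

text \<open>
  The group is identified with its Lie algebra through the exponential map: both live on a
  Euclidean space \<open>'a\<close>, whose inner product is the fixed scalar product. Every tangent space
  of the group is identified with \<open>'a\<close> through its linear structure.
\<close>


section \<open>Graded groups\<close>

fun nested_bracket :: "('a::zero \<Rightarrow> 'a \<Rightarrow> 'a) \<Rightarrow> 'a list \<Rightarrow> 'a" where
  "nested_bracket br [] = 0"
| "nested_bracket br [x] = x"
| "nested_bracket br (x # y # zs) = br x (nested_bracket br (y # zs))"

text \<open>
  Dynkin's form of the Baker-Campbell-Hausdorff series. The list
  \<open>[(r\<^sub>1, s\<^sub>1), \<dots>, (r\<^sub>m, s\<^sub>m)]\<close> stands for the iterated bracket of the word
  \<open>x\<^sup>r\<^sup>1 y\<^sup>s\<^sup>1 \<dots> x\<^sup>r\<^sup>m y\<^sup>s\<^sup>m\<close>. In a Lie algebra that is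
  nilpotent of step at most \<open>k\<close> the terms of total degree greater than \<open>k\<close> vanish.
\<close>

definition dynkin_words :: "nat \<Rightarrow> (nat \<times> nat) list set" where
  "dynkin_words k =
     {ws. ws \<noteq> [] \<and> (\<forall>(r, s)\<in>set ws. 0 < r + s) \<and> (\<Sum>(r, s)\<leftarrow>ws. r + s) \<le> k}"

lemma finite_dynkin_words: "finite (dynkin_words k)"
proof (rule finite_subset)
  have len: "length ws \<le> (\<Sum>(r, s)\<leftarrow>ws. r + s)"
    if "\<forall>(r, s)\<in>set ws. 0 < r + s" for ws :: "(nat \<times> nat) list"
    using that by (induction ws) auto
  have mem: "r + s \<le> (\<Sum>(r, s)\<leftarrow>ws. r + s)" if "(r, s) \<in> set ws" for r s and ws :: "(nat \<times> nat) list"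
    using that by (induction ws) auto
  show "dynkin_words k \<subseteq> {ws. set ws \<subseteq> {..k} \<times> {..k} \<and> length ws \<le> k}"
    using len mem unfolding dynkin_words_def by (fastforce dest: order_trans)
  show "finite {ws. set ws \<subseteq> {..k} \<times> {..k} \<and> length ws \<le> k}"
    by (intro finite_lists_length_le) simp
qed

definition bch :: "('a::real_vector \<Rightarrow> 'a \<Rightarrow> 'a) \<Rightarrow> nat \<Rightarrow> 'a \<Rightarrow> 'a \<Rightarrow> 'a" where
  "bch br k x y =
     (\<Sum>ws\<in>dynkin_words k.
        ((- 1) ^ (length ws - 1) /
          (real (length ws) * real (\<Sum>(r, s)\<leftarrow>ws. r + s) * (\<Prod>(r, s)\<leftarrow>ws. fact r * fact s)))
        *\<^sub>R nested_bracket br (concat (map (\<lambda>(r, s). replicate r x @ replicate s y) ws)))"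

record 'a group_data =
  layer :: "nat \<Rightarrow> 'a set"
  step :: nat
  bracket :: "'a \<Rightarrow> 'a \<Rightarrow> 'a"
  mult :: "'a \<Rightarrow> 'a \<Rightarrow> 'a"

text \<open>
  The layers are indexed by \<open>1, \<dots>, step G\<close>; all other layers are trivial. The group axioms
  are consequences of the Baker-Campbell-Hausdorff formula and the Lie algebra axioms; they are
  listed because a graded group is a group by definition.
\<close>

locale graded_group =
  fixes G :: "'a::euclidean_space group_data"
  assumes bilinear_bracket: "bilinear (bracket G)"
    and bracket_self: "bracket G x x = 0"
    and jacobi: "bracket G x (bracket G y z) + bracket G y (bracket G z x)
                   + bracket G z (bracket G x y) = 0"
    and subspace_layer: "subspace (layer G i)"
    and layer_trivial: "i = 0 \<or> step G < i \<Longrightarrow> layer G i = {0}"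
    and step_pos: "1 \<le> step G"
    and top_layer: "layer G (step G) \<noteq> {0}"
    and layer_direct_sum: "\<exists>!h. (\<forall>i. h i \<in> layer G i) \<and> x = (\<Sum>i=1..step G. h i)"
    and layer_orthogonal: "i \<noteq> j \<Longrightarrow> u \<in> layer G i \<Longrightarrow> v \<in> layer G j \<Longrightarrow> u \<bullet> v = 0"
    and bracket_layer: "u \<in> layer G i \<Longrightarrow> v \<in> layer G j \<Longrightarrow> bracket G u v \<in> layer G (i + j)"
    and mult_bch: "mult G x y = bch (bracket G) (step G) x y"
    and mult_assoc: "mult G (mult G x y) z = mult G x (mult G y z)"
    and mult_0_left: "mult G 0 x = x"
    and mult_0_right: "mult G x 0 = x"
    and mult_minus_left: "mult G (- x) x = 0"
    and mult_minus_right: "mult G x (- x) = 0"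

definition layer_proj :: "'a::euclidean_space group_data \<Rightarrow> nat \<Rightarrow> 'a \<Rightarrow> 'a" where
  "layer_proj G j x = (THE h. (\<forall>i. h i \<in> layer G i) \<and> x = (\<Sum>i=1..step G. h i)) j"

definition dilation :: "'a::euclidean_space group_data \<Rightarrow> real \<Rightarrow> 'a \<Rightarrow> 'a" where
  "dilation G r x = (\<Sum>i=1..step G. r ^ i *\<^sub>R layer_proj G i x)"

definition homogeneous_subspace :: "'a::euclidean_space group_data \<Rightarrow> 'a set \<Rightarrow> bool" where
  "homogeneous_subspace G V \<longleftrightarrow> subspace V \<and> (\<forall>r>0. dilation G r ` V \<subseteq> V)"

definition homogeneous_family :: "'a::euclidean_space group_data \<Rightarrow> (nat \<Rightarrow> nat) \<Rightarrow> 'a set set" where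
  "homogeneous_family G ns =
     {V. homogeneous_subspace G V \<and>
         (\<exists>W. (\<forall>i\<in>{1..step G}. subspace (W i) \<and> W i \<subseteq> layer G i \<and> dim (W i) = ns i) \<and>
              V = span (\<Union>i\<in>{1..step G}. W i))}"


section \<open>Homogeneous distances\<close>

definition homogeneous_distance ::
    "'a::euclidean_space group_data \<Rightarrow> ('a \<Rightarrow> 'a \<Rightarrow> real) \<Rightarrow> bool" where
  "homogeneous_distance G d \<longleftrightarrow>
     Metric_space UNIV d \<and>
     (\<forall>x y z. d (mult G z x) (mult G z y) = d x y) \<and>
     (\<forall>x y r. 0 < r \<longrightarrow> d (dilation G r x) (dilation G r y) = r * d x y)"

abbreviation closed_ball :: "('a \<Rightarrow> 'a \<Rightarrow> real) \<Rightarrow> 'a \<Rightarrow> real \<Rightarrow> 'a set" where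
  "closed_ball d x r \<equiv> Metric_space.mcball UNIV d x r"

text \<open>
  The orthant \<open>[0, \<infinity>)\<^sup>k\<close>, as sequences indexed by \<open>1, \<dots>, k\<close> and extended by zero. On it the
  product topology of the type \<^typ>\<open>nat \<Rightarrow> real\<close> is the Euclidean one.
\<close>

definition orthant :: "nat \<Rightarrow> (nat \<Rightarrow> real) set" where
  "orthant k = {t. (\<forall>i. 0 \<le> t i) \<and> (\<forall>i. i \<notin> {1..k} \<longrightarrow> t i = 0)}"

definition multiradial :: "'a::euclidean_space group_data \<Rightarrow> ('a \<Rightarrow> 'a \<Rightarrow> real) \<Rightarrow> bool" where
  "multiradial G d \<longleftrightarrow>
     homogeneous_distance G d \<and>
     (\<exists>\<phi> :: (nat \<Rightarrow> real) \<Rightarrow> real.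
        continuous_on (orthant (step G)) \<phi> \<and>
        (\<forall>t\<in>orthant (step G). 0 \<le> \<phi> t) \<and>
        (\<forall>t\<in>orthant (step G). \<forall>i\<in>{1..step G}. \<forall>s\<ge>t i. \<phi> t \<le> \<phi> (t(i := s))) \<and>
        \<phi> (\<lambda>_. 0) = 0 \<and>
        (\<forall>C. \<exists>R. \<forall>t\<in>orthant (step G). R \<le> L2_set t {1..step G} \<longrightarrow> C \<le> \<phi> t) \<and>
        closed_ball d 0 1 =
          {x. \<phi> (\<lambda>i. if i \<in> {1..step G} then norm (layer_proj G i x) else 0) \<le> 1})"


section \<open>Measures constructed from coverings\<close>

definition ediam :: "('a \<Rightarrow> 'a \<Rightarrow> real) \<Rightarrow> 'a set \<Rightarrow> ennreal" where
  "ediam d S = (SUP x\<in>S. SUP y\<in>S. ennreal (d x y))"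

definition covering_measure ::
    "('a \<Rightarrow> 'a \<Rightarrow> real) \<Rightarrow> 'a set set \<Rightarrow> ('a set \<Rightarrow> ennreal) \<Rightarrow> 'a set \<Rightarrow> ennreal" where
  "covering_measure d F \<zeta> A =
     (SUP \<delta>\<in>{0<..}. INF C\<in>{C. C \<subseteq> F \<and> countable C \<and> A \<subseteq> \<Union>C \<and> (\<forall>B\<in>C. ediam d B \<le> ennreal \<delta>)}.
        (\<Sum>\<^sub>\<infinity>B\<in>C. \<zeta> B))"

definition closed_balls :: "('a \<Rightarrow> 'a \<Rightarrow> real) \<Rightarrow> 'a set set" where
  "closed_balls d = {closed_ball d x r |x r. 0 < r}"

definition spherical_measure :: "('a \<Rightarrow> 'a \<Rightarrow> real) \<Rightarrow> nat \<Rightarrow> 'a set \<Rightarrow> ennreal" where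
  "spherical_measure d N = covering_measure d (closed_balls d) (\<lambda>B. (ediam d B / 2) ^ N)"

text \<open>
  The Euclidean Hausdorff measure is normalized by assigning the value one to unit \<open>k\<close>-cubes,
  so that it agrees with Lebesgue measure on \<open>k\<close>-planes.
\<close>

definition hausdorff_unnormalized :: "nat \<Rightarrow> 'a::euclidean_space set \<Rightarrow> ennreal" where
  "hausdorff_unnormalized k = covering_measure dist UNIV (\<lambda>B. ediam dist B ^ k)"

definition unit_cube :: "nat \<Rightarrow> 'a::euclidean_space set" where
  "unit_cube k =
     (let E = (SOME E. E \<subseteq> Basis \<and> card E = k)
      in {(\<Sum>b\<in>E. t b *\<^sub>R b) |t. \<forall>b\<in>E. 0 \<le> t b \<and> t b \<le> 1})"

definition hausdorff_measure :: "nat \<Rightarrow> 'a::euclidean_space set \<Rightarrow> ennreal" where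
  "hausdorff_measure k A =
     hausdorff_unnormalized k A / hausdorff_unnormalized k (unit_cube k :: 'a set)"

definition spherical_factor :: "('a::euclidean_space \<Rightarrow> 'a \<Rightarrow> real) \<Rightarrow> 'a set \<Rightarrow> ennreal" where
  "spherical_factor d V =
     (SUP z\<in>closed_ball d 0 1. hausdorff_measure (dim V) (V \<inter> closed_ball d z 1))"

definition spherical_constant ::
    "'a::euclidean_space group_data \<Rightarrow> ('a \<Rightarrow> 'a \<Rightarrow> real) \<Rightarrow> (nat \<Rightarrow> nat) \<Rightarrow> ennreal" where
  "spherical_constant G d ns = (THE c. \<forall>V\<in>homogeneous_family G ns. spherical_factor d V = c)"

definition federer_density ::
    "('a \<Rightarrow> 'a \<Rightarrow> real) \<Rightarrow> nat \<Rightarrow> ('a set \<Rightarrow> ennreal) \<Rightarrow> 'a \<Rightarrow> ennreal" where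
  "federer_density d N \<mu> x =
     (INF \<epsilon>\<in>{0<..}. SUP B\<in>{B \<in> closed_balls d. x \<in> B \<and> ediam d B < ennreal \<epsilon>}.
        \<mu> B / (ediam d B / 2) ^ N)"


section \<open>Multivectors\<close>

text \<open>
  With \<open>n = CARD('n)\<close>, the space \<open>\<Lambda>\<^sub>n\<close> over \<open>'a\<close> is realized as the space of alternating
  \<open>n\<close>-linear forms on covectors, the latter being identified with vectors through the inner
  product: \<open>v\<^sub>1 \<and> \<dots> \<and> v\<^sub>n\<close> maps \<open>(w\<^sub>1, \<dots>, w\<^sub>n)\<close> to the determinant of the matrix
  \<open>(v\<^sub>i \<bullet> w\<^sub>j)\<close>.
\<close>

type_synonym ('a, 'n) multivector = "'a ^ 'n \<Rightarrow> real"

definition wedge :: "'a::euclidean_space ^ 'n \<Rightarrow> ('a, 'n::finite) multivector" where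
  "wedge v = (\<lambda>w. det (\<chi> i j. v $ i \<bullet> w $ j))"

text \<open>
  The \<open>(n + 1)\<close>-vector \<open>v \<and> \<xi>\<close>, evaluated at the covectors \<open>u, w\<^sub>1, \<dots>, w\<^sub>n\<close>: for \<open>\<xi>\<close> a
  wedge product this is the expansion of the determinant along the row of \<open>v\<close>.
\<close>

definition wedge_left ::
    "'a::euclidean_space \<Rightarrow> ('a, 'n::finite) multivector \<Rightarrow> 'a \<Rightarrow> 'a ^ 'n \<Rightarrow> real" where
  "wedge_left v \<xi> u w =
     (v \<bullet> u) * \<xi> w - (\<Sum>j\<in>UNIV. (v \<bullet> w $ j) * \<xi> (\<chi> i. if i = j then u else w $ i))"

text \<open>The multi-indices \<open>i\<^sub>1 < \<dots> < i\<^sub>n\<close> in \<open>{1..q}\<close>.\<close>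

definition multi_indices :: "nat \<Rightarrow> ('n::{finite,wellorder} \<Rightarrow> nat) set" where
  "multi_indices q = {I. strict_mono I \<and> range I \<subseteq> {1..q}}"

lemma finite_multi_indices: "finite (multi_indices q :: ('n::{finite,wellorder} \<Rightarrow> nat) set)"
proof (rule finite_subset)
  show "multi_indices q \<subseteq> (UNIV :: 'n set) \<rightarrow>\<^sub>E {1..q}"
    unfolding multi_indices_def by auto
  show "finite ((UNIV :: 'n set) \<rightarrow>\<^sub>E {1..q})"
    by (intro finite_PiE) auto
qed

definition multivector_sum ::
    "(nat \<Rightarrow> 'a::euclidean_space) \<Rightarrow> (('n::{finite,wellorder} \<Rightarrow> nat) \<Rightarrow> real)
      \<Rightarrow> ('a, 'n) multivector" where
  "multivector_sum b c = (\<lambda>w. \<Sum>I\<in>multi_indices DIM('a). c I * wedge (\<chi> i. b (I i)) w)"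

definition multivector_coeff ::
    "(nat \<Rightarrow> 'a::euclidean_space) \<Rightarrow> ('a, 'n::{finite,wellorder}) multivector
      \<Rightarrow> ('n \<Rightarrow> nat) \<Rightarrow> real" where
  "multivector_coeff b \<eta> =
     (THE c. (\<forall>I. I \<notin> multi_indices DIM('a) \<longrightarrow> c I = 0) \<and> multivector_sum b c = \<eta>)"

text \<open>
  The norm of a multivector induced by a scalar product \<open>\<beta>\<close> on \<open>'a\<close>, i.e. by the scalar product
  with \<open>\<langle>v\<^sub>1 \<and> \<dots> \<and> v\<^sub>n, w\<^sub>1 \<and> \<dots> \<and> w\<^sub>n\<rangle> = det (\<beta> v\<^sub>i w\<^sub>j)\<close>. It is computed in the basis \<open>b\<close> of
  \<open>'a\<close>, on which it does not depend.
\<close>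

definition multivector_norm ::
    "(nat \<Rightarrow> 'a::euclidean_space) \<Rightarrow> ('a \<Rightarrow> 'a \<Rightarrow> real)
      \<Rightarrow> ('a, 'n::{finite,wellorder}) multivector \<Rightarrow> real" where
  "multivector_norm b \<beta> \<eta> =
     sqrt (\<Sum>I\<in>multi_indices DIM('a). \<Sum>J\<in>multi_indices DIM('a).
             multivector_coeff b \<eta> I * multivector_coeff b \<eta> J * det (\<chi> i j. \<beta> (b (I i)) (b (J j))))"


section \<open>Left invariant frames\<close>

definition graded_basis :: "'a::euclidean_space group_data \<Rightarrow> (nat \<Rightarrow> 'a) \<Rightarrow> bool" where
  "graded_basis G e \<longleftrightarrow>
     inj_on e {1..DIM('a)} \<and>
     e ` {1..DIM('a)} \<subseteq> (\<Union>j\<in>{1..step G}. layer G j) \<and>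
     (\<forall>j\<in>{1..step G}. independent (layer G j \<inter> e ` {1..DIM('a)}) \<and>
                       span (layer G j \<inter> e ` {1..DIM('a)}) = layer G j)"

definition basis_degree :: "'a::euclidean_space group_data \<Rightarrow> (nat \<Rightarrow> 'a) \<Rightarrow> nat \<Rightarrow> nat" where
  "basis_degree G e i = (THE j. j \<in> {1..step G} \<and> e i \<in> layer G j)"

definition index_degree ::
    "'a::euclidean_space group_data \<Rightarrow> (nat \<Rightarrow> 'a) \<Rightarrow> ('n::{finite,wellorder} \<Rightarrow> nat) \<Rightarrow> nat" where
  "index_degree G e I = (\<Sum>k\<in>UNIV. basis_degree G e (I k))"

definition left_frame :: "'a::euclidean_space group_data \<Rightarrow> (nat \<Rightarrow> 'a) \<Rightarrow> 'a \<Rightarrow> nat \<Rightarrow> 'a" where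
  "left_frame G e p i = frechet_derivative (mult G p) (at 0) (e i)"

definition left_metric :: "'a::euclidean_space group_data \<Rightarrow> 'a \<Rightarrow> 'a \<Rightarrow> 'a \<Rightarrow> real" where
  "left_metric G p u v =
     frechet_derivative (mult G (- p)) (at p) u \<bullet> frechet_derivative (mult G (- p)) (at p) v"

definition degree_proj ::
    "'a::euclidean_space group_data \<Rightarrow> (nat \<Rightarrow> 'a) \<Rightarrow> 'a \<Rightarrow> nat
      \<Rightarrow> ('a, 'n::{finite,wellorder}) multivector \<Rightarrow> ('a, 'n) multivector" where
  "degree_proj G e p M \<eta> =
     multivector_sum (left_frame G e p)
       (\<lambda>I. if index_degree G e I = M then multivector_coeff (left_frame G e p) \<eta> I else 0)"


section \<open>Submanifolds\<close>

definition local_parametrization ::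
    "'a::euclidean_space set \<Rightarrow> (real ^ 'n::{finite,wellorder}) set
      \<Rightarrow> (real ^ 'n::{finite,wellorder} \<Rightarrow> 'a) \<Rightarrow> bool" where
  "local_parametrization S U \<Psi> \<longleftrightarrow>
     open U \<and> openin (top_of_set S) (\<Psi> ` U) \<and> (\<exists>\<Phi>. homeomorphism U (\<Psi> ` U) \<Psi> \<Phi>) \<and>
     \<Psi> differentiable_on U \<and>
     (\<forall>v. continuous_on U (\<lambda>x. frechet_derivative \<Psi> (at x) v)) \<and>
     (\<forall>x\<in>U. inj (frechet_derivative \<Psi> (at x)))"

text \<open>Embedded \<open>C\<^sup>1\<close> submanifolds of dimension \<open>CARD('n)\<close>.\<close>

definition C1_submanifold :: "'n::{finite,wellorder} itself \<Rightarrow> 'a::euclidean_space set \<Rightarrow> bool" where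
  "C1_submanifold _ S \<longleftrightarrow>
     (\<forall>p\<in>S. \<exists>(U :: (real ^ 'n::{finite,wellorder}) set) \<Psi>. local_parametrization S U \<Psi> \<and> p \<in> \<Psi> ` U)"

text \<open>Tangent vectors are the velocities of curves in \<open>S\<close>.\<close>

definition tangent_space :: "'a::euclidean_space set \<Rightarrow> 'a \<Rightarrow> 'a set" where
  "tangent_space S p =
     {v. \<exists>\<gamma>. \<gamma> 0 = p \<and> (\<forall>\<^sub>F t in nhds (0::real). \<gamma> t \<in> S) \<and> (\<gamma> has_vector_derivative v) (at 0)}"

definition tangent_multivector ::
    "'a::euclidean_space set \<Rightarrow> 'a \<Rightarrow> ('a, 'n::{finite,wellorder}) multivector" where
  "tangent_multivector S p =
     (SOME \<tau>. \<tau> \<noteq> (\<lambda>_. 0) \<and> (\<exists>v. \<tau> = wedge v \<and> span (range (($) v)) = tangent_space S p))"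

definition point_degree ::
    "'n::{finite,wellorder} itself \<Rightarrow> 'a::euclidean_space group_data \<Rightarrow> (nat \<Rightarrow> 'a)
      \<Rightarrow> 'a set \<Rightarrow> 'a \<Rightarrow> nat" where
  "point_degree _ G e S p =
     Max {M. degree_proj G e p M (tangent_multivector S p :: ('a, 'n) multivector) \<noteq> (\<lambda>_. 0)}"

definition manifold_degree ::
    "'n::{finite,wellorder} itself \<Rightarrow> 'a::euclidean_space group_data \<Rightarrow> (nat \<Rightarrow> 'a)
      \<Rightarrow> 'a set \<Rightarrow> nat" where
  "manifold_degree n G e S = Max (point_degree n G e S ` S)"

text \<open>
  Since \<open>X\<^sub>I\<close> is the left invariant extension of \<open>e\<^sub>I\<close>, the multivector at \<open>0\<close> whose left
  invariant extension takes a prescribed value at \<open>p\<close> has the same coefficients with respect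
  to the \<open>e\<^sub>I\<close> as this value has with respect to the \<open>X\<^sub>I(p)\<close>.
\<close>

definition homogeneous_tangent_space ::
    "'n::{finite,wellorder} itself \<Rightarrow> 'a::euclidean_space group_data \<Rightarrow> (nat \<Rightarrow> 'a)
      \<Rightarrow> 'a set \<Rightarrow> nat \<Rightarrow> 'a \<Rightarrow> 'a set" where
  "homogeneous_tangent_space _ G e S N p =
     (let \<xi> = multivector_sum e (multivector_coeff (left_frame G e p)
                (degree_proj G e p N (tangent_multivector S p :: ('a, 'n) multivector)))
      in {v. wedge_left v \<xi> = (\<lambda>_ _. 0)})"


section \<open>Riemannian metrics and the intrinsic measure\<close>

text \<open>Coinductively: a function is smooth if it is differentiable with smooth directional derivatives.\<close>

coinductive smooth :: "('a::real_normed_vector \<Rightarrow> real) \<Rightarrow> bool" where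
  "(\<And>x. (f has_derivative f' x) (at x)) \<Longrightarrow> (\<And>v. smooth (\<lambda>x. f' x v)) \<Longrightarrow> smooth f"

definition riemannian_metric :: "('a::euclidean_space \<Rightarrow> 'a \<Rightarrow> 'a \<Rightarrow> real) \<Rightarrow> bool" where
  "riemannian_metric g \<longleftrightarrow>
     (\<forall>p. bilinear (g p) \<and> (\<forall>u v. g p u v = g p v u) \<and> (\<forall>v. v \<noteq> 0 \<longrightarrow> 0 < g p v v)) \<and>
     (\<forall>u v. smooth (\<lambda>p. g p u v))"

text \<open>
  The Riemannian surface measure of a submanifold, as a Borel measure on the ambient space, is
  characterized by the area formula in all local parametrizations; it exists and is unique for
  every embedded \<open>C\<^sup>1\<close> submanifold.
\<close>

definition surface_measure ::
    "'n::{finite,wellorder} itself \<Rightarrow> ('a::euclidean_space \<Rightarrow> 'a \<Rightarrow> 'a \<Rightarrow> real)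
      \<Rightarrow> 'a set \<Rightarrow> 'a measure \<Rightarrow> bool" where
  "surface_measure _ g S \<sigma> \<longleftrightarrow>
     sets \<sigma> = sets borel \<and> emeasure \<sigma> (- S) = 0 \<and>
     (\<forall>(U :: (real ^ 'n::{finite,wellorder}) set) \<Psi>. local_parametrization S U \<Psi> \<longrightarrow>
        (\<forall>B\<in>sets borel. B \<subseteq> \<Psi> ` U \<longrightarrow>
           emeasure \<sigma> B =
             (\<integral>\<^sup>+x\<in>{x \<in> U. \<Psi> x \<in> B}.
                ennreal (sqrt (det (\<chi> i j. g (\<Psi> x) (frechet_derivative \<Psi> (at x) (axis i 1))
                                                (frechet_derivative \<Psi> (at x) (axis j 1)))))
              \<partial>lborel)))"

definition unit_tangent ::
    "'a::euclidean_space group_data \<Rightarrow> (nat \<Rightarrow> 'a) \<Rightarrow> ('a \<Rightarrow> 'a \<Rightarrow> 'a \<Rightarrow> real)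
      \<Rightarrow> 'a set \<Rightarrow> 'a \<Rightarrow> ('a, 'n::{finite,wellorder}) multivector" where
  "unit_tangent G e g S p =
     (\<lambda>w. tangent_multivector S p w /
            multivector_norm (left_frame G e p) (g p)
              (tangent_multivector S p :: ('a, 'n) multivector))"

text \<open>The integrand \<open>\<parallel>\<tau>\<^sub>N\<parallel>\<close>, with the norm of the left invariant metric.\<close>

definition intrinsic_density ::
    "'n::{finite,wellorder} itself \<Rightarrow> 'a::euclidean_space group_data \<Rightarrow> (nat \<Rightarrow> 'a)
      \<Rightarrow> ('a \<Rightarrow> 'a \<Rightarrow> 'a \<Rightarrow> real) \<Rightarrow> 'a set \<Rightarrow> nat \<Rightarrow> 'a \<Rightarrow> real" where
  "intrinsic_density _ G e g S N p =
     multivector_norm (left_frame G e p) (left_metric G p)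
       (degree_proj G e p N (unit_tangent G e g S p :: ('a, 'n) multivector))"

definition intrinsic_measure ::
    "'n::{finite,wellorder} itself \<Rightarrow> 'a::euclidean_space group_data \<Rightarrow> (nat \<Rightarrow> 'a)
      \<Rightarrow> ('a \<Rightarrow> 'a \<Rightarrow> 'a \<Rightarrow> real) \<Rightarrow> 'a measure \<Rightarrow> 'a set \<Rightarrow> nat \<Rightarrow> 'a set \<Rightarrow> ennreal" where
  "intrinsic_measure n G e g \<sigma> S N B =
     (\<integral>\<^sup>+p\<in>B \<inter> S. ennreal (intrinsic_density n G e g S N p) \<partial>\<sigma>)"

end

theory Submission
  imports Defs
begin

text \<open>
  The Federer density of \<open>\<mu>\<^sub>\<Sigma>\<close> is a positive finite constant \<open>c\<close> on the points of maximum degree: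
  the spherical factor of a multiradial distance is constant on homogeneous subspaces with layers of
  prescribed dimensions. Indeed, in \<open>z\<inverse>x\<close> the layer \<open>i\<close> of \<open>x\<close> is only translated by a quantity
  depending on the lower layers of \<open>x\<close>. Projecting these translations to \<open>V\<close> gives shears, which do
  not decrease the Hausdorff measure of \<open>V \<inter> B(z, 1)\<close> and, since the ball is multiradial, move it into
  \<open>V \<inter> B(0, 1)\<close>. So the maximum is attained at \<open>z = 0\<close>, where the section depends only on the
  dimensions of the layers.

  Constant density \<open>c\<close> implies \<open>\<mu> = c S\<^sup>N\<close>: coverings by small balls give \<open>\<mu> \<le> t S\<^sup>N\<close> for \<open>t > c\<close>, and
  disjoint families of small balls together with Vitali's lemma and outer regularity give
  \<open>t S\<^sup>N \<le> \<mu>\<close> for \<open>t < c\<close>. The points of lower degree are null for \<open>S\<^sup>N\<close> by assumption and for \<open>\<mu>\<^sub>\<Sigma>\<close>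
  because its density vanishes there.
\<close>

section \<open>Measures constructed from coverings\<close>

text \<open>The spherical measure and the Federer density both admit balls centred away from the
  point considered. Because of this match every covering ball that meets the set is a competitor in
  the density, and no constant is lost. In the other direction Vitali enlargement costs a factor
  \<open>5 ^ N\<close>; it is charged only to the tail of a summable family, so it vanishes in the
  limit. The spherical factor is controlled through the triangular form of the group law: layer
  \<open>i\<close> of a product contains layer \<open>i\<close> of the second factor additively and
  otherwise sees only its lower layers. A shear is compared with piecewise translations, which uses
  additivity of the Hausdorff outer measure on Borel sets, hence Caratheodory's criterion.
  Positivity of the constant comes from Lebesgue measure, finiteness from subdividing cubes. The
  tangent multivector is an arbitrary choice, fixed only up to a nonzero factor; charts cancel that
  factor and show that the intrinsic density and the set of points of maximum degree are
  Borel.\<close>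

lemma infsum_ennreal_eq_SUP:
  fixes f :: "'b \<Rightarrow> ennreal"
  shows "(\<Sum>\<^sub>\<infinity>x\<in>A. f x) = (SUP F\<in>{F. finite F \<and> F \<subseteq> A}. sum f F)"
  by (intro nonneg_infsum_complete) auto

lemma infsum_ennreal_leI:
  fixes f :: "'b \<Rightarrow> ennreal"
  assumes "\<And>F. finite F \<Longrightarrow> F \<subseteq> A \<Longrightarrow> sum f F \<le> c"
  shows "(\<Sum>\<^sub>\<infinity>x\<in>A. f x) \<le> c"
  unfolding infsum_ennreal_eq_SUP using assms by (auto intro: SUP_least)

lemma sum_le_infsum_ennreal:
  fixes f :: "'b \<Rightarrow> ennreal"
  assumes "finite F" "F \<subseteq> A"
  shows "sum f F \<le> (\<Sum>\<^sub>\<infinity>x\<in>A. f x)"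
  unfolding infsum_ennreal_eq_SUP using assms by (auto intro: SUP_upper)

lemma infsum_ennreal_mono_set:
  fixes f :: "'b \<Rightarrow> ennreal"
  assumes "A \<subseteq> B"
  shows "(\<Sum>\<^sub>\<infinity>x\<in>A. f x) \<le> (\<Sum>\<^sub>\<infinity>x\<in>B. f x)"
  using assms by (auto intro!: infsum_ennreal_leI sum_le_infsum_ennreal)

text \<open>The sets may overlap; each point of a finite partial sum is assigned to one set that
  contains it.\<close>

lemma infsum_ennreal_UNION_le:
  fixes f :: "'b \<Rightarrow> ennreal"
  shows "(\<Sum>\<^sub>\<infinity>x\<in>(\<Union>n. A n). f x) \<le> (\<Sum>n. \<Sum>\<^sub>\<infinity>x\<in>A n. f x)"
proof (rule infsum_ennreal_leI)
  fix F assume F: "finite F" "F \<subseteq> (\<Union>n. A n)"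
  have "\<forall>x\<in>F. \<exists>n. x \<in> A n"
    using F by auto
  then obtain n where n: "\<And>x. x \<in> F \<Longrightarrow> x \<in> A (n x)"
    by metis
  have "sum f F = (\<Sum>k\<in>n ` F. sum f {x \<in> F. n x = k})"
    by (rule sum.image_gen[OF F(1)])
  also have "\<dots> \<le> (\<Sum>k\<in>n ` F. \<Sum>\<^sub>\<infinity>x\<in>A k. f x)"
    using F n by (intro sum_mono sum_le_infsum_ennreal) fastforce+
  also have "\<dots> \<le> (\<Sum>n. \<Sum>\<^sub>\<infinity>x\<in>A n. f x)"
    using F by (intro sum_le_suminf) auto
  finally show "sum f F \<le> (\<Sum>n. \<Sum>\<^sub>\<infinity>x\<in>A n. f x)" .
qed

lemma infsum_ennreal_Un_le:
  fixes f :: "'b \<Rightarrow> ennreal"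
  shows "(\<Sum>\<^sub>\<infinity>x\<in>A \<union> B. f x) \<le> (\<Sum>\<^sub>\<infinity>x\<in>A. f x) + (\<Sum>\<^sub>\<infinity>x\<in>B. f x)"
proof (rule infsum_ennreal_leI)
  fix F assume F: "finite F" "F \<subseteq> A \<union> B"
  have "F = (F \<inter> A) \<union> (F - A)"
    by auto
  then have "sum f F = sum f (F \<inter> A) + sum f (F - A)"
    using F by (metis finite_Diff finite_Int sum.union_disjoint Int_Diff_disjoint Diff_disjoint inf_commute sum.Int_Diff)
  also have "\<dots> \<le> (\<Sum>\<^sub>\<infinity>x\<in>A. f x) + (\<Sum>\<^sub>\<infinity>x\<in>B. f x)"
    using F by (intro add_mono sum_le_infsum_ennreal) auto
  finally show "sum f F \<le> (\<Sum>\<^sub>\<infinity>x\<in>A. f x) + (\<Sum>\<^sub>\<infinity>x\<in>B. f x)" .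
qed

text \<open>A covering is a set of sets, so coinciding images count once; summing over a set of
  representatives can only lower the total.\<close>

lemma infsum_ennreal_image_le:
  fixes f :: "'b \<Rightarrow> ennreal"
  shows "(\<Sum>\<^sub>\<infinity>x\<in>h ` A. f x) \<le> (\<Sum>\<^sub>\<infinity>x\<in>A. f (h x))"
proof -
  obtain A' where A': "A' \<subseteq> A" "inj_on h A'" "h ` A = h ` A'"
    by (metis subset_image_inj subset_refl)
  have "(\<Sum>\<^sub>\<infinity>x\<in>h ` A. f x) = (\<Sum>\<^sub>\<infinity>x\<in>A'. f (h x))"
    using infsum_reindex[OF A'(2), of f] A' by (simp add: o_def)
  also have "\<dots> \<le> (\<Sum>\<^sub>\<infinity>x\<in>A. f (h x))"
    by (rule infsum_ennreal_mono_set[OF A'(1)])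
  finally show ?thesis .
qed

lemma infsum_ennreal_mono:
  fixes f g :: "'b \<Rightarrow> ennreal"
  assumes "\<And>x. x \<in> A \<Longrightarrow> f x \<le> g x"
  shows "(\<Sum>\<^sub>\<infinity>x\<in>A. f x) \<le> (\<Sum>\<^sub>\<infinity>x\<in>A. g x)"
  by (intro infsum_mono nonneg_summable_on_complete assms) auto

lemma infsum_ennreal_cmult:
  fixes f :: "'b \<Rightarrow> ennreal"
  shows "(\<Sum>\<^sub>\<infinity>x\<in>A. c * f x) = c * (\<Sum>\<^sub>\<infinity>x\<in>A. f x)"
  unfolding infsum_ennreal_eq_SUP sum_distrib_left[symmetric]
  by (rule SUP_mult_left_ennreal[symmetric])

text \<open>Serves the Vitali argument, where all but finitely many balls are enlarged and the
  enlarged ones must have small total weight.\<close>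

lemma infsum_ennreal_tail:
  fixes f :: "'b \<Rightarrow> ennreal"
  assumes fin: "(\<Sum>\<^sub>\<infinity>x\<in>A. f x) < \<infinity>" and "0 < \<epsilon>"
  obtains F where "finite F" "F \<subseteq> A" "(\<Sum>\<^sub>\<infinity>x\<in>A - F. f x) \<le> \<epsilon>"
proof (cases "(\<Sum>\<^sub>\<infinity>x\<in>A. f x) \<le> \<epsilon>")
  case True
  then show ?thesis
    using that[of "{}"] by auto
next
  case False
  define s where "s = (\<Sum>\<^sub>\<infinity>x\<in>A. f x)"
  have lt: "\<epsilon> < s" "s < \<infinity>"
    using False fin by (auto simp: s_def)
  have \<epsilon>: "\<epsilon> \<noteq> \<infinity>" and "0 < s"
    using lt by (auto intro: le_less_trans[OF zero_le])
  have "s - \<epsilon> < s"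
    using lt \<open>0 < \<epsilon>\<close> \<open>0 < s\<close> by (intro ennreal_between) auto
  then obtain F where F: "finite F" "F \<subseteq> A" "s - \<epsilon> < sum f F"
    unfolding s_def infsum_ennreal_eq_SUP less_SUP_iff by auto
  have s: "s = sum f F + (\<Sum>\<^sub>\<infinity>x\<in>A - F. f x)"
  proof -
    have "A = F \<union> (A - F)" using F by auto
    then show ?thesis
      unfolding s_def using F infsum_Un_disjoint[of f F "A - F"]
      by (simp add: nonneg_summable_on_complete Un_absorb1)
  qed
  have "(\<Sum>\<^sub>\<infinity>x\<in>A - F. f x) \<le> \<epsilon>"
  proof (rule ccontr)
    assume "\<not> ?thesis"
    then have "sum f F + \<epsilon> \<le> s"
      unfolding s by (intro add_left_mono) auto
    moreover have "sum f F \<noteq> \<infinity>"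
      using lt s by (auto simp: top_unique)
    moreover have "s < sum f F + \<epsilon>"
      using F(3) lt \<epsilon> minus_less_iff_ennreal[of \<epsilon> s "sum f F"] by auto
    ultimately show False by auto
  qed
  then show ?thesis using that F by blast
qed

section \<open>Outer measures defined by coverings of small mesh\<close>

definition coverings :: "('a \<Rightarrow> 'a \<Rightarrow> real) \<Rightarrow> 'a set set \<Rightarrow> 'a set \<Rightarrow> real \<Rightarrow> 'a set set set" where
  "coverings d F A \<delta> = {C. C \<subseteq> F \<and> countable C \<and> A \<subseteq> \<Union>C \<and> (\<forall>B\<in>C. ediam d B \<le> ennreal \<delta>)}"

lemma covering_measure_alt:
  "covering_measure d F \<zeta> A = (SUP \<delta>\<in>{0<..}. INF C\<in>coverings d F A \<delta>. (\<Sum>\<^sub>\<infinity>B\<in>C. \<zeta> B))"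
  unfolding covering_measure_def coverings_def ..

lemma covering_measure_leI:
  assumes "\<And>\<delta> \<epsilon>. 0 < \<delta> \<Longrightarrow> 0 < \<epsilon> \<Longrightarrow> \<exists>C\<in>coverings d F A \<delta>. (\<Sum>\<^sub>\<infinity>B\<in>C. \<zeta> B) \<le> c + ennreal \<epsilon>"
  shows "covering_measure d F \<zeta> A \<le> c"
  unfolding covering_measure_alt
proof (rule SUP_least)
  fix \<delta> :: real assume "\<delta> \<in> {0<..}"
  show "(INF C\<in>coverings d F A \<delta>. \<Sum>\<^sub>\<infinity>B\<in>C. \<zeta> B) \<le> c"
  proof (rule ennreal_le_epsilon)
    fix e :: real assume "0 < e"
    then obtain C where "C\<in>coverings d F A \<delta>" "(\<Sum>\<^sub>\<infinity>B\<in>C. \<zeta> B) \<le> c + ennreal e"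
      using assms \<open>\<delta> \<in> _\<close> by auto
    then show "(INF C\<in>coverings d F A \<delta>. \<Sum>\<^sub>\<infinity>B\<in>C. \<zeta> B) \<le> c + ennreal e"
      by (rule INF_lower2)
  qed
qed

lemma covering_measure_approx:
  assumes "covering_measure d F \<zeta> A < \<infinity>" "0 < \<delta>" "0 < \<epsilon>"
  obtains C where "C \<in> coverings d F A \<delta>"
    "(\<Sum>\<^sub>\<infinity>B\<in>C. \<zeta> B) \<le> covering_measure d F \<zeta> A + ennreal \<epsilon>"
proof -
  have "(INF C\<in>coverings d F A \<delta>. \<Sum>\<^sub>\<infinity>B\<in>C. \<zeta> B) \<le> covering_measure d F \<zeta> A"
    unfolding covering_measure_alt using assms by (intro SUP_upper) auto
  also have "\<dots> < covering_measure d F \<zeta> A + ennreal \<epsilon>"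
    using assms using ennreal_add_left_cancel_less[of "covering_measure d F \<zeta> A" 0 "ennreal \<epsilon>"] by simp
  finally show ?thesis
    unfolding INF_less_iff using that by (auto intro: less_imp_le)
qed

lemma covering_measure_mono:
  assumes "A \<subseteq> B"
  shows "covering_measure d F \<zeta> A \<le> covering_measure d F \<zeta> B"
  unfolding covering_measure_alt using assms
  by (intro SUP_mono' INF_superset_mono) (auto simp: coverings_def)

lemma covering_measure_empty [simp]: "covering_measure d F \<zeta> {} = 0"
proof -
  have "covering_measure d F \<zeta> {} \<le> 0"
    by (rule covering_measure_leI, rule bexI[of _ "{}"]) (auto simp: coverings_def)
  then show ?thesis by simp
qed

lemma covering_measure_UNION_le:
  "covering_measure d F \<zeta> (\<Union>n. A n) \<le> (\<Sum>n. covering_measure d F \<zeta> (A n))"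
    (is "_ \<le> (\<Sum>n. ?m n)")
proof (cases "\<forall>n. ?m n < \<infinity>")
  case False
  then obtain n where "?m n = \<infinity>"
    by (auto simp: less_top[symmetric])
  moreover have "?m n \<le> (\<Sum>n. ?m n)"
    using sum_le_suminf[of ?m "{n}"] by auto
  ultimately show ?thesis by (simp add: top_unique)
next
  case True
  show ?thesis
  proof (rule covering_measure_leI)
    fix \<delta> \<epsilon> :: real assume "0 < \<delta>" "0 < \<epsilon>"
    have "\<exists>C\<in>coverings d F (A n) \<delta>. (\<Sum>\<^sub>\<infinity>B\<in>C. \<zeta> B) \<le> ?m n + ennreal (\<epsilon> * (1/2) ^ Suc n)" for n
      using covering_measure_approx[of d F \<zeta> "A n" \<delta> "\<epsilon> * (1/2) ^ Suc n"] True \<open>0 < \<delta>\<close> \<open>0 < \<epsilon>\<close>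
      by auto
    then obtain C where C: "\<And>n. C n \<in> coverings d F (A n) \<delta>"
        "\<And>n. (\<Sum>\<^sub>\<infinity>B\<in>C n. \<zeta> B) \<le> ?m n + ennreal (\<epsilon> * (1/2) ^ Suc n)"
      by metis
    have "(\<Sum>\<^sub>\<infinity>B\<in>(\<Union>n. C n). \<zeta> B) \<le> (\<Sum>n. \<Sum>\<^sub>\<infinity>B\<in>C n. \<zeta> B)"
      by (rule infsum_ennreal_UNION_le)
    also have "\<dots> \<le> (\<Sum>n. ?m n + ennreal (\<epsilon> * (1/2) ^ Suc n))"
      using C by (intro suminf_le) auto
    also have "\<dots> = (\<Sum>n. ?m n) + (\<Sum>n. ennreal (\<epsilon> * (1/2) ^ Suc n))"
      by (intro suminf_add[symmetric]) auto
    also have "(\<Sum>n. ennreal (\<epsilon> * (1/2) ^ Suc n)) = ennreal \<epsilon>"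
      using \<open>0 < \<epsilon>\<close> sums_mult[OF power_half_series, of \<epsilon>]
      by (intro suminf_ennreal_eq) auto
    finally have "(\<Sum>\<^sub>\<infinity>B\<in>(\<Union>n. C n). \<zeta> B) \<le> (\<Sum>n. ?m n) + ennreal \<epsilon>" .
    moreover have "(\<Union>n. C n) \<in> coverings d F (\<Union>n. A n) \<delta>"
      using C(1) unfolding coverings_def by (simp add: UN_subset_iff subset_iff) blast
    ultimately show "\<exists>C\<in>coverings d F (\<Union>n. A n) \<delta>. (\<Sum>\<^sub>\<infinity>B\<in>C. \<zeta> B) \<le> (\<Sum>n. ?m n) + ennreal \<epsilon>"
      by blast
  qed
qed

lemma outer_measure_space_covering_measure:
  "outer_measure_space UNIV (covering_measure d F \<zeta>)"
  by (auto simp: outer_measure_space_def positive_def increasing_def countably_subadditive_def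
      intro: covering_measure_mono covering_measure_UNION_le)

lemma covering_measure_Un_le:
  "covering_measure d F \<zeta> (A \<union> B) \<le> covering_measure d F \<zeta> A + covering_measure d F \<zeta> B"
proof -
  \<comment> \<open>\<open>subadditive\<close> speaks of disjoint sets, so it is applied to
    \<open>A\<close> and \<open>B - A\<close>.\<close>
  have "subadditive UNIV (covering_measure d F \<zeta>)"
    using outer_measure_space_covering_measure[of d F \<zeta>] ring_of_sets_Pow[of UNIV]
    unfolding outer_measure_space_def
    by (auto intro: ring_of_sets.countably_subadditive_subadditive)
  then have "covering_measure d F \<zeta> (A \<union> (B - A))
      \<le> covering_measure d F \<zeta> A + covering_measure d F \<zeta> (B - A)"
    unfolding subadditive_def by blast
  also have "A \<union> (B - A) = A \<union> B"
    by auto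
  also have "covering_measure d F \<zeta> A + covering_measure d F \<zeta> (B - A)
      \<le> covering_measure d F \<zeta> A + covering_measure d F \<zeta> B"
    by (intro add_left_mono covering_measure_mono) auto
  finally show ?thesis .
qed

lemma ediam_leI:
  assumes "\<And>x y. x \<in> A \<Longrightarrow> y \<in> A \<Longrightarrow> d x y \<le> c"
  shows "ediam d A \<le> ennreal c"
  unfolding ediam_def using assms by (auto intro!: SUP_least ennreal_leI)

lemma ediam_ge: "x \<in> A \<Longrightarrow> y \<in> A \<Longrightarrow> ennreal (d x y) \<le> ediam d A"
  unfolding ediam_def by (meson SUP_upper SUP_upper2)

section \<open>Vitali coverings and the comparison of measures\<close>

lemma ennreal_divide_le_iff:
  fixes a c t :: ennreal
  assumes "0 < c" "c < top"
  shows "t \<le> a / c \<longleftrightarrow> t * c \<le> a"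
  using divide_less_ennreal[of c a t] assms by (metis less_le not_less)

text \<open>
  Zorn's lemma is applied to the disjoint subfamilies \<open>G\<close> such that a ball which meets \<open>G\<close> also meets a
  member of \<open>G\<close> of at least half its radius. A maximal one meets every ball of \<open>F\<close>: otherwise a ball of
  almost maximal radius among those missing \<open>G\<close> could be added.
\<close>

lemma (in Metric_space) Vitali_disjoint_subfamily:
  assumes F: "\<And>p. p \<in> F \<Longrightarrow> fst p \<in> M \<and> 0 < snd p \<and> snd p \<le> R"
  obtains G where "G \<subseteq> F"
    "pairwise (\<lambda>p q. disjnt (mcball (fst p) (snd p)) (mcball (fst q) (snd q))) G"
    "\<And>p. p \<in> F \<Longrightarrow>
      \<exists>q\<in>G. \<not> disjnt (mcball (fst p) (snd p)) (mcball (fst q) (snd q)) \<and> snd p \<le> 2 * snd q"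
proof -
  define b where "b p = mcball (fst p) (snd p)" for p
  define \<Omega> where "\<Omega> = {G. G \<subseteq> F \<and> pairwise (\<lambda>p q. disjnt (b p) (b q)) G \<and>
    (\<forall>p\<in>F. (\<exists>q\<in>G. \<not> disjnt (b p) (b q)) \<longrightarrow>
            (\<exists>q\<in>G. \<not> disjnt (b p) (b q) \<and> snd p \<le> 2 * snd q))}"
  have "\<exists>G\<in>\<Omega>. \<forall>X\<in>\<Omega>. G \<subseteq> X \<longrightarrow> X = G"
  proof (rule subset_Zorn_nonempty)
    show "\<Omega> \<noteq> {}"
      unfolding \<Omega>_def by (auto intro!: exI[of _ "{}"])
    fix C assume C: "C \<noteq> {}" "subset.chain \<Omega> C"
    have "C \<subseteq> \<Omega>" and lin: "\<And>X Y. X \<in> C \<Longrightarrow> Y \<in> C \<Longrightarrow> X \<subseteq> Y \<or> Y \<subseteq> X"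
      using C by (auto simp: subset_chain_def)
    have "disjnt (b p) (b q)" if pq: "p \<in> \<Union>C" "q \<in> \<Union>C" "p \<noteq> q" for p q
    proof -
      obtain X Y where XY: "X \<in> C" "Y \<in> C" "p \<in> X" "q \<in> Y"
        using pq by auto
      then obtain Z where "Z \<in> C" "p \<in> Z" "q \<in> Z"
        using lin[of X Y] by blast
      then show ?thesis
        using \<open>C \<subseteq> \<Omega>\<close> \<open>p \<noteq> q\<close> by (auto simp: \<Omega>_def pairwise_def)
    qed
    moreover have "\<Union>C \<subseteq> F"
      using \<open>C \<subseteq> \<Omega>\<close> by (auto simp: \<Omega>_def)
    moreover have "\<exists>q\<in>\<Union>C. \<not> disjnt (b p) (b q) \<and> snd p \<le> 2 * snd q"
      if "p \<in> F" "\<exists>q\<in>\<Union>C. \<not> disjnt (b p) (b q)" for p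
      using that \<open>C \<subseteq> \<Omega>\<close> unfolding \<Omega>_def by blast
    ultimately show "\<Union>C \<in> \<Omega>"
      unfolding \<Omega>_def by (simp add: pairwise_def)
  qed
  then obtain G where G: "G \<in> \<Omega>" and max: "\<And>X. X \<in> \<Omega> \<Longrightarrow> G \<subseteq> X \<Longrightarrow> X = G"
    by blast
  have "\<exists>q\<in>G. \<not> disjnt (b p) (b q)" if p: "p \<in> F" for p
  proof (rule ccontr)
    assume none: "\<not> ?thesis"
    define K where "K = {p \<in> F. \<forall>q\<in>G. disjnt (b p) (b q)}"
    have "p \<in> K"
      using p none by (auto simp: K_def)
    then have K: "K \<noteq> {}" "bdd_above (snd ` K)"
      using F by (blast, auto simp: K_def intro!: bdd_aboveI[of _ R])
    have "0 < snd p" "snd p \<le> Sup (snd ` K)"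
      using F[OF p] K \<open>p \<in> K\<close> by (auto intro!: cSup_upper)
    \<comment> \<open>The radii are bounded by \<open>R\<close> and the supremum is positive, so
      some ball of \<open>K\<close> has more than half of it as radius.\<close>
    then have "Sup (snd ` K) / 2 < Sup (snd ` K)"
      by linarith
    then obtain p0 where p0: "p0 \<in> K" "Sup (snd ` K) / 2 < snd p0"
      using less_cSup_iff[of "snd ` K" "Sup (snd ` K) / 2"] K by auto
    have half: "snd q \<le> 2 * snd p0" if "q \<in> K" for q
      using cSup_upper[of "snd q" "snd ` K"] that K p0 by auto
    have "insert p0 G \<in> \<Omega>"
      unfolding \<Omega>_def
    proof (intro CollectI conjI ballI impI)
      show "insert p0 G \<subseteq> F"
        using G p0 by (auto simp: \<Omega>_def K_def)
      show "pairwise (\<lambda>p q. disjnt (b p) (b q)) (insert p0 G)"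
        using G p0 by (auto simp: \<Omega>_def K_def pairwise_insert disjnt_sym)
      fix q assume q: "q \<in> F" "\<exists>r\<in>insert p0 G. \<not> disjnt (b q) (b r)"
      show "\<exists>r\<in>insert p0 G. \<not> disjnt (b q) (b r) \<and> snd q \<le> 2 * snd r"
      proof (cases "\<exists>r\<in>G. \<not> disjnt (b q) (b r)")
        case True
        then show ?thesis
          using G q by (auto simp: \<Omega>_def)
      next
        \<comment> \<open>A ball of \<open>F\<close> that misses \<open>G\<close> lies in
          \<open>K\<close>; the member it meets is then \<open>p0\<close>, whose radius is at least
          half as large.\<close>
        case False
        then show ?thesis
          using q half[of q] by (auto simp: K_def)
      qed
    qed
    then have "p0 \<in> G"
      using max[of "insert p0 G"] by auto
    then have "disjnt (b p0) (b p0)"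
      using p0 by (auto simp: K_def)
    moreover have "fst p0 \<in> b p0"
      using p0 F[of p0] by (auto simp: K_def b_def)
    ultimately show False
      by (auto simp: disjnt_def)
  qed
  then have "\<And>p. p \<in> F \<Longrightarrow> \<exists>q\<in>G. \<not> disjnt (b p) (b q) \<and> snd p \<le> 2 * snd q"
    using G by (simp add: \<Omega>_def)
  then show ?thesis
    using that[of G] G by (simp add: \<Omega>_def b_def)
qed

section \<open>Comparison of a Borel measure with the spherical measure\<close>

lemma emeasure_Union_le_infsum:
  assumes "countable C" "C \<subseteq> sets \<mu>"
  shows "emeasure \<mu> (\<Union>C) \<le> (\<Sum>\<^sub>\<infinity>B\<in>C. emeasure \<mu> B)"
proof (cases "C = {}")
  case False
  define f where "f = from_nat_into C"
  have f: "range f = C"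
    using assms False by (simp add: f_def)
  have "\<Union>C = (\<Union>n. \<Union>B\<in>f ` {..n}. B)"
    unfolding f[symmetric] by auto
  also have "emeasure \<mu> \<dots> = (SUP n. emeasure \<mu> (\<Union>B\<in>f ` {..n}. B))"
    using assms f by (intro SUP_emeasure_incseq[symmetric]) (force simp: incseq_def)+
  also have "\<dots> \<le> (\<Sum>\<^sub>\<infinity>B\<in>C. emeasure \<mu> B)"
  proof (rule SUP_least)
    fix n
    have "emeasure \<mu> (\<Union>B\<in>f ` {..n}. B) \<le> (\<Sum>B\<in>f ` {..n}. emeasure \<mu> B)"
      using assms f by (intro emeasure_subadditive_finite) auto
    also have "\<dots> \<le> (\<Sum>\<^sub>\<infinity>B\<in>C. emeasure \<mu> B)"
      using f by (intro sum_le_infsum_ennreal) auto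
    finally show "emeasure \<mu> (\<Union>B\<in>f ` {..n}. B) \<le> (\<Sum>\<^sub>\<infinity>B\<in>C. emeasure \<mu> B)" .
  qed
  finally show ?thesis .
qed auto

text \<open>The properties of a homogeneous distance on which the density theorem rests: its balls
  are compact neighbourhoods for the Euclidean topology and shrink to points. \<open>D\<close>
  stands for the diameter of a ball of radius one, so ball weights scale like powers of the
  radius.\<close>

locale scaled_ball_metric = Metric_space UNIV d
  for d :: "'a::euclidean_space \<Rightarrow> 'a \<Rightarrow> real" +
  fixes D :: real
  assumes compact_mcball: "compact (mcball x r)"
    and mcball_nhds: "open V \<Longrightarrow> x \<in> V \<Longrightarrow> \<exists>r>0. mcball x r \<subseteq> V"
    and interior_mcball: "0 < r \<Longrightarrow> x \<in> interior (mcball x r)"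
    and ediam_mcball: "0 < r \<Longrightarrow> ediam d (mcball x r) = ennreal (r * D)"
    and D_pos: "0 < D"
begin

lemma closed_ballsE:
  assumes "B \<in> closed_balls d"
  obtains x r where "B = mcball x r" "0 < r"
  using assms unfolding closed_balls_def by auto

lemma closed_ballsI: "0 < r \<Longrightarrow> mcball x r \<in> closed_balls d"
  unfolding closed_balls_def by auto

lemma closed_balls_borel: "B \<in> closed_balls d \<Longrightarrow> B \<in> sets borel"
  by (auto elim!: closed_ballsE intro: compact_mcball compact_imp_closed borel_closed)

abbreviation ball_weight :: "nat \<Rightarrow> 'a set \<Rightarrow> ennreal" where
  "ball_weight N B \<equiv> (ediam d B / 2) ^ N"

lemma ball_weight_mcball:
  assumes "0 < r"
  shows "ball_weight N (mcball x r) = ennreal ((r * D / 2) ^ N)"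
  using assms D_pos by (simp add: ediam_mcball divide_ennreal[symmetric] ennreal_power[symmetric])

lemma ball_weight_pos:
  assumes "B \<in> closed_balls d"
  shows "0 < ball_weight N B" "ball_weight N B < top"
  using assms D_pos by (auto elim!: closed_ballsE simp: ball_weight_mcball)

lemma federer_density_less:
  assumes "federer_density d N \<mu> x < t"
  shows "\<exists>\<epsilon>>0. \<forall>B\<in>closed_balls d. x \<in> B \<longrightarrow> ediam d B < ennreal \<epsilon> \<longrightarrow> \<mu> B \<le> t * ball_weight N B"
proof -
  from assms obtain \<epsilon> where \<epsilon>: "0 < \<epsilon>"
    and lt: "(SUP B\<in>{B \<in> closed_balls d. x \<in> B \<and> ediam d B < ennreal \<epsilon>}. \<mu> B / ball_weight N B) < t"
    unfolding federer_density_def INF_less_iff by auto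
  have "\<mu> B \<le> t * ball_weight N B"
    if "B \<in> closed_balls d" "x \<in> B" "ediam d B < ennreal \<epsilon>" for B
  proof -
    have "\<mu> B / ball_weight N B < t"
      using that by (intro le_less_trans[OF _ lt] SUP_upper) auto
    then show ?thesis
      using divide_less_ennreal[of "ball_weight N B" "\<mu> B" t] ball_weight_pos[OF that(1), of N]
      by (metis less_imp_le less_irrefl)
  qed
  then show ?thesis
    using \<epsilon> by blast
qed

lemma federer_density_greater:
  assumes "t < federer_density d N \<mu> x" "0 < \<epsilon>"
  obtains B where "B \<in> closed_balls d" "x \<in> B" "ediam d B < ennreal \<epsilon>" "t * ball_weight N B \<le> \<mu> B"
proof -
  have "t < (SUP B\<in>{B \<in> closed_balls d. x \<in> B \<and> ediam d B < ennreal \<epsilon>}. \<mu> B / ball_weight N B)"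
    using assms unfolding federer_density_def by (auto intro: less_le_trans INF_lower)
  then obtain B where B: "B \<in> closed_balls d" "x \<in> B" "ediam d B < ennreal \<epsilon>"
      "t < \<mu> B / ball_weight N B"
    unfolding less_SUP_iff by auto
  then have "t * ball_weight N B \<le> \<mu> B"
    using ennreal_divide_le_iff[OF ball_weight_pos[OF B(1), of N], of t "\<mu> B"] by auto
  then show ?thesis
    using that B by blast
qed

text \<open>The scale below which balls satisfy the density bound depends on the point. The set is
  exhausted by the parts on which one scale works, and from a finer covering only the balls that
  meet such a part are kept: each contains a point at which the bound applies to it.\<close>

lemma measure_le_spherical_measure:
  assumes \<mu>: "sets \<mu> = sets borel" and A: "A \<in> sets borel"
    and dens: "\<And>x. x \<in> A \<Longrightarrow> federer_density d N (emeasure \<mu>) x < ennreal t" and "0 < t"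
  shows "emeasure \<mu> A \<le> ennreal t * spherical_measure d N A"
proof (cases "spherical_measure d N A < \<infinity>")
  case False
  then show ?thesis
    using \<open>0 < t\<close> by (simp add: ennreal_mult_top less_top[symmetric])
next
  case True
  \<comment> \<open>The points for which the scale \<open>1 / Suc k\<close> is good enough; these
    sets increase with \<open>k\<close>.\<close>
  define A' where "A' k = {x \<in> A. \<forall>B\<in>closed_balls d. x \<in> B \<longrightarrow> ediam d B \<le> ennreal (1 / Suc k) \<longrightarrow>
      emeasure \<mu> B \<le> ennreal t * ball_weight N B}" for k
  have A'_mono: "A' k \<subseteq> A' l" if "k \<le> l" for k l
  proof -
    have "1 / real (Suc l) \<le> 1 / real (Suc k)"
      using that by (intro divide_left_mono) auto
    then show ?thesis
      unfolding A'_def by (auto dest!: ennreal_leI intro: order_trans)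
  qed
  have A_sub: "\<exists>k. x \<in> A' k" if x: "x \<in> A" for x
  proof -
    obtain \<epsilon> where \<epsilon>: "0 < \<epsilon>" "\<And>B. B \<in> closed_balls d \<Longrightarrow> x \<in> B \<Longrightarrow> ediam d B < ennreal \<epsilon> \<Longrightarrow>
        emeasure \<mu> B \<le> ennreal t * ball_weight N B"
      using federer_density_less[OF dens[OF x]] by blast
    obtain k where "1 / real (Suc k) < \<epsilon>"
      using \<epsilon>(1) nat_approx_posE by blast
    then have "ennreal (1 / real (Suc k)) < ennreal \<epsilon>"
      by (simp add: ennreal_lessI \<epsilon>)
    then have "x \<in> A' k"
      using x \<epsilon>(2) unfolding A'_def by (auto intro: le_less_trans)
    then show ?thesis ..
  qed
  show ?thesis
  proof (rule ennreal_le_epsilon)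
    fix e :: real assume "0 < e"
    have "\<exists>H\<in>sets borel. A' k \<subseteq> H \<and> emeasure \<mu> H \<le> ennreal t * spherical_measure d N A + ennreal e" for k
    proof -
      \<comment> \<open>The tolerance \<open>e / t\<close> becomes \<open>e\<close> after
        multiplication by \<open>t\<close>.\<close>
      obtain C where C: "C \<in> coverings d (closed_balls d) A (1 / Suc k)"
        "(\<Sum>\<^sub>\<infinity>B\<in>C. ball_weight N B) \<le> spherical_measure d N A + ennreal (e / t)"
        using covering_measure_approx[of d "closed_balls d" "ball_weight N" A "1 / Suc k" "e / t"]
          True \<open>0 < e\<close> \<open>0 < t\<close> unfolding spherical_measure_def by auto
      define C' where "C' = {B \<in> C. B \<inter> A' k \<noteq> {}}"
      have C': "countable C'" "C' \<subseteq> C" "C' \<subseteq> closed_balls d"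
        using C(1) by (auto simp: C'_def coverings_def)
      have "emeasure \<mu> (\<Union>C') \<le> (\<Sum>\<^sub>\<infinity>B\<in>C'. emeasure \<mu> B)"
        using C' closed_balls_borel \<mu> by (intro emeasure_Union_le_infsum) auto
      also have "\<dots> \<le> (\<Sum>\<^sub>\<infinity>B\<in>C'. ennreal t * ball_weight N B)"
      proof (rule infsum_ennreal_mono)
        fix B assume B: "B \<in> C'"
        then obtain x where "x \<in> B" "x \<in> A' k"
          by (auto simp: C'_def)
        moreover have "B \<in> closed_balls d" "ediam d B \<le> ennreal (1 / Suc k)"
          using B C' C(1) by (auto simp: coverings_def)
        ultimately show "emeasure \<mu> B \<le> ennreal t * ball_weight N B"
          by (auto simp: A'_def)
      qed
      also have "\<dots> \<le> ennreal t * (\<Sum>\<^sub>\<infinity>B\<in>C. ball_weight N B)"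
        unfolding infsum_ennreal_cmult using C' by (intro mult_left_mono infsum_ennreal_mono_set) auto
      also have "\<dots> \<le> ennreal t * (spherical_measure d N A + ennreal (e / t))"
        using C(2) by (intro mult_left_mono) auto
      also have "\<dots> = ennreal t * spherical_measure d N A + ennreal e"
        using \<open>0 < e\<close> \<open>0 < t\<close> by (simp add: distrib_left ennreal_mult[symmetric])
      finally have "emeasure \<mu> (\<Union>C') \<le> ennreal t * spherical_measure d N A + ennreal e" .
      moreover have "A' k \<subseteq> \<Union>C'"
      proof
        fix x assume x: "x \<in> A' k"
        then have "x \<in> \<Union>C"
          using C(1) by (auto simp: A'_def coverings_def)
        then show "x \<in> \<Union>C'"
          using x by (auto simp: C'_def)
      qed
      moreover have "\<Union>C' \<in> sets borel"
        using C' closed_balls_borel by (intro sets.countable_Union) auto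
      ultimately show ?thesis
        by blast
    qed
    \<comment> \<open>The sets \<open>A' k\<close> need not be measurable, so they are replaced by Borel hulls; \<open>A\<close> lies in the
      lower limit of the hulls because the \<open>A' k\<close> increase to \<open>A\<close>.\<close>
    then obtain H where H: "\<And>k. H k \<in> sets borel" "\<And>k. A' k \<subseteq> H k"
        "\<And>k. emeasure \<mu> (H k) \<le> ennreal t * spherical_measure d N A + ennreal e"
      by metis
    have "A \<subseteq> (\<Union>j. \<Inter>k\<in>{j..}. H k)"
    proof
      fix x assume "x \<in> A"
      then obtain j where "x \<in> A' j"
        using A_sub by blast
      then have "x \<in> H k" if "j \<le> k" for k
        using A'_mono[OF that] H(2) by blast
      then show "x \<in> (\<Union>j. \<Inter>k\<in>{j..}. H k)"
        by auto
    qed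
    then have "emeasure \<mu> A \<le> emeasure \<mu> (\<Union>j. \<Inter>k\<in>{j..}. H k)"
      using H(1) \<mu> by (intro emeasure_mono) auto
    also have "\<dots> = (SUP j. emeasure \<mu> (\<Inter>k\<in>{j..}. H k))"
      using H(1) \<mu> by (intro SUP_emeasure_incseq[symmetric]) (auto simp: incseq_def intro!: sets.countable_INT)
    also have "\<dots> \<le> ennreal t * spherical_measure d N A + ennreal e"
    proof (rule SUP_least)
      fix j
      have "emeasure \<mu> (\<Inter>k\<in>{j..}. H k) \<le> emeasure \<mu> (H j)"
        using H(1) \<mu> by (intro emeasure_mono) auto
      also note H(3)
      finally show "emeasure \<mu> (\<Inter>k\<in>{j..}. H k) \<le> ennreal t * spherical_measure d N A + ennreal e" .
    qed
    finally show "emeasure \<mu> A \<le> ennreal t * spherical_measure d N A + ennreal e" .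
  qed
qed

text \<open>A disjoint Vitali family of balls inside \<open>V\<close>, each of measure at least
  \<open>t\<close> times its weight, has total weight at most the measure of \<open>V\<close>
  divided by \<open>t\<close>. Finitely many balls \<open>K\<close> keep their size and the others
  are enlarged five times. A point outside the closed union of \<open>K\<close> lies in a small ball
  missing \<open>K\<close>, hence in an enlarged ball.\<close>

lemma spherical_measure_le_measure:
  assumes \<mu>: "sets \<mu> = sets borel" and V: "open V" "A \<subseteq> V" "emeasure \<mu> V < \<infinity>"
    and dens: "\<And>x. x \<in> A \<Longrightarrow> ennreal t < federer_density d N (emeasure \<mu>) x" and "0 < t"
  shows "spherical_measure d N A \<le> emeasure \<mu> V / ennreal t"
  unfolding spherical_measure_def
proof (rule covering_measure_leI)
  fix \<delta> \<epsilon> :: real assume "0 < \<delta>" "0 < \<epsilon>"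
  define b where "b p = mcball (fst p) (snd p)" for p
  define b5 where "b5 p = mcball (fst p) (5 * snd p)" for p
  \<comment> \<open>The bound on \<open>5 * snd p * D\<close> keeps even the enlarged balls within
    the mesh \<open>\<delta>\<close>.\<close>
  define F where "F = {p. 0 < snd p \<and> 5 * snd p * D \<le> \<delta> \<and> b p \<subseteq> V \<and>
    ennreal t * ball_weight N (b p) \<le> emeasure \<mu> (b p)}"
  have fine: "\<exists>p\<in>F. x \<in> b p \<and> b p \<subseteq> W" if x: "x \<in> A" and W: "open W" "x \<in> W" for x W
  proof -
    obtain r where r: "0 < r" "mcball x r \<subseteq> V \<inter> W"
      using mcball_nhds[of "V \<inter> W" x] V x W by auto
    \<comment> \<open>The centre of \<open>B\<close> is unknown. A diameter below \<open>r\<close>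
      together with \<open>x \<in> B\<close> still puts \<open>B\<close> inside
      \<open>mcball x r\<close>; \<open>\<delta> / 5\<close> leaves room for the
      enlargement.\<close>
    obtain B where B: "B \<in> closed_balls d" "x \<in> B" "ediam d B < ennreal (min r (\<delta> / 5))"
        "ennreal t * ball_weight N B \<le> emeasure \<mu> B"
      using federer_density_greater[OF dens[OF x], of "min r (\<delta> / 5)"] r \<open>0 < \<delta>\<close> by auto
    obtain y s where y: "B = mcball y s" "0 < s"
      using B(1) by (rule closed_ballsE)
    have "ennreal (s * D) < ennreal (min r (\<delta> / 5))"
      using B(3) y by (simp add: ediam_mcball)
    then have sD: "s * D < min r (\<delta> / 5)"
      using y D_pos by (simp add: ennreal_less_iff)
    have "B \<subseteq> mcball x r"
    proof
      fix z assume "z \<in> B"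
      then have "ennreal (d x z) \<le> ediam d B"
        using B(2) by (intro ediam_ge)
      then have "d x z \<le> s * D"
        using y D_pos by (simp add: ediam_mcball)
      then show "z \<in> mcball x r"
        using sD by simp
    qed
    then have "(y, s) \<in> F" "b (y, s) = B"
      using y sD r B by (auto simp: F_def b_def)
    then show ?thesis
      using B(2) \<open>B \<subseteq> mcball x r\<close> r by (intro bexI[of _ "(y, s)"]) auto
  qed
  have "fst p \<in> UNIV \<and> 0 < snd p \<and> snd p \<le> \<delta> / (5 * D)" if "p \<in> F" for p
    using that D_pos by (auto simp: F_def field_simps)
  then obtain G where G: "G \<subseteq> F" "pairwise (\<lambda>p q. disjnt (b p) (b q)) G"
      "\<And>p. p \<in> F \<Longrightarrow> \<exists>q\<in>G. \<not> disjnt (b p) (b q) \<and> snd p \<le> 2 * snd q"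
    using Vitali_disjoint_subfamily[of F "\<delta> / (5 * D)"] unfolding b_def by blast
  have snd_pos: "0 < snd p" if "p \<in> G" for p
    using that G(1) by (auto simp: F_def)
  have b_ne: "fst p \<in> interior (b p)" if "p \<in> G" for p
    using snd_pos[OF that] by (simp add: b_def interior_mcball)
  have b_in: "fst p \<in> b p" if "p \<in> G" for p
    using snd_pos[OF that] by (simp add: b_def)
  have inj: "inj_on b G"
    using G(2) b_in unfolding inj_on_def pairwise_def disjnt_def by blast
  \<comment> \<open>Disjoint balls with nonempty interior in a separable space.\<close>
  have "countable (b ` G)"
  proof (rule countable_disjoint_nonempty_interior_subsets)
    show "disjoint (b ` G)"
      using G(2) by (auto simp: pairwise_def)
  qed (use b_ne in auto)
  then have "countable G"
    using inj by (rule countable_image_inj_on)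
  have tsum: "ennreal t * (\<Sum>\<^sub>\<infinity>p\<in>G. ball_weight N (b p)) \<le> emeasure \<mu> V"
    unfolding infsum_ennreal_cmult[symmetric]
  proof (rule infsum_ennreal_leI)
    fix K assume K: "finite K" "K \<subseteq> G"
    have bs: "b p \<in> sets \<mu>" for p
      unfolding b_def \<mu> by (simp add: compact_mcball compact_imp_closed)
    have "(\<Sum>p\<in>K. ennreal t * ball_weight N (b p)) \<le> (\<Sum>p\<in>K. emeasure \<mu> (b p))"
      using K G(1) by (intro sum_mono) (auto simp: F_def)
    also have "\<dots> = emeasure \<mu> (\<Union>p\<in>K. b p)"
    proof (rule sum_emeasure)
      show "disjoint_family_on b K"
        using K(2) G(2) unfolding disjoint_family_on_def pairwise_def disjnt_def by blast
    qed (use K bs in auto)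
    also have "\<dots> \<le> emeasure \<mu> V"
      using K G(1) V \<mu> by (intro emeasure_mono) (auto simp: F_def)
    finally show "(\<Sum>p\<in>K. ennreal t * ball_weight N (b p)) \<le> emeasure \<mu> V" .
  qed
  have "0 < ennreal t" "ennreal t < top"
    using \<open>0 < t\<close> by auto
  then have sum_le: "(\<Sum>\<^sub>\<infinity>p\<in>G. ball_weight N (b p)) \<le> emeasure \<mu> V / ennreal t"
    using tsum by (simp add: ennreal_divide_le_iff mult.commute)
  also have "\<dots> < \<infinity>"
    using V(3) \<open>0 < t\<close> by (simp add: ennreal_divide_eq_top_iff less_top[symmetric])
  \<comment> \<open>The tail bound is divided by \<open>5 ^ N\<close>, the factor by which
    enlargement multiplies the weight.\<close>
  finally obtain K where K: "finite K" "K \<subseteq> G"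
      "(\<Sum>\<^sub>\<infinity>p\<in>G - K. ball_weight N (b p)) \<le> ennreal (\<epsilon> / 5 ^ N)"
    using infsum_ennreal_tail[of "\<lambda>p. ball_weight N (b p)" G "ennreal (\<epsilon> / 5 ^ N)"] \<open>0 < \<epsilon>\<close> by auto
  define C where "C = b ` K \<union> b5 ` (G - K)"
  have weight5: "ball_weight N (b5 p) = ennreal (5 ^ N) * ball_weight N (b p)" if "p \<in> G" for p
    using snd_pos[OF that] D_pos unfolding b_def b5_def
    by (simp add: ball_weight_mcball ennreal_mult[symmetric] power_mult_distrib[symmetric] mult.assoc)
  have "(\<Sum>\<^sub>\<infinity>B\<in>C. ball_weight N B)
      \<le> (\<Sum>\<^sub>\<infinity>B\<in>b ` K. ball_weight N B) + (\<Sum>\<^sub>\<infinity>B\<in>b5 ` (G - K). ball_weight N B)"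
    unfolding C_def by (rule infsum_ennreal_Un_le)
  also have "\<dots> \<le> (\<Sum>\<^sub>\<infinity>p\<in>K. ball_weight N (b p)) + (\<Sum>\<^sub>\<infinity>p\<in>G - K. ball_weight N (b5 p))"
    by (intro add_mono infsum_ennreal_image_le)
  also have "\<dots> \<le> (\<Sum>\<^sub>\<infinity>p\<in>G. ball_weight N (b p)) + ennreal (5 ^ N) * (\<Sum>\<^sub>\<infinity>p\<in>G - K. ball_weight N (b p))"
    unfolding infsum_ennreal_cmult[symmetric] using K weight5
    by (intro add_mono infsum_ennreal_mono_set infsum_ennreal_mono) auto
  also have "\<dots> \<le> emeasure \<mu> V / ennreal t + ennreal (5 ^ N) * ennreal (\<epsilon> / 5 ^ N)"
    using K sum_le by (intro add_mono mult_left_mono) auto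
  also have "ennreal (5 ^ N) * ennreal (\<epsilon> / 5 ^ N) = ennreal \<epsilon>"
    using \<open>0 < \<epsilon>\<close> by (simp add: ennreal_mult[symmetric])
  finally have "(\<Sum>\<^sub>\<infinity>B\<in>C. ball_weight N B) \<le> emeasure \<mu> V / ennreal t + ennreal \<epsilon>" .
  moreover have "C \<in> coverings d (closed_balls d) A \<delta>"
    unfolding coverings_def
  proof (intro CollectI conjI)
    show "C \<subseteq> closed_balls d"
      using snd_pos K(2) by (auto simp: C_def b_def b5_def intro!: closed_ballsI)
    show "countable C"
      using \<open>countable G\<close> K(1) by (auto simp: C_def intro: countable_subset countable_finite)
    show "\<forall>B\<in>C. ediam d B \<le> ennreal \<delta>"
    proof
      fix B assume "B \<in> C"
      then obtain p where p: "p \<in> G" "B = b p \<or> B = b5 p"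
        using K(2) by (auto simp: C_def)
      have "5 * snd p * D \<le> \<delta>"
        using p G(1) by (auto simp: F_def)
      moreover have "0 < snd p * D"
        using snd_pos[OF p(1)] D_pos by simp
      ultimately have "snd p * D \<le> \<delta>" "5 * (snd p * D) \<le> \<delta>"
        by linarith+
      then show "ediam d B \<le> ennreal \<delta>"
        using p snd_pos[OF p(1)] D_pos by (auto simp: b_def b5_def ediam_mcball mult.assoc intro!: ennreal_leI)
    qed
    show "A \<subseteq> \<Union>C"
    proof
      fix x assume x: "x \<in> A"
      show "x \<in> \<Union>C"
      proof (cases "x \<in> (\<Union>p\<in>K. b p)")
        case False
        have "closed (\<Union>p\<in>K. b p)"
          using K(1) by (intro closed_UN) (auto simp: b_def compact_mcball compact_imp_closed)
        then have "open (- (\<Union>p\<in>K. b p))"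
          by (rule open_Compl)
        then obtain p where p: "p \<in> F" "x \<in> b p" "b p \<subseteq> - (\<Union>p\<in>K. b p)"
          using fine[OF x, of "- (\<Union>p\<in>K. b p)"] False by blast
        obtain q where q: "q \<in> G" "\<not> disjnt (b p) (b q)" "snd p \<le> 2 * snd q"
          using G(3)[OF p(1)] by blast
        have "q \<notin> K"
          using p(3) q(2) by (auto simp: disjnt_def)
        obtain z where z: "z \<in> b p" "z \<in> b q"
          using q(2) by (auto simp: disjnt_def)
        \<comment> \<open>Passing through the common point \<open>z\<close> costs one radius of
          \<open>q\<close> and two of \<open>p\<close>, that is at most five radii of
          \<open>q\<close>.\<close>
        have "d (fst q) x \<le> d (fst q) z + d z (fst p) + d (fst p) x"
          using triangle[of "fst q" z x] triangle[of z "fst p" x] by simp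
        also have "\<dots> \<le> snd q + snd p + snd p"
          using z p(2) commute[of z "fst p"] by (auto simp: b_def)
        also have "\<dots> \<le> 5 * snd q"
          using q(3) by simp
        finally have "x \<in> b5 q"
          by (simp add: b5_def)
        then show ?thesis
          using q(1) \<open>q \<notin> K\<close> by (auto simp: C_def)
      qed (auto simp: C_def)
    qed
  qed
  ultimately show "\<exists>C\<in>coverings d (closed_balls d) A \<delta>. (\<Sum>\<^sub>\<infinity>B\<in>C. ball_weight N B) \<le> emeasure \<mu> V / ennreal t + ennreal \<epsilon>"
    by blast
qed

text \<open>
  Since the density is finite on \<open>A\<close>, every point of \<open>A\<close> is interior to a ball of finite measure, and
  outer regularity is applied inside countably many such balls.
\<close>

theorem measure_eq_spherical_measure:
  assumes \<mu>: "sets \<mu> = sets borel" and A: "A \<in> sets borel"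
    and dens: "\<And>x. x \<in> A \<Longrightarrow> federer_density d N (emeasure \<mu>) x = ennreal c" and "0 < c"
  shows "emeasure \<mu> A = ennreal c * spherical_measure d N A"
proof (rule antisym)
  let ?S = "spherical_measure d N"
  show "emeasure \<mu> A \<le> ennreal c * ?S A"
  proof (cases "?S A")
    case (real s)
    show ?thesis
    proof (rule ennreal_le_epsilon)
      fix e :: real assume "0 < e"
      \<comment> \<open>Then \<open>(t - c) * s \<le> e\<close>; the summand one covers the case
        \<open>s = 0\<close>.\<close>
      define t where "t = c + e / (s + 1)"
      have t: "c < t" "0 < t"
        using real \<open>0 < e\<close> \<open>0 < c\<close> by (auto simp: t_def add_pos_pos)
      have "emeasure \<mu> A \<le> ennreal t * ?S A"
        using t dens by (intro measure_le_spherical_measure \<mu> A) (auto simp: ennreal_less_iff \<open>0 < c\<close> less_imp_le)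
      also have "\<dots> = ennreal (t * s)"
        using real t by (simp add: ennreal_mult)
      also have "t * s \<le> c * s + e"
        using real \<open>0 < e\<close> by (simp add: t_def field_simps)
      also have "ennreal (c * s + e) = ennreal c * ?S A + ennreal e"
        using real \<open>0 < c\<close> \<open>0 < e\<close> by (simp add: ennreal_mult)
      finally show "emeasure \<mu> A \<le> ennreal c * ?S A + ennreal e"
        by (simp add: ennreal_leI)
    qed
  qed (use \<open>0 < c\<close> in \<open>simp add: ennreal_mult_top\<close>)
  define \<U> where "\<U> = {interior B |B. B \<in> closed_balls d \<and> emeasure \<mu> B < \<infinity>}"
  have cov: "A \<subseteq> \<Union>\<U>"
  proof
    fix x assume x: "x \<in> A"
    have "federer_density d N (emeasure \<mu>) x < ennreal (c + 1)"
      using dens[OF x] \<open>0 < c\<close> by (simp add: ennreal_less_iff)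
    from federer_density_less[OF this]
    obtain \<epsilon> where \<epsilon>: "0 < \<epsilon>" "\<And>B. B \<in> closed_balls d \<Longrightarrow> x \<in> B \<Longrightarrow> ediam d B < ennreal \<epsilon> \<Longrightarrow>
        emeasure \<mu> B \<le> ennreal (c + 1) * ball_weight N B"
      by blast
    define r where "r = \<epsilon> / (2 * D)"
    have r: "0 < r" "r * D < \<epsilon>"
      using \<epsilon>(1) D_pos by (auto simp: r_def)
    have B: "mcball x r \<in> closed_balls d" "x \<in> mcball x r"
      using r by (auto intro: closed_ballsI)
    have "emeasure \<mu> (mcball x r) \<le> ennreal (c + 1) * ball_weight N (mcball x r)"
      using r \<epsilon>(1) by (intro \<epsilon>(2) B) (simp add: ediam_mcball ennreal_lessI)
    also have "\<dots> < \<infinity>"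
      using ball_weight_pos[OF B(1), of N] by (simp add: ennreal_mult_less_top)
    finally show "x \<in> \<Union>\<U>"
      using B interior_mcball[OF r(1), of x] unfolding \<U>_def by blast
  qed
  show "ennreal c * ?S A \<le> emeasure \<mu> A"
  proof (cases "A = {}")
    case True
    then show ?thesis
      by (simp add: spherical_measure_def)
  next
    case False
    obtain \<U>' where \<U>': "\<U>' \<subseteq> \<U>" "countable \<U>'" "\<Union>\<U>' = \<Union>\<U>"
      using Lindelof[of \<U>] by (auto simp: \<U>_def)
    then have "\<U>' \<noteq> {}"
      using cov False by blast
    define Q where "Q n = from_nat_into \<U>' n" for n
    have Q: "Q n \<in> \<U>" for n
      using \<U>' \<open>\<U>' \<noteq> {}\<close> by (metis Q_def from_nat_into subsetD)
    have "range Q = \<U>'"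
      using \<U>' \<open>\<U>' \<noteq> {}\<close> by (simp add: Q_def)
    have Q_open: "open (Q n)" for n
      using Q[of n] by (auto simp: \<U>_def)
    have Q_fin: "emeasure \<mu> (Q n) < \<infinity>" for n
    proof -
      obtain B where B: "Q n = interior B" "B \<in> closed_balls d" "emeasure \<mu> B < \<infinity>"
        using Q[of n] by (auto simp: \<U>_def)
      have "emeasure \<mu> (Q n) \<le> emeasure \<mu> B"
        using B closed_balls_borel \<mu> by (intro emeasure_mono) (auto simp: interior_subset)
      then show ?thesis
        using B(3) by (rule le_less_trans)
    qed
    \<comment> \<open>A countable Borel partition of \<open>A\<close> whose parts lie in open sets
      of finite measure.\<close>
    define P where "P n = A \<inter> disjointed Q n" for n
    have P_sets: "P n \<in> sets borel" for n
    proof -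
      have "range (disjointed Q) \<subseteq> sets borel"
        using Q_open by (intro sets.range_disjointed_sets) auto
      then show ?thesis
        using A by (auto simp: P_def)
    qed
    have P_sub: "P n \<subseteq> Q n" for n
      using disjointed_subset[of Q n] by (auto simp: P_def)
    have P_disj: "disjoint_family P"
      using disjoint_family_disjointed[of Q] by (auto simp: P_def disjoint_family_on_def)
    have P_Un: "(\<Union>n. P n) = A"
      using cov \<U>'(3) UN_disjointed_eq[of Q] \<open>range Q = \<U>'\<close> by (auto simp: P_def)
    have piece: "ennreal t * ?S (P n) \<le> emeasure \<mu> (P n)" if t: "0 < t" "t < c" for t n
    proof -
      \<comment> \<open>Outer regularity is available for finite measures; the restriction to
        \<open>Q n\<close> is finite and agrees with \<open>\<mu>\<close> on the parts
        considered.\<close>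
      let ?\<nu> = "density \<mu> (indicator (Q n))"
      have \<nu>: "emeasure ?\<nu> X = emeasure \<mu> (Q n \<inter> X)" if "X \<in> sets borel" for X
        using that Q_open \<mu> by (intro emeasure_restricted) auto
      have "emeasure \<mu> (P n) = emeasure ?\<nu> (P n)"
        using \<nu>[OF P_sets] P_sub[of n] by (simp add: Int_absorb1)
      also have "\<dots> = (INF U\<in>{U. P n \<subseteq> U \<and> open U}. emeasure ?\<nu> U)"
      proof (rule outer_regular)
        show "emeasure ?\<nu> (space ?\<nu>) \<noteq> \<infinity>"
          using \<nu>[of UNIV] Q_fin[of n] \<mu> sets_eq_imp_space_eq[OF \<mu>] by auto
      qed (use \<mu> P_sets in auto)
      also have "\<dots> \<ge> ennreal t * ?S (P n)"
      proof (rule INF_greatest)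
        fix U assume U: "U \<in> {U. P n \<subseteq> U \<and> open U}"
        have "?S (P n) \<le> emeasure \<mu> (Q n \<inter> U) / ennreal t"
        proof (rule spherical_measure_le_measure[OF \<mu>])
          show "open (Q n \<inter> U)"
            using U Q_open by auto
          show "P n \<subseteq> Q n \<inter> U"
            using U P_sub by auto
          have "emeasure \<mu> (Q n \<inter> U) \<le> emeasure \<mu> (Q n)"
            using Q_open \<mu> by (intro emeasure_mono) auto
          then show "emeasure \<mu> (Q n \<inter> U) < \<infinity>"
            using Q_fin by (rule le_less_trans)
          show "ennreal t < federer_density d N (emeasure \<mu>) x" if "x \<in> P n" for x
            using that dens t by (auto simp: P_def ennreal_lessI)
        qed (use t in auto)
        then show "ennreal t * ?S (P n) \<le> emeasure ?\<nu> U"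
          using \<nu>[of U] U ennreal_divide_le_iff[of "ennreal t" "?S (P n)" "emeasure \<mu> (Q n \<inter> U)"] t
          by (simp add: mult.commute)
      qed
      finally show ?thesis .
    qed
    have le: "ennreal t * ?S A \<le> emeasure \<mu> A" if t: "0 < t" "t < c" for t
    proof -
      have "ennreal t * ?S A \<le> ennreal t * (\<Sum>n. ?S (P n))"
        unfolding P_Un[symmetric] spherical_measure_def
        by (intro mult_left_mono covering_measure_UNION_le) auto
      also have "\<dots> = (\<Sum>n. ennreal t * ?S (P n))"
        by (rule ennreal_suminf_cmult[symmetric])
      also have "\<dots> \<le> (\<Sum>n. emeasure \<mu> (P n))"
        using piece t by (intro suminf_le) auto
      also have "\<dots> = emeasure \<mu> A"
        using P_sets P_disj \<mu> P_Un by (subst suminf_emeasure) auto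
      finally show ?thesis .
    qed
    show ?thesis
    proof (cases "?S A")
      case (real s)
      show ?thesis
      proof (rule ennreal_le_epsilon)
        fix e :: real assume "0 < e"
        \<comment> \<open>The maximum with \<open>c / 2\<close> keeps \<open>t\<close> positive when
          \<open>e\<close> is large.\<close>
        define t where "t = max (c / 2) (c - e / (s + 1))"
        have t: "0 < t" "t < c"
          using real \<open>0 < e\<close> \<open>0 < c\<close> by (auto simp: t_def)
        have "(c - e / (s + 1)) * s \<le> t * s"
          using real by (intro mult_right_mono) (auto simp: t_def)
        moreover have "e / (s + 1) * s \<le> e"
          using real \<open>0 < e\<close> by (simp add: field_simps)
        ultimately have "c * s \<le> t * s + e"
          by (simp add: algebra_simps)
        then have "ennreal c * ?S A \<le> ennreal (t * s + e)"
          using real \<open>0 < c\<close> by (simp add: ennreal_mult[symmetric] ennreal_leI)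
        also have "\<dots> = ennreal t * ?S A + ennreal e"
          using real t \<open>0 < e\<close> by (simp add: ennreal_mult)
        also have "\<dots> \<le> emeasure \<mu> A + ennreal e"
          using le[OF t] by (intro add_right_mono)
        finally show "ennreal c * ?S A \<le> emeasure \<mu> A + ennreal e" .
      qed
    next
      case top
      then have "emeasure \<mu> A = top"
        using le[of "c / 2"] \<open>0 < c\<close> by (simp add: ennreal_mult_top top_unique)
      then show ?thesis by simp
    qed
  qed
qed

end

section \<open>Graded groups\<close>

context graded_group
begin

abbreviation P :: "nat \<Rightarrow> 'a \<Rightarrow> 'a" where
  "P \<equiv> layer_proj G"

lemma layer_proj_decomp: "(\<forall>i. P i x \<in> layer G i) \<and> x = (\<Sum>i=1..step G. P i x)"
proof -
  have "P i x = (THE h. (\<forall>i. h i \<in> layer G i) \<and> x = (\<Sum>i=1..step G. h i)) i" for i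
    by (simp add: layer_proj_def)
  then show ?thesis
    using theI'[OF layer_direct_sum[of x]] by simp
qed

lemma layer_proj_in [simp]: "P i x \<in> layer G i"
  using layer_proj_decomp by blast

lemma sum_layer_proj: "(\<Sum>i=1..step G. P i x) = x"
  using layer_proj_decomp by metis

lemma layer_projI:
  assumes "\<And>i. h i \<in> layer G i"
  shows "P j (\<Sum>i=1..step G. h i) = h j"
  using layer_direct_sum[of "\<Sum>i=1..step G. h i"] layer_proj_decomp[of "\<Sum>i=1..step G. h i"] assms
  by metis

lemma layer_proj_unique:
  assumes "\<And>i. h i \<in> layer G i" "x = (\<Sum>i=1..step G. h i)"
  shows "P j x = h j"
  using layer_projI[OF assms(1)] assms(2) by simp

lemma linear_layer_proj: "linear (P j)"
proof (rule linearI)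
  fix x y c
  show "P j (x + y) = P j x + P j y"
    by (rule layer_proj_unique[of "\<lambda>i. P i x + P i y"])
      (auto simp: sum.distrib sum_layer_proj simp del: One_nat_def intro: subspace_add subspace_layer)
  show "P j (c *\<^sub>R x) = c *\<^sub>R P j x"
    by (rule layer_proj_unique[of "\<lambda>i. c *\<^sub>R P i x"])
      (auto simp: scaleR_sum_right[symmetric] sum_layer_proj simp del: One_nat_def intro: subspace_scale subspace_layer)
qed

lemmas layer_proj_simps [simp] =
  linear_add[OF linear_layer_proj] linear_diff[OF linear_layer_proj] linear_0[OF linear_layer_proj]
  linear_scale[OF linear_layer_proj] linear_sum[OF linear_layer_proj] linear_neg[OF linear_layer_proj]

lemma layer_proj_layer:
  assumes "v \<in> layer G i"
  shows "P j v = (if i = j then v else 0)"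
proof (cases "i \<in> {1..step G}")
  case True
  show ?thesis
  proof (rule layer_proj_unique[of "\<lambda>j. if i = j then v else 0"])
    show "(if i = k then v else 0) \<in> layer G k" for k
      using assms by (auto intro: subspace_0 subspace_layer)
  qed (use True in simp)
next
  case False
  then have "v = 0"
    using assms layer_trivial[of i] by auto
  then show ?thesis by simp
qed

lemma layer_proj_outside: "i \<notin> {1..step G} \<Longrightarrow> P i x = 0"
  using layer_trivial[of i] layer_proj_in[of i x] by (cases "i = 0") auto

text \<open>Pythagoras for the orthogonal layers; it links the properness of a multiradial profile
  to Euclidean boundedness.\<close>

lemma norm_eq_L2_set: "norm x = L2_set (\<lambda>i. norm (P i x)) {1..step G}"
proof -
  have "x \<bullet> x = (\<Sum>i=1..step G. \<Sum>j=1..step G. P i x \<bullet> P j x)"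
    by (simp only: inner_sum_left[symmetric] inner_sum_right[symmetric] sum_layer_proj)
  also have "\<dots> = (\<Sum>i=1..step G. \<Sum>j=1..step G. if i = j then (norm (P i x))\<^sup>2 else 0)"
    by (intro sum.cong) (auto simp: power2_norm_eq_inner intro: layer_orthogonal layer_proj_in)
  also have "\<dots> = (\<Sum>i=1..step G. (norm (P i x))\<^sup>2)"
    by simp
  finally show ?thesis
    by (simp only: L2_set_def norm_eq_sqrt_inner)
qed

lemma norm_layer_proj_le: "norm (P i x) \<le> norm x"
proof (cases "i \<in> {1..step G}")
  case True
  then show ?thesis
    unfolding norm_eq_L2_set[of x] by (intro member_le_L2_set) auto
qed (simp add: layer_proj_outside)

lemma layer_proj_continuous [continuous_intros]:
  "continuous_on A f \<Longrightarrow> continuous_on A (\<lambda>x. P i (f x))"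
  using continuous_on_compose2[OF linear_continuous_on[of "P i" UNIV], of A f] linear_layer_proj
  by (simp add: linear_linear)

lemma layer_eqI: "(\<And>i. i \<in> {1..step G} \<Longrightarrow> P i x = P i y) \<Longrightarrow> x = y"
  using sum.cong[OF refl, of "{1..step G}" "\<lambda>i. P i x" "\<lambda>i. P i y"] by (simp only: sum_layer_proj)

lemma layer_proj_dilation: "P i (dilation G r x) = r ^ i *\<^sub>R P i x"
  unfolding dilation_def
  by (rule layer_projI[of "\<lambda>i. r ^ i *\<^sub>R P i x"]) (auto intro: subspace_scale subspace_layer)

lemma dilation_dilation: "dilation G r (dilation G s x) = dilation G (r * s) x"
  by (rule layer_eqI) (simp add: layer_proj_dilation power_mult_distrib)

lemma dilation_1 [simp]: "dilation G 1 x = x"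
  by (rule layer_eqI) (simp add: layer_proj_dilation)

lemma dilation_0 [simp]: "dilation G r 0 = 0"
  by (rule layer_eqI) (simp add: layer_proj_dilation)

lemma continuous_on_dilation: "continuous_on A (dilation G r)"
  unfolding dilation_def by (intro continuous_intros)

text \<open>The layers start at index one, so \<open>r ^ i \<le> r\<close> for every layer when
  \<open>r \<le> 1\<close>.\<close>

lemma norm_dilation_le:
  assumes "0 \<le> r" "r \<le> 1"
  shows "norm (dilation G r x) \<le> real (step G) * r * norm x"
proof -
  have "norm (dilation G r x) \<le> (\<Sum>i=1..step G. norm (r ^ i *\<^sub>R P i x))"
    unfolding dilation_def by (rule norm_sum)
  also have "\<dots> \<le> (\<Sum>i=1..step G. r * norm x)"
  proof (intro sum_mono)
    fix i assume "i \<in> {1..step G}"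
    then have "r ^ i \<le> r ^ 1"
      using assms by (intro power_decreasing) auto
    then show "norm (r ^ i *\<^sub>R P i x) \<le> r * norm x"
      using assms by (auto intro!: mult_mono norm_layer_proj_le)
  qed
  finally show ?thesis by (simp add: mult.assoc)
qed

section \<open>Triangular form of the group law\<close>

lemmas bracket_simps =
  bilinear_ladd[OF bilinear_bracket] bilinear_radd[OF bilinear_bracket]
  bilinear_lsub[OF bilinear_bracket] bilinear_rsub[OF bilinear_bracket]
  bilinear_sum[OF bilinear_bracket]

text \<open>Congruence modulo the ideal formed by the layers of index at least
  \<open>m\<close>.\<close>

definition agree_below :: "nat \<Rightarrow> 'a \<Rightarrow> 'a \<Rightarrow> bool" where
  "agree_below m u v \<longleftrightarrow> (\<forall>j<m. P j u = P j v)"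

lemma agree_below_refl [simp]: "agree_below m u u"
  by (simp add: agree_below_def)

text \<open>Layer \<open>l\<close> of a bracket collects the pairs with \<open>i + j = l\<close>. As
  both indices are at least one, both lie strictly below \<open>l\<close>, hence below
  \<open>m\<close>.\<close>

lemma bracket_layer_proj_eq_0:
  assumes "(\<forall>j<m. P j u = 0) \<or> (\<forall>j<m. P j v = 0)" "l < Suc m"
  shows "P l (bracket G u v) = 0"
proof -
  have "bracket G u v = bracket G (\<Sum>i=1..step G. P i u) (\<Sum>i=1..step G. P i v)"
    by (simp only: sum_layer_proj)
  also have "\<dots> = (\<Sum>(i, j)\<in>{1..step G} \<times> {1..step G}. bracket G (P i u) (P j v))"
    by (rule bilinear_sum[OF bilinear_bracket])
  also have "P l \<dots> = (\<Sum>(i, j)\<in>{1..step G} \<times> {1..step G}. P l (bracket G (P i u) (P j v)))"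
    by (simp add: case_prod_unfold)
  also have "\<dots> = 0"
  proof (rule sum.neutral, clarify)
    fix i j assume ij: "i \<in> {1..step G}" "j \<in> {1..step G}"
    have in_layer: "bracket G (P i u) (P j v) \<in> layer G (i + j)"
      by (intro bracket_layer layer_proj_in)
    show "P l (bracket G (P i u) (P j v)) = 0"
    proof (cases "i + j = l")
      case True
      then have "i < m" "j < m"
        using ij assms(2) by auto
      then have "P i u = 0 \<or> P j v = 0"
        using assms(1) by auto
      then show ?thesis
        by (auto simp: bilinear_lzero[OF bilinear_bracket] bilinear_rzero[OF bilinear_bracket])
    qed (simp add: layer_proj_layer[OF in_layer])
  qed
  finally show ?thesis .
qed

text \<open>One degree is gained because the other factor of the bracket contributes degree at least
  one.\<close>

lemma agree_below_bracket:
  assumes "agree_below m u u'" "agree_below m v v'"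
  shows "agree_below (Suc m) (bracket G u v) (bracket G u' v')"
  unfolding agree_below_def
proof (intro allI impI)
  fix l assume "l < Suc m"
  have "bracket G u v - bracket G u' v' = bracket G (u - u') v + bracket G u' (v - v')"
    by (simp add: bracket_simps)
  moreover have "P l (bracket G (u - u') v) = 0" "P l (bracket G u' (v - v')) = 0"
    using assms \<open>l < Suc m\<close> by (auto intro!: bracket_layer_proj_eq_0[of m] simp: agree_below_def)
  ultimately have "P l (bracket G u v - bracket G u' v') = 0"
    by simp
  then show "P l (bracket G u v) = P l (bracket G u' v')"
    by simp
qed

lemma agree_below_mono: "agree_below m u v \<Longrightarrow> k \<le> m \<Longrightarrow> agree_below k u v"
  by (auto simp: agree_below_def)

text \<open>A single letter gains nothing, while any genuine bracket gains a degree. The weaker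
  claim is carried along because the inner bracket may be a single letter.\<close>

lemma agree_below_nested_bracket:
  assumes "list_all2 (agree_below m) us vs"
  shows "agree_below m (nested_bracket (bracket G) us) (nested_bracket (bracket G) vs)
    \<and> (2 \<le> length us \<longrightarrow>
        agree_below (Suc m) (nested_bracket (bracket G) us) (nested_bracket (bracket G) vs))"
  using assms
proof (induction us arbitrary: vs)
  case (Cons u us)
  then obtain v vs' where vs: "vs = v # vs'" "agree_below m u v" "list_all2 (agree_below m) us vs'"
    by (auto simp: list_all2_Cons1)
  show ?case
  proof (cases us)
    case Nil
    then show ?thesis
      using vs by auto
  next
    case (Cons u2 us2)
    then obtain v2 vs2 where vs': "vs' = v2 # vs2"
      using vs(3) by (auto simp: list_all2_Cons1)
    have "agree_below (Suc m) (nested_bracket (bracket G) (u # us)) (nested_bracket (bracket G) vs)"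
      using Cons.IH[OF vs(3)] vs(2) unfolding vs(1) vs' Cons
      by (auto intro!: agree_below_bracket)
    then show ?thesis
      by (auto intro: agree_below_mono)
  qed
qed simp

definition bch_word :: "'a \<Rightarrow> 'a \<Rightarrow> (nat \<times> nat) list \<Rightarrow> 'a list" where
  "bch_word x y ws = concat (map (\<lambda>(r, s). replicate r x @ replicate s y) ws)"

definition bch_coeff :: "(nat \<times> nat) list \<Rightarrow> real" where
  "bch_coeff ws = (- 1) ^ (length ws - 1) /
     (real (length ws) * real (\<Sum>(r, s)\<leftarrow>ws. r + s) * (\<Prod>(r, s)\<leftarrow>ws. fact r * fact s))"

lemma mult_alt:
  "mult G x y = (\<Sum>ws\<in>dynkin_words (step G). bch_coeff ws *\<^sub>R nested_bracket (bracket G) (bch_word x y ws))"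
  unfolding mult_bch bch_def bch_word_def bch_coeff_def ..

lemma length_bch_word: "length (bch_word x y ws) = (\<Sum>(r, s)\<leftarrow>ws. r + s)"
  by (induction ws) (auto simp: bch_word_def)

lemma bch_word_rel:
  assumes "R x x'" "R y y'"
  shows "list_all2 R (bch_word x y ws) (bch_word x' y' ws)"
proof -
  have rep: "R u v \<Longrightarrow> list_all2 R (replicate n u) (replicate n v)" for n u v
    by (induction n) auto
  show ?thesis
    by (induction ws) (auto simp: bch_word_def assms rep intro!: list_all2_appendI)
qed

text \<open>Apart from the term \<open>y\<close> itself, every term of the Baker-Campbell-Hausdorff
  sum is either free of \<open>y\<close> or a bracket of at least two letters, whose layer
  \<open>i\<close> sees only the layers of \<open>y\<close> below \<open>i\<close>. Left translation
  thus moves layer \<open>i\<close> by an amount determined by lower layers.\<close>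

lemma layer_proj_mult:
  assumes "agree_below i y y'"
  shows "P i (mult G x y) - P i y = P i (mult G x y') - P i y'"
proof -
  let ?t = "\<lambda>y ws. bch_coeff ws *\<^sub>R nested_bracket (bracket G) (bch_word x y ws)"
  have mem: "[(0, 1)] \<in> dynkin_words (step G)"
    using step_pos by (auto simp: dynkin_words_def)
  have term1: "?t y [(0, 1)] = y" for y
    by (simp add: bch_word_def bch_coeff_def)
  have split: "mult G x y = y + (\<Sum>ws\<in>dynkin_words (step G) - {[(0, 1)]}. ?t y ws)" for y
    unfolding mult_alt using sum.remove[OF finite_dynkin_words mem, of "?t y"] term1 by simp
  have "P i (?t y ws) = P i (?t y' ws)" if ws: "ws \<in> dynkin_words (step G) - {[(0, 1)]}" for ws
  proof (cases "2 \<le> length (bch_word x y ws)")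
    case True
    then have "agree_below (Suc i) (nested_bracket (bracket G) (bch_word x y ws))
        (nested_bracket (bracket G) (bch_word x y' ws))"
      using agree_below_nested_bracket[OF bch_word_rel[where R = "agree_below i", of x x y y' ws]] assms by simp
    then show ?thesis
      by (simp add: agree_below_def)
  next
    case False
    \<comment> \<open>With \<open>[(0, 1)]\<close> removed, the only word with fewer than two
      letters is \<open>[(1, 0)]\<close>, the term \<open>x\<close>.\<close>
    obtain r s ws' where ws': "ws = (r, s) # ws'"
      using ws by (cases ws) (auto simp: dynkin_words_def)
    have "ws' = []"
    proof (cases ws')
      case (Cons w ws'')
      obtain r' s' where "w = (r', s')" by fastforce
      then have "0 < r + s" "0 < r' + s'" "r + s + (r' + s') \<le> length (bch_word x y ws)"
        using ws ws' Cons by (auto simp: dynkin_words_def length_bch_word)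
      then show ?thesis
        using False by linarith
    qed
    moreover have "0 < r + s" "r + s \<le> 1"
      using ws ws' False \<open>ws' = []\<close> by (auto simp: dynkin_words_def length_bch_word)
    ultimately have "s = 0"
      using ws ws' by (cases s) auto
    then show ?thesis
      using ws' \<open>ws' = []\<close> by (simp add: bch_word_def)
  qed
  then have "(\<Sum>ws\<in>dynkin_words (step G) - {[(0, 1)]}. P i (?t y ws))
      = (\<Sum>ws\<in>dynkin_words (step G) - {[(0, 1)]}. P i (?t y' ws))"
    by (intro sum.cong) auto
  then show ?thesis
    unfolding split[of y] split[of y'] by simp
qed

section \<open>Differentiability of the group law\<close>

lemma nested_bracket_differentiable:
  assumes "\<forall>f\<in>set fs. f differentiable (at y)"
  shows "(\<lambda>y. nested_bracket (bracket G) (map (\<lambda>f. f y) fs)) differentiable (at (y :: 'b :: real_normed_vector))"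
  using assms
proof (induction fs rule: induct_list012)
  case (3 f f' fs)
  have "bounded_bilinear (bracket G)"
    using bilinear_bracket by (simp add: bilinear_conv_bounded_bilinear)
  moreover have "f differentiable (at y)"
    "(\<lambda>y. nested_bracket (bracket G) (map (\<lambda>f. f y) (f' # fs))) differentiable (at y)"
    using 3 by auto
  ultimately show ?case
    unfolding differentiable_def by (auto dest: bounded_bilinear.FDERIV)
qed auto

text \<open>Both factors may vary with \<open>y\<close>. This covers left translations and also maps
  such as \<open>p\<close> going to the product of \<open>- p\<close> with a point depending on
  \<open>p\<close>, whose measurability is used for the differentials.\<close>

lemma mult_differentiable:
  assumes "f differentiable (at y)" "h differentiable (at y)"
  shows "(\<lambda>y. mult G (f y) (h y)) differentiable (at (y :: 'b :: real_normed_vector))"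
proof -
  have word: "bch_word (f y) (h y) ws =
      map (\<lambda>f. f y) (concat (map (\<lambda>(r, s). replicate r f @ replicate s h) ws))" for ws y
    by (induction ws) (auto simp: bch_word_def)
  have "set (concat (map (\<lambda>(r, s). replicate r f @ replicate s h) ws)) \<subseteq> {f, h}" for ws
    by (induction ws) (auto split: if_splits)
  then have "(\<lambda>y. nested_bracket (bracket G) (bch_word (f y) (h y) ws)) differentiable (at y)" for ws
    unfolding word using assms by (intro nested_bracket_differentiable) blast
  then show ?thesis
    unfolding mult_alt
    by (intro differentiable_sum finite_dynkin_words ballI differentiable_scaleR) auto
qed

lemma mult_differentiable_left: "mult G x differentiable (at y)"
  using mult_differentiable[of "\<lambda>_. x" y "\<lambda>y. y"] by simp

lemma continuous_on_mult: "continuous_on A (mult G x)"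
  by (intro continuous_at_imp_continuous_on ballI differentiable_imp_continuous_within
      mult_differentiable_left)

lemma mult_cancel: "mult G (- x) (mult G x y) = y" "mult G x (mult G (- x) y) = y"
  by (simp_all only: mult_assoc[symmetric] mult_minus_left mult_minus_right mult_0_left)

end

section \<open>Homogeneous distances\<close>

locale homogeneous_group = graded_group G
  for G :: "'a::euclidean_space group_data" +
  fixes d :: "'a \<Rightarrow> 'a \<Rightarrow> real"
  assumes homogeneous: "homogeneous_distance G d"
begin

sublocale Metric_space UNIV d
  using homogeneous by (simp add: homogeneous_distance_def)

lemma d_mult: "d (mult G z x) (mult G z y) = d x y"
  using homogeneous by (simp add: homogeneous_distance_def)

lemma d_dilation: "0 < r \<Longrightarrow> d (dilation G r x) (dilation G r y) = r * d x y"
  using homogeneous by (simp add: homogeneous_distance_def)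

lemma d_dilation_0: "0 < r \<Longrightarrow> d 0 (dilation G r y) = r * d 0 y"
  using d_dilation[of r 0 y] by simp

lemma d_eq: "d x y = d 0 (mult G (- x) y)"
  using d_mult[of "- x" x y] by (simp add: mult_minus_left)

lemma mem_mcball_iff:
  assumes "0 < r"
  shows "y \<in> mcball x r \<longleftrightarrow> dilation G (1 / r) (mult G (- x) y) \<in> mcball 0 1"
  using assms by (simp add: d_eq[of x y] d_dilation_0 field_simps)

lemma mcball_eq_image:
  assumes "0 < r"
  shows "mcball x r = (\<lambda>z. mult G x (dilation G r z)) ` mcball 0 1"
proof (intro equalityI subsetI)
  fix y assume "y \<in> mcball x r"
  then have "dilation G (1 / r) (mult G (- x) y) \<in> mcball 0 1"
    using mem_mcball_iff[OF assms] by blast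
  moreover have "y = mult G x (dilation G r (dilation G (1 / r) (mult G (- x) y)))"
    using assms by (simp add: dilation_dilation mult_cancel)
  ultimately show "y \<in> (\<lambda>z. mult G x (dilation G r z)) ` mcball 0 1"
    by blast
next
  fix y assume "y \<in> (\<lambda>z. mult G x (dilation G r z)) ` mcball 0 1"
  then obtain z where z: "z \<in> mcball 0 1" "y = mult G x (dilation G r z)"
    by blast
  then show "y \<in> mcball x r"
    unfolding mem_mcball_iff[OF assms] using assms by (simp add: mult_cancel dilation_dilation)
qed

definition unit_diam :: real where
  "unit_diam = enn2real (ediam d (mcball 0 1))"

lemma ediam_mcball_0_1: "ediam d (mcball 0 1) = ennreal unit_diam" "0 < unit_diam"
proof -
  have "ediam d (mcball 0 1) \<le> ennreal 2"
  proof (rule ediam_leI)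
    fix x y assume "x \<in> mcball 0 1" "y \<in> mcball 0 1"
    then show "d x y \<le> 2"
      using triangle[of x 0 y] commute[of x 0] by simp
  qed
  then have fin: "ediam d (mcball 0 1) < top"
    by (rule le_less_trans) simp
  then show *: "ediam d (mcball 0 1) = ennreal unit_diam"
    by (simp add: unit_diam_def)
  obtain v :: 'a where v: "v \<noteq> 0"
    using top_layer subspace_0[OF subspace_layer, of "step G"] by blast
  \<comment> \<open>A nonzero vector, supplied by the nontrivial top layer, is dilated to distance
    one from the unit; so the unit ball has positive diameter.\<close>
  define w where "w = dilation G (1 / d 0 v) v"
  have "0 < d 0 v"
    using v by simp
  then have "d 0 w = 1"
    by (simp add: w_def d_dilation_0)
  then have "ennreal 1 \<le> ediam d (mcball 0 1)"
    using ediam_ge[of 0 "mcball 0 1" w d] by simp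
  then have "1 \<le> unit_diam"
    unfolding * by simp
  then show "0 < unit_diam" by simp
qed

lemma ediam_mcball:
  assumes "0 < r"
  shows "ediam d (mcball x r) = ennreal (r * unit_diam)"
proof -
  have "ediam d (mcball x r) = (SUP a\<in>mcball 0 1. SUP b\<in>mcball 0 1. ennreal r * ennreal (d a b))"
    unfolding mcball_eq_image[OF assms] ediam_def using assms
    by (simp add: image_image d_mult d_dilation ennreal_mult)
  also have "\<dots> = ennreal r * ediam d (mcball 0 1)"
    unfolding ediam_def by (simp add: SUP_mult_left_ennreal)
  also have "\<dots> = ennreal (r * unit_diam)"
    using assms ediam_mcball_0_1 by (simp add: ennreal_mult)
  finally show ?thesis .
qed

end

text \<open>One profile \<phi> from the existential in \<open>multiradial\<close> is fixed as a
  parameter, so that the unit ball is an explicit sublevel set.\<close>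

locale multiradial_group = graded_group G
  for G :: "'a::euclidean_space group_data" +
  fixes d :: "'a \<Rightarrow> 'a \<Rightarrow> real" and \<phi> :: "(nat \<Rightarrow> real) \<Rightarrow> real"
  assumes homogeneous': "homogeneous_distance G d"
    and \<phi>_continuous: "continuous_on (orthant (step G)) \<phi>"
    and \<phi>_mono: "t \<in> orthant (step G) \<Longrightarrow> i \<in> {1..step G} \<Longrightarrow> t i \<le> s \<Longrightarrow> \<phi> t \<le> \<phi> (t(i := s))"
    and \<phi>_0: "\<phi> (\<lambda>_. 0) = 0"
    and \<phi>_proper: "\<exists>R. \<forall>t\<in>orthant (step G). R \<le> L2_set t {1..step G} \<longrightarrow> C \<le> \<phi> t"
    and unit_ball: "closed_ball d 0 1 =
          {x. \<phi> (\<lambda>i. if i \<in> {1..step G} then norm (layer_proj G i x) else 0) \<le> 1}"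
begin

sublocale homogeneous_group G d
  by unfold_locales (rule homogeneous')

definition radii :: "'a \<Rightarrow> nat \<Rightarrow> real" where
  "radii x = (\<lambda>i. if i \<in> {1..step G} then norm (P i x) else 0)"

lemma radii_orthant: "radii x \<in> orthant (step G)"
  by (auto simp: radii_def orthant_def)

lemma continuous_on_radii: "continuous_on A (\<lambda>x. \<phi> (radii x))"
proof (rule continuous_on_compose2[OF \<phi>_continuous])
  have "continuous_on A (\<lambda>x. radii x i)" for i
    by (cases "i \<in> {1..step G}") (auto simp: radii_def intro!: continuous_intros)
  then show "continuous_on A radii"
    by (rule continuous_on_coordinatewise_then_product)
qed (use radii_orthant in auto)

lemma mem_unit_ball: "x \<in> mcball 0 1 \<longleftrightarrow> \<phi> (radii x) \<le> 1"
  unfolding unit_ball radii_def by simp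

lemma compact_unit_ball: "compact (mcball 0 1)"
proof -
  have eq: "mcball 0 1 = {x. \<phi> (radii x) \<le> 1}"
    using mem_unit_ball by blast
  \<comment> \<open>Any level above one would do: beyond radius \<open>R\<close> the profile exceeds
    the level that defines the unit ball.\<close>
  obtain R where R: "\<forall>t\<in>orthant (step G). R \<le> L2_set t {1..step G} \<longrightarrow> 2 \<le> \<phi> t"
    using \<phi>_proper by blast
  have "norm x \<le> R" if "x \<in> mcball 0 1" for x
  proof (rule ccontr)
    assume "\<not> norm x \<le> R"
    moreover have "norm x = L2_set (radii x) {1..step G}"
      by (subst norm_eq_L2_set, intro L2_set_cong) (auto simp: radii_def)
    ultimately have "2 \<le> \<phi> (radii x)"
      using R radii_orthant by auto
    then show False
      using that mem_unit_ball[of x] by linarith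
  qed
  then have "bounded (mcball 0 1)"
    unfolding bounded_iff by blast
  moreover have "closed (mcball 0 1)"
    unfolding eq by (intro closed_Collect_le continuous_on_radii continuous_on_const)
  ultimately show ?thesis
    by (simp add: compact_eq_bounded_closed)
qed

lemma zero_interior_unit_ball: "0 \<in> interior (mcball 0 1)"
proof (rule interiorI)
  show "open {x. \<phi> (radii x) < 1}"
    by (intro open_Collect_less continuous_on_radii continuous_on_const)
  have "radii 0 = (\<lambda>_. 0)"
    by (auto simp: radii_def)
  then show "0 \<in> {x. \<phi> (radii x) < 1}"
    using \<phi>_0 by simp
  show "{x. \<phi> (radii x) < 1} \<subseteq> mcball 0 1"
    using mem_unit_ball by (intro subsetI) (metis (lifting) less_imp_le mem_Collect_eq)
qed

text \<open>Every ball of positive radius is a dilated and left translated unit ball, so continuity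
  of dilations and translations carries the Euclidean properties of the unit ball over to
  it.\<close>

sublocale scaled_ball_metric d unit_diam
proof
  fix x :: 'a and r :: real and V :: "'a set"
  show "compact (mcball x r)"
  proof (cases "0 < r")
    case True
    have "continuous_on (mcball 0 1) (\<lambda>z. mult G x (dilation G r z))"
      by (rule continuous_on_compose2[OF continuous_on_mult continuous_on_dilation subset_UNIV])
    then show ?thesis
      unfolding mcball_eq_image[OF True] by (rule compact_continuous_image[OF _ compact_unit_ball])
  next
    case False
    \<comment> \<open>A ball of nonpositive radius is empty or its centre.\<close>
    have "mcball x r \<subseteq> {x}"
    proof
      fix y assume "y \<in> mcball x r"
      then have "d x y \<le> r"
        by simp
      then have "d x y = 0"
        using False nonneg[of x y] by linarith
      then show "y \<in> {x}"
        using zero[of x y] by simp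
    qed
    then have "finite (mcball x r)"
      by (rule finite_subset) simp
    then show ?thesis
      by (rule finite_imp_compact)
  qed
  show "\<exists>r>0. mcball x r \<subseteq> V" if V: "open V" "x \<in> V"
  proof -
    have "open (mult G x -` V)"
      using V(1) continuous_on_mult[of UNIV x] by (simp add: continuous_on_open_vimage)
    moreover have "0 \<in> mult G x -` V"
      using V(2) by (simp add: mult_0_right)
    ultimately obtain e where e: "0 < e" "ball 0 e \<subseteq> mult G x -` V"
      unfolding open_contains_ball by blast
    obtain R where R: "0 < R" "\<And>z. z \<in> mcball 0 1 \<Longrightarrow> norm z \<le> R"
      using compact_imp_bounded[OF compact_unit_ball] unfolding bounded_pos by blast
    \<comment> \<open>The bound one makes the linear estimate for dilations available; the rest
      sends the unit ball, of Euclidean size at most \<open>R\<close>, into radius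
      \<open>e / 2\<close>.\<close>
    define r where "r = min 1 (e / (2 * real (step G) * R))"
    have sp: "0 < real (step G) * R"
      using step_pos R by simp
    have r: "0 < r" "r \<le> 1"
      using e R step_pos by (auto simp: r_def)
    have "mult G x (dilation G r z) \<in> V" if "z \<in> mcball 0 1" for z
    proof -
      have "norm (dilation G r z) \<le> real (step G) * r * norm z"
        using r by (intro norm_dilation_le) auto
      also have "\<dots> \<le> real (step G) * r * R"
        using R(2)[OF that] r by (intro mult_left_mono) auto
      also have "\<dots> = r * (real (step G) * R)"
        by simp
      also have "\<dots> \<le> e / (2 * real (step G) * R) * (real (step G) * R)"
        using sp by (intro mult_right_mono) (auto simp: r_def)
      also have "\<dots> < e"
        using sp e by (simp add: field_simps)
      finally show ?thesis
        using e(2) by (auto simp: subset_iff)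
    qed
    then show ?thesis
      using r(1) mcball_eq_image[OF r(1), of x] by (intro exI[of _ r]) auto
  qed
  show "x \<in> interior (mcball x r)" if r: "0 < r"
  proof (rule interiorI)
    let ?f = "\<lambda>y. dilation G (1 / r) (mult G (- x) y)"
    have "continuous_on UNIV ?f"
      by (rule continuous_on_compose2[OF continuous_on_dilation continuous_on_mult subset_UNIV])
    then show "open (?f -` interior (mcball 0 1))"
      by (simp add: continuous_on_open_vimage)
    show "x \<in> ?f -` interior (mcball 0 1)"
      using zero_interior_unit_ball by (simp add: mult_minus_left)
    show "?f -` interior (mcball 0 1) \<subseteq> mcball x r"
      using interior_subset[of "mcball 0 1"] mem_mcball_iff[OF r, of _ x] by blast
  qed
  show "ediam d (mcball x r) = ennreal (r * unit_diam)" if "0 < r"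
    using that by (rule ediam_mcball)
  show "0 < unit_diam"
    by (rule ediam_mcball_0_1)
qed

end

section \<open>Hausdorff measures of Euclidean space\<close>

text \<open>A covering set of diameter less than \<epsilon> cannot meet both sets, so a fine
  covering of the union splits into coverings of the two parts.\<close>

lemma covering_measure_dist_separated:
  fixes A B :: "'a::metric_space set"
  assumes sep: "\<And>a b. a \<in> A \<Longrightarrow> b \<in> B \<Longrightarrow> \<epsilon> \<le> dist a b" and "0 < \<epsilon>"
  shows "covering_measure dist UNIV \<zeta> A + covering_measure dist UNIV \<zeta> B
    \<le> covering_measure dist UNIV \<zeta> (A \<union> B)"
proof -
  let ?h = "\<lambda>\<delta> X. INF C\<in>coverings dist UNIV X \<delta>. (\<Sum>\<^sub>\<infinity>B\<in>C. \<zeta> B)"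
  let ?m = "covering_measure dist UNIV \<zeta>"
  have h: "?h \<delta> A + ?h \<delta>' B \<le> ?m (A \<union> B)" if \<delta>: "0 < \<delta>" "0 < \<delta>'" for \<delta> \<delta>'
  proof (cases "?m (A \<union> B) < \<infinity>")
    case True
    show ?thesis
    proof (rule ennreal_le_epsilon)
      fix e :: real assume "0 < e"
      define r where "r = min (\<epsilon> / 2) (min \<delta> \<delta>')"
      have r: "0 < r" "r < \<epsilon>" "r \<le> \<delta>" "r \<le> \<delta>'"
        using \<delta> \<open>0 < \<epsilon>\<close> by (auto simp: r_def)
      obtain C where C: "C \<in> coverings dist UNIV (A \<union> B) r" "(\<Sum>\<^sub>\<infinity>B\<in>C. \<zeta> B) \<le> ?m (A \<union> B) + ennreal e"
        using covering_measure_approx[OF True r(1) \<open>0 < e\<close>] by blast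
      define CA where "CA = {X \<in> C. X \<inter> A \<noteq> {}}"
      define CB where "CB = {X \<in> C. X \<inter> B \<noteq> {}}"
      have diam: "ediam dist X \<le> ennreal r" if "X \<in> C" for X
        using that C(1) by (auto simp: coverings_def)
      have "CA \<inter> CB = {}"
      proof (rule ccontr)
        assume "CA \<inter> CB \<noteq> {}"
        then obtain X a b where X: "X \<in> C" "a \<in> X" "a \<in> A" "b \<in> X" "b \<in> B"
          by (auto simp: CA_def CB_def)
        have "ennreal (dist a b) \<le> ennreal r"
          using ediam_ge[of a X b dist] X diam[of X] by auto
        then show False
          using sep[of a b] X r by simp
      qed
      then have "(\<Sum>\<^sub>\<infinity>X\<in>CA. \<zeta> X) + (\<Sum>\<^sub>\<infinity>X\<in>CB. \<zeta> X) = (\<Sum>\<^sub>\<infinity>X\<in>CA \<union> CB. \<zeta> X)"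
        by (intro infsum_Un_disjoint[symmetric] nonneg_summable_on_complete) auto
      also have "\<dots> \<le> (\<Sum>\<^sub>\<infinity>X\<in>C. \<zeta> X)"
        by (intro infsum_ennreal_mono_set) (auto simp: CA_def CB_def)
      finally have le: "(\<Sum>\<^sub>\<infinity>X\<in>CA. \<zeta> X) + (\<Sum>\<^sub>\<infinity>X\<in>CB. \<zeta> X) \<le> (\<Sum>\<^sub>\<infinity>X\<in>C. \<zeta> X)" .
      have ler: "X \<le> ennreal \<delta>" "X \<le> ennreal \<delta>'" if "X \<le> ennreal r" for X
        using that r ennreal_leI order_trans by blast+
      have cnt: "countable C" and cov: "A \<union> B \<subseteq> \<Union>C"
        using C(1) by (auto simp: coverings_def)
      have "countable CA" "countable CB"
        by (rule countable_subset[OF _ cnt], force simp: CA_def CB_def)+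
      moreover have "A \<subseteq> \<Union>CA" "B \<subseteq> \<Union>CB"
        using cov unfolding CA_def CB_def by blast+
      ultimately have "CA \<in> coverings dist UNIV A \<delta>" "CB \<in> coverings dist UNIV B \<delta>'"
        using diam ler unfolding coverings_def CA_def CB_def by simp_all
      then have "?h \<delta> A + ?h \<delta>' B \<le> (\<Sum>\<^sub>\<infinity>X\<in>CA. \<zeta> X) + (\<Sum>\<^sub>\<infinity>X\<in>CB. \<zeta> X)"
        by (intro add_mono INF_lower)
      then show "?h \<delta> A + ?h \<delta>' B \<le> ?m (A \<union> B) + ennreal e"
        using le C(2) by (meson order_trans)
    qed
  qed (simp add: less_top[symmetric])
  \<comment> \<open>The suprema over the two mesh sizes are taken one after the other; this is why
    \<delta> and \<open>\<delta>'\<close> were kept independent.\<close>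
  have "?m A + ?h \<delta>' B \<le> ?m (A \<union> B)" if "0 < \<delta>'" for \<delta>'
    unfolding covering_measure_alt[of dist UNIV \<zeta> A]
    by (subst ennreal_SUP_add_left[symmetric]) (use h that in \<open>auto intro!: SUP_least\<close>)
  then show ?thesis
    unfolding covering_measure_alt[of dist UNIV \<zeta> B]
    by (subst ennreal_SUP_add_right) (auto intro!: SUP_least)
qed

text \<open>
  Caratheodory's criterion: the layers of points whose distance to the closed set lies between
  \<open>1 / (n + 2)\<close> and \<open>1 / (n + 1)\<close> are pairwise separated if their indices have the same
  parity, so the sum of their measures is finite.
\<close>

lemma covering_measure_dist_closed:
  fixes F X :: "'a::metric_space set"
  assumes "closed F"
  shows "covering_measure dist UNIV \<zeta> (X \<inter> F) + covering_measure dist UNIV \<zeta> (X - F)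
    \<le> covering_measure dist UNIV \<zeta> X"
proof (cases "F = {} \<or> covering_measure dist UNIV \<zeta> X = \<infinity>")
  case True
  then show ?thesis by auto
next
  case False
  let ?m = "covering_measure dist UNIV \<zeta>"
  have F: "F \<noteq> {}" and fin: "?m X < \<infinity>"
    using False by (auto simp: less_top[symmetric])
  define Y where "Y n = {x \<in> X. 1 / real (Suc n) \<le> infdist x F}" for n
  define R where "R n = Y (Suc n) - Y n" for n
  have inv_mono: "1 / real (Suc n) \<le> 1 / real (Suc m)" if "m \<le> n" for m n
    using that by (intro divide_left_mono) auto
  have Y_mono: "Y m \<subseteq> Y n" if "m \<le> n" for m n
    using inv_mono[OF that] by (auto simp: Y_def intro: order_trans)
  have infdist_le: "infdist a F \<le> dist a b + infdist b F" for a b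
    using infdist_triangle[of a F b] by simp
  have step1: "?m (X \<inter> F) + ?m (Y n) \<le> ?m X" for n
  proof -
    have "?m (X \<inter> F) + ?m (Y n) \<le> ?m ((X \<inter> F) \<union> Y n)"
    proof (rule covering_measure_dist_separated)
      fix a b assume "a \<in> X \<inter> F" "b \<in> Y n"
      then show "1 / real (Suc n) \<le> dist a b"
        using infdist_le2[of a F b 0] infdist_le[of b a] by (auto simp: Y_def dist_commute)
    qed simp
    also have "\<dots> \<le> ?m X"
      by (intro covering_measure_mono) (auto simp: Y_def)
    finally show ?thesis .
  qed
  have gap: "\<exists>\<epsilon>>0. \<forall>a\<in>Y n. \<forall>b\<in>R k. \<epsilon> \<le> dist a b" if "n < k" for n k
  proof -
    have "1 / real (Suc k) < 1 / real (Suc n)"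
      using that by (intro divide_strict_left_mono) auto
    moreover have "1 / real (Suc n) - 1 / real (Suc k) \<le> dist a b" if "a \<in> Y n" "b \<in> R k" for a b
    proof -
      have "1 / real (Suc n) \<le> infdist a F" "infdist b F \<le> 1 / real (Suc k)"
        using that by (auto simp: Y_def R_def)
      then show ?thesis
        using infdist_le[of a b] by simp
    qed
    ultimately show ?thesis
      by (intro exI[of _ "1 / real (Suc n) - 1 / real (Suc k)"]) auto
  qed
  have R_sub: "R n \<subseteq> Y m" if "n < m" for n m
    using Y_mono[of "Suc n" m] that by (auto simp: R_def)
  have parity: "(\<Sum>i<j. ?m (R (2 * i + p))) \<le> ?m (\<Union>i<j. R (2 * i + p))" for j p
  proof (induction j)
    case (Suc j)
    let ?U = "\<Union>i<j. R (2 * i + p)"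
    have "?m ?U + ?m (R (2 * j + p)) \<le> ?m (?U \<union> R (2 * j + p))"
    proof (cases j)
      case (Suc j')
      \<comment> \<open>The earlier layers of the same parity lie in
        \<open>Y (2 * j' + p + 1)\<close>, whose index is one less than \<open>2 * j + p\<close>; so
        they keep a positive distance from the next layer.\<close>
      obtain \<epsilon> where \<epsilon>: "0 < \<epsilon>" "\<forall>a\<in>Y (2 * j' + p + 1). \<forall>b\<in>R (2 * j + p). \<epsilon> \<le> dist a b"
        using gap[of "2 * j' + p + 1" "2 * j + p"] Suc by auto
      have "?U \<subseteq> Y (2 * j' + p + 1)"
        using Suc by (intro UN_least R_sub) auto
      then show ?thesis
        using \<epsilon> by (intro covering_measure_dist_separated[of _ _ \<epsilon>]) auto
    qed simp
    moreover have "(\<Union>i<Suc j. R (2 * i + p)) = ?U \<union> R (2 * j + p)"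
      by (auto simp: lessThan_Suc)
    ultimately show ?case
      using Suc by (auto intro: order_trans[OF add_right_mono])
  qed simp
  have R_X: "R n \<subseteq> X" for n
    by (auto simp: R_def Y_def)
  have parity': "(\<Sum>i<j. ?m (R (2 * i + p))) \<le> ?m X" for j p
    using R_X by (intro order_trans[OF parity] covering_measure_mono) auto
  have sum2: "(\<Sum>k<2 * j. ?m (R k)) = (\<Sum>i<j. ?m (R (2 * i + 0))) + (\<Sum>i<j. ?m (R (2 * i + 1)))" for j
    by (induction j) (auto simp: algebra_simps)
  have sums: "(\<Sum>k<j. ?m (R k)) \<le> ?m X + ?m X" for j
  proof -
    have "(\<Sum>k<j. ?m (R k)) \<le> (\<Sum>k<2 * j. ?m (R k))"
      by (intro sum_mono2) auto
    also have "\<dots> \<le> ?m X + ?m X"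
      unfolding sum2 by (intro add_mono parity')
    finally show ?thesis .
  qed
  define r where "r k = enn2real (?m (R k))" for k
  have r: "?m (R k) = ennreal (r k)" for k
  proof -
    have "?m (R k) \<le> ?m X"
      by (intro covering_measure_mono R_X)
    then show ?thesis
      using fin by (auto simp: r_def ennreal_enn2real_if)
  qed
  have r_nonneg: "0 \<le> r k" for k
    by (simp add: r_def)
  obtain M where M: "?m X = ennreal M" "0 \<le> M"
    using fin by (cases "?m X") auto
  have "summable r"
  proof (rule summableI_nonneg_bounded[OF r_nonneg])
    fix j
    have "ennreal (sum r {..<j}) = (\<Sum>k<j. ?m (R k))"
      unfolding r using r_nonneg by (simp add: sum_ennreal)
    also have "\<dots> \<le> ennreal (M + M)"
      using sums[of j] M by (simp add: ennreal_plus[symmetric] del: ennreal_plus)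
    finally show "sum r {..<j} \<le> M + M"
      using M by (subst (asm) ennreal_le_iff) auto
  qed
  show ?thesis
  proof (rule ennreal_le_epsilon)
    fix e :: real assume "0 < e"
    then obtain n where "norm (\<Sum>i. r (i + n)) < e"
      using suminf_exist_split[OF _ \<open>summable r\<close>] by blast
    then have n: "(\<Sum>i. r (i + n)) \<le> e"
      by simp
    have "(\<Sum>i. ?m (R (i + n))) = ennreal (\<Sum>i. r (i + n))"
      unfolding r using r_nonneg \<open>summable r\<close> by (intro suminf_ennreal2) (auto simp: summable_iff_shift)
    also have "\<dots> \<le> ennreal e"
      using n by (rule ennreal_leI)
    finally have tail: "(\<Sum>i. ?m (R (i + n))) \<le> ennreal e" .
    have "X - F \<subseteq> Y n \<union> (\<Union>i. R (i + n))"
    proof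
      fix x assume x: "x \<in> X - F"
      then have "0 < infdist x F"
        using infdist_pos_not_in_closed[OF assms F] by auto
      then obtain k where "1 / real (Suc k) < infdist x F"
        using nat_approx_posE by blast
      then have "x \<in> Y k"
        using x by (auto simp: Y_def)
      then have ex: "\<exists>k. x \<in> Y k" ..
      define k where "k = (LEAST k. x \<in> Y k)"
      have k: "x \<in> Y k" "\<And>l. l < k \<Longrightarrow> x \<notin> Y l"
        unfolding k_def using LeastI_ex[OF ex] not_less_Least by blast+
      show "x \<in> Y n \<union> (\<Union>i. R (i + n))"
      proof (cases "k \<le> n")
        case True
        then show ?thesis
          using Y_mono[OF True] k(1) by auto
      next
        case False
        \<comment> \<open>By minimality \<open>x\<close> belongs to \<open>Y k\<close> but not to
          \<open>Y (k - 1)\<close>, and \<open>k - Suc n + n\<close> is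
          \<open>k - 1\<close>.\<close>
        then have "x \<in> R (k - Suc n + n)"
          using k(1) k(2)[of "k - 1"] by (auto simp: R_def)
        then show ?thesis by blast
      qed
    qed
    then have "?m (X - F) \<le> ?m (Y n \<union> (\<Union>i. R (i + n)))"
      by (rule covering_measure_mono)
    also have "\<dots> \<le> ?m (Y n) + ?m (\<Union>i. R (i + n))"
      by (rule covering_measure_Un_le)
    also have "\<dots> \<le> ?m (Y n) + ennreal e"
      by (intro add_left_mono order_trans[OF covering_measure_UNION_le tail])
    finally have "?m (X \<inter> F) + ?m (X - F) \<le> ?m (X \<inter> F) + (?m (Y n) + ennreal e)"
      by (rule add_left_mono)
    also have "\<dots> \<le> ?m X + ennreal e"
      unfolding add.assoc[symmetric] by (intro add_right_mono step1)
    finally show "?m (X \<inter> F) + ?m (X - F) \<le> ?m X + ennreal e" .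
  qed
qed

text \<open>Caratheodory's theorem gives a measure on the measurable sets of the outer measure;
  these contain the closed sets and therefore all Borel sets.\<close>

lemma measure_space_covering_measure_dist:
  "measure_space UNIV (sets (borel :: 'a::metric_space measure)) (covering_measure dist UNIV \<zeta>)"
proof -
  let ?m = "covering_measure dist (UNIV :: 'a set set) \<zeta>"
  let ?L = "lambda_system UNIV (UNIV :: 'a set set) ?m"
  have L: "measure_space UNIV ?L ?m"
    using sigma_algebra.caratheodory_lemma[OF sigma_algebra_Pow[of UNIV] outer_measure_space_covering_measure[of dist UNIV \<zeta>, folded Pow_UNIV]]
    by simp
  then have sa: "sigma_algebra UNIV ?L"
    by (simp add: measure_space_def)
  have "{F. closed F} \<subseteq> ?L"
  proof
    fix F :: "'a set" assume "F \<in> {F. closed F}"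
    then have F: "closed F" by simp
    have "?m (F \<inter> X) + ?m (X - F) = ?m X" for X
    proof (rule antisym)
      show "?m (F \<inter> X) + ?m (X - F) \<le> ?m X"
        using covering_measure_dist_closed[OF F, of \<zeta> X] by (simp add: Int_commute)
      have "?m ((F \<inter> X) \<union> (X - F)) \<le> ?m (F \<inter> X) + ?m (X - F)"
        by (rule covering_measure_Un_le)
      moreover have "(F \<inter> X) \<union> (X - F) = X" by auto
      ultimately show "?m X \<le> ?m (F \<inter> X) + ?m (X - F)" by simp
    qed
    moreover have "(UNIV - F) \<inter> X = X - F" for X by auto
    ultimately show "F \<in> ?L"
      by (simp add: lambda_system_def)
  qed
  then have "sigma_sets UNIV {F :: 'a set. closed F} \<subseteq> ?L"
    by (rule sigma_algebra.sigma_sets_subset[OF sa])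
  then have "sets (borel :: 'a measure) \<subseteq> ?L"
    unfolding borel_eq_closed by simp
  then show ?thesis
    using measure_down[OF L, of "sets borel"] sets.sigma_algebra_axioms[of borel] by simp
qed

section \<open>Hausdorff measure on Borel sets and under Lipschitz maps\<close>

definition hausdorff_borel :: "nat \<Rightarrow> 'a::euclidean_space measure" where
  "hausdorff_borel k = measure_of UNIV (sets borel) (hausdorff_unnormalized k)"

lemma sets_hausdorff_borel [simp, measurable_cong]: "sets (hausdorff_borel k) = sets borel"
  unfolding hausdorff_borel_def using sets.sigma_sets_eq[of borel] by (simp add: sets_measure_of_conv)

lemma emeasure_hausdorff_borel:
  assumes "A \<in> sets borel"
  shows "emeasure (hausdorff_borel k) A = hausdorff_unnormalized k A"
  using measure_space_covering_measure_dist[of "\<lambda>B. ediam dist B ^ k"] assms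
  unfolding hausdorff_borel_def
  by (intro emeasure_measure_of_sigma)
    (auto simp: measure_space_def hausdorff_unnormalized_def[abs_def])

lemma hausdorff_unnormalized_mono:
  "A \<subseteq> B \<Longrightarrow> hausdorff_unnormalized k A \<le> hausdorff_unnormalized k B"
  unfolding hausdorff_unnormalized_def by (rule covering_measure_mono)

text \<open>Covering sets are cut down to \<open>A\<close> before being mapped, since the Lipschitz
  bound holds only there.\<close>

lemma hausdorff_unnormalized_image_le:
  assumes L: "\<And>x y. x \<in> A \<Longrightarrow> y \<in> A \<Longrightarrow> dist (f x) (f y) \<le> L * dist x y" and "0 < L"
  shows "hausdorff_unnormalized k (f ` A) \<le> ennreal L ^ k * hausdorff_unnormalized k A"
proof (cases "hausdorff_unnormalized k A < \<infinity>")
  case False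
  then show ?thesis
    using \<open>0 < L\<close> by (simp add: less_top[symmetric] ennreal_mult_top ennreal_power)
next
  case True
  have "covering_measure dist UNIV (\<lambda>B. ediam dist B ^ k) (f ` A) \<le> ennreal L ^ k * hausdorff_unnormalized k A"
  proof (rule covering_measure_leI)
    fix \<delta> \<epsilon> :: real assume "0 < \<delta>" "0 < \<epsilon>"
    then have pos: "0 < \<delta> / L" "0 < \<epsilon> / L ^ k"
      using \<open>0 < L\<close> by auto
    obtain C where C: "C \<in> coverings dist UNIV A (\<delta> / L)"
        "(\<Sum>\<^sub>\<infinity>B\<in>C. ediam dist B ^ k) \<le> hausdorff_unnormalized k A + ennreal (\<epsilon> / L ^ k)"
      using covering_measure_approx[of dist UNIV "\<lambda>B. ediam dist B ^ k" A, OF _ pos] True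
      unfolding hausdorff_unnormalized_def by blast
    let ?g = "\<lambda>B. f ` (B \<inter> A)"
    have diam: "ediam dist (?g B) \<le> ennreal L * ediam dist B" for B
      unfolding ediam_def
    proof (safe intro!: SUP_least)
      fix x y assume xy: "x \<in> B" "x \<in> A" "y \<in> B" "y \<in> A"
      have "ennreal (dist (f x) (f y)) \<le> ennreal (L * dist x y)"
        by (intro ennreal_leI L xy)
      also have "\<dots> = ennreal L * ennreal (dist x y)"
        using \<open>0 < L\<close> by (simp add: ennreal_mult)
      also have "\<dots> \<le> ennreal L * ediam dist B"
        by (intro mult_left_mono ediam_ge xy) auto
      finally show "ennreal (dist (f x) (f y)) \<le> ennreal L * (SUP x\<in>B. SUP y\<in>B. ennreal (dist x y))"
        by (simp add: ediam_def)
    qed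
    have "(\<Sum>\<^sub>\<infinity>B\<in>?g ` C. ediam dist B ^ k) \<le> (\<Sum>\<^sub>\<infinity>B\<in>C. ediam dist (?g B) ^ k)"
      by (rule infsum_ennreal_image_le)
    also have "\<dots> \<le> (\<Sum>\<^sub>\<infinity>B\<in>C. ennreal L ^ k * ediam dist B ^ k)"
      unfolding power_mult_distrib[symmetric] by (intro infsum_ennreal_mono power_mono diam) auto
    also have "\<dots> \<le> ennreal L ^ k * (hausdorff_unnormalized k A + ennreal (\<epsilon> / L ^ k))"
      unfolding infsum_ennreal_cmult by (intro mult_left_mono C(2)) auto
    also have "\<dots> = ennreal L ^ k * hausdorff_unnormalized k A + ennreal \<epsilon>"
      using \<open>0 < L\<close> \<open>0 < \<epsilon>\<close> by (simp add: distrib_left ennreal_power ennreal_mult[symmetric])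
    finally have "(\<Sum>\<^sub>\<infinity>B\<in>?g ` C. ediam dist B ^ k) \<le> ennreal L ^ k * hausdorff_unnormalized k A + ennreal \<epsilon>" .
    moreover have "?g ` C \<in> coverings dist UNIV (f ` A) \<delta>"
      unfolding coverings_def
    proof (intro CollectI conjI ballI)
      show "f ` A \<subseteq> \<Union> (?g ` C)"
        using C(1) unfolding coverings_def by blast
      show "countable (?g ` C)"
        using C(1) by (simp add: coverings_def)
      fix X assume "X \<in> ?g ` C"
      then obtain B where B: "B \<in> C" "X = ?g B" by blast
      have "ediam dist X \<le> ennreal L * ennreal (\<delta> / L)"
        using diam[of B] B C(1) unfolding coverings_def
        by (auto intro: order_trans[OF _ mult_left_mono])
      also have "\<dots> = ennreal \<delta>"
        using \<open>0 < L\<close> \<open>0 < \<delta>\<close> by (simp add: ennreal_mult[symmetric])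
      finally show "ediam dist X \<le> ennreal \<delta>" .
    qed simp
    ultimately show "\<exists>C\<in>coverings dist UNIV (f ` A) \<delta>.
        (\<Sum>\<^sub>\<infinity>B\<in>C. ediam dist B ^ k) \<le> ennreal L ^ k * hausdorff_unnormalized k A + ennreal \<epsilon>"
      by blast
  qed
  then show ?thesis
    by (simp add: hausdorff_unnormalized_def)
qed

section \<open>Positivity and finiteness of Hausdorff measure on subspaces\<close>

definition cube :: "'a::euclidean_space set \<Rightarrow> 'a set" where
  "cube E = {(\<Sum>b\<in>E. t b *\<^sub>R b) |t. \<forall>b\<in>E. 0 \<le> t b \<and> t b \<le> 1}"

text \<open>The coordinate set of \<open>unit_cube\<close> is an arbitrary choice. The estimates
  below hold for every coordinate set of the right size, hence for the chosen one.\<close>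

lemma unit_cubeE:
  assumes "k \<le> DIM('a)"
  obtains E where "E \<subseteq> (Basis :: 'a::euclidean_space set)" "card E = k" "(unit_cube k :: 'a set) = cube E"
proof -
  have "\<exists>E. E \<subseteq> (Basis :: 'a set) \<and> card E = k"
    using obtain_subset_with_card_n[OF assms] by metis
  from someI_ex[OF this] show ?thesis
    by (intro that) (auto simp: unit_cube_def Let_def cube_def)
qed

lemma inner_sum_subset_Basis:
  assumes "E \<subseteq> Basis" "c \<in> Basis"
  shows "(\<Sum>b\<in>E. t b *\<^sub>R b) \<bullet> c = (if c \<in> E then t c else 0)"
proof -
  have "(\<Sum>b\<in>E. t b *\<^sub>R b) \<bullet> c = (\<Sum>b\<in>E. if b = c then t b else 0)"
    using assms unfolding inner_sum_left by (intro sum.cong) (auto simp: inner_Basis)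
  also have "\<dots> = (if c \<in> E then t c else 0)"
    using finite_subset[OF assms(1) finite_Basis] by simp
  finally show ?thesis .
qed

text \<open>Subdivision into \<open>m ^ k\<close> cubes of diameter at most \<open>k / m\<close>
  bounds the covering sums by \<open>k ^ k\<close>, independently of \<open>m\<close>.\<close>

lemma hausdorff_cube_finite:
  fixes E :: "'a::euclidean_space set"
  assumes E: "E \<subseteq> Basis" "card E = k"
  shows "hausdorff_unnormalized k (cube E) < \<infinity>"
proof -
  have fE: "finite E"
    by (rule finite_subset[OF E(1) finite_Basis])
  have "covering_measure dist UNIV (\<lambda>B. ediam dist B ^ k) (cube E) \<le> ennreal (real k ^ k)"
  proof (rule covering_measure_leI)
    fix \<delta> \<epsilon> :: real assume "0 < \<delta>" "0 < \<epsilon>"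
    obtain m :: nat where m: "real k / \<delta> < real m"
      using reals_Archimedean2 by blast
    have "0 < m"
      using m \<open>0 < \<delta>\<close> by (cases m) (auto simp: field_simps)
    then have km: "real k / m \<le> \<delta>"
      using m \<open>0 < \<delta>\<close> by (simp add: field_simps)
    define J where "J = (E \<rightarrow>\<^sub>E {..<m})"
    define Q where "Q j = {(\<Sum>b\<in>E. t b *\<^sub>R b) |t. \<forall>b\<in>E. real (j b) / m \<le> t b \<and> t b \<le> (real (j b) + 1) / m}"
      for j :: "'a \<Rightarrow> nat"
    have J: "finite J" "card J = m ^ k"
      using fE E(2) by (auto simp: J_def card_PiE intro: finite_PiE)
    have diam: "ediam dist (Q j) \<le> ennreal (real k / m)" for j
    proof (rule ediam_leI)
      fix x y assume "x \<in> Q j" "y \<in> Q j"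
      then obtain t s where t: "x = (\<Sum>b\<in>E. t b *\<^sub>R b)" "\<forall>b\<in>E. real (j b) / m \<le> t b \<and> t b \<le> (real (j b) + 1) / m"
        and s: "y = (\<Sum>b\<in>E. s b *\<^sub>R b)" "\<forall>b\<in>E. real (j b) / m \<le> s b \<and> s b \<le> (real (j b) + 1) / m"
        by (auto simp: Q_def)
      have "dist x y = norm (\<Sum>b\<in>E. (t b - s b) *\<^sub>R b)"
        by (simp add: t(1) s(1) dist_norm sum_subtractf scaleR_diff_left)
      also have "\<dots> \<le> (\<Sum>b\<in>E. norm ((t b - s b) *\<^sub>R b))"
        by (rule norm_sum)
      also have "\<dots> \<le> (\<Sum>b\<in>E. 1 / m)"
      proof (rule sum_mono)
        fix b assume b: "b \<in> E"
        have "\<bar>t b - s b\<bar> \<le> (real (j b) + 1) / m - real (j b) / m"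
          using t(2) s(2) b by (force simp: abs_le_iff)
        also have "\<dots> = 1 / m"
          by (simp add: diff_divide_distrib[symmetric])
        finally show "norm ((t b - s b) *\<^sub>R b) \<le> 1 / m"
          using b E(1) by (auto simp: subset_iff)
      qed
      also have "\<dots> = real k / m"
        by (simp add: E(2))
      finally show "dist x y \<le> real k / m" .
    qed
    have "(\<Sum>\<^sub>\<infinity>B\<in>Q ` J. ediam dist B ^ k) \<le> (\<Sum>\<^sub>\<infinity>j\<in>J. ediam dist (Q j) ^ k)"
      by (rule infsum_ennreal_image_le)
    also have "\<dots> \<le> (\<Sum>j\<in>J. ennreal (real k / m) ^ k)"
      unfolding infsum_finite[OF J(1)] using diam by (intro sum_mono power_mono) auto
    also have "\<dots> = ennreal (real (m ^ k)) * ennreal ((real k / m) ^ k)"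
      by (simp only: sum_constant J ennreal_of_nat_eq_real_of_nat) (simp add: ennreal_power)
    also have "\<dots> = ennreal (real k ^ k)"
      using \<open>0 < m\<close> by (simp add: ennreal_mult[symmetric] power_divide)
    finally have le: "(\<Sum>\<^sub>\<infinity>B\<in>Q ` J. ediam dist B ^ k) \<le> ennreal (real k ^ k)" .
    have "Q ` J \<in> coverings dist UNIV (cube E) \<delta>"
      unfolding coverings_def
    proof (intro CollectI conjI ballI)
      show "countable (Q ` J)"
        using J by (simp add: countable_finite)
      show "ediam dist B \<le> ennreal \<delta>" if "B \<in> Q ` J" for B
        using that diam ennreal_leI[OF km] by (auto intro: order_trans)
      show "cube E \<subseteq> \<Union> (Q ` J)"
      proof
        fix x assume "x \<in> cube E"
        then obtain t where t: "x = (\<Sum>b\<in>E. t b *\<^sub>R b)" "\<forall>b\<in>E. 0 \<le> t b \<and> t b \<le> 1"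
          by (auto simp: cube_def)
        \<comment> \<open>The minimum with \<open>m - 1\<close> assigns the right endpoint
          \<open>t b = 1\<close> to the last subinterval.\<close>
        define j where "j = restrict (\<lambda>b. min (m - 1) (nat \<lfloor>t b * m\<rfloor>)) E"
        have "j \<in> J"
          using \<open>0 < m\<close> by (auto simp: j_def J_def)
        moreover have "real (j b) / m \<le> t b \<and> t b \<le> (real (j b) + 1) / m" if b: "b \<in> E" for b
        proof -
          have tb: "0 \<le> t b" "t b \<le> 1"
            using t b by auto
          have fl: "real (nat \<lfloor>t b * m\<rfloor>) \<le> t b * m" "t b * m < real (nat \<lfloor>t b * m\<rfloor>) + 1"
            using tb by (auto simp: of_nat_nat)
          have "real (j b) \<le> t b * m"
            using fl b by (simp add: j_def min_def)
          moreover have "t b * m \<le> real (j b) + 1"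
          proof (cases "nat \<lfloor>t b * m\<rfloor> \<le> m - 1")
            case False
            then have "real (j b) + 1 = m"
              using \<open>0 < m\<close> b by (simp add: j_def min_def)
            then show ?thesis
              using tb by (simp add: mult_left_le_one_le)
          qed (use fl b in \<open>simp add: j_def min_def\<close>)
          ultimately show ?thesis
            using \<open>0 < m\<close> by (simp add: field_simps)
        qed
        ultimately have "x \<in> Q j" "j \<in> J"
          using t(1) by (auto simp: Q_def)
        then show "x \<in> \<Union> (Q ` J)" by blast
      qed
    qed simp
    then show "\<exists>C\<in>coverings dist UNIV (cube E) \<delta>. (\<Sum>\<^sub>\<infinity>B\<in>C. ediam dist B ^ k) \<le> ennreal (real k ^ k) + ennreal \<epsilon>"
      using le by (intro bexI[of _ "Q ` J"]) (auto intro: order_trans)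
  qed
  then show ?thesis
    unfolding hausdorff_unnormalized_def by (rule le_less_trans) simp
qed

text \<open>Thickening by unit intervals in the coordinates outside \<open>E\<close> turns a
  covering of the cube into a covering of the full-dimensional unit cube by boxes. The volume of
  such a box is \<open>2 ^ k\<close> times the \<open>k\<close>-th power of a diameter, so the
  covering sums cannot be arbitrarily small.\<close>

lemma hausdorff_cube_pos:
  fixes E :: "'a::euclidean_space set"
  assumes E: "E \<subseteq> Basis" "card E = k"
  shows "0 < hausdorff_unnormalized k (cube E)"
proof (rule ccontr)
  assume "\<not> ?thesis"
  then have H0: "covering_measure dist UNIV (\<lambda>B. ediam dist B ^ k) (cube E) = 0"
    by (simp add: hausdorff_unnormalized_def not_less)
  \<comment> \<open>With the factor \<open>2 ^ k\<close> the tolerance leaves total volume at most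
    one half, against volume one.\<close>
  obtain C where C: "C \<in> coverings dist UNIV (cube E) 1"
      "(\<Sum>\<^sub>\<infinity>B\<in>C. ediam dist B ^ k) \<le> ennreal (1 / 2 ^ Suc k)"
    using covering_measure_approx[of dist UNIV "\<lambda>B. ediam dist B ^ k" "cube E" 1 "1 / 2 ^ Suc k"]
    by (auto simp: H0)
  define r where "r B = enn2real (ediam dist B)" for B :: "'a set"
  define p where "p B = (SOME x. x \<in> B)" for B :: "'a set"
  define lo where "lo B = (\<Sum>b\<in>Basis. (if b \<in> E then p B \<bullet> b - r B else 0) *\<^sub>R b)" for B
  define up where "up B = (\<Sum>b\<in>Basis. (if b \<in> E then p B \<bullet> b + r B else 1) *\<^sub>R b)" for B
  have r: "ediam dist B = ennreal (r B)" if "B \<in> C" for B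
  proof -
    have "ediam dist B \<le> ennreal 1"
      using C(1) that by (auto simp: coverings_def)
    then have "ediam dist B < top"
      by (rule le_less_trans) simp
    then show ?thesis
      by (simp add: r_def)
  qed
  have r_nonneg: "0 \<le> r B" for B
    by (simp add: r_def)
  have vol: "emeasure lborel (cbox (lo B) (up B)) = ennreal ((2 * r B) ^ k)" for B
  proof -
    have "emeasure lborel (cbox (lo B) (up B)) = ennreal (\<Prod>b\<in>Basis. (up B - lo B) \<bullet> b)"
      using r_nonneg[of B] by (intro emeasure_lborel_cbox) (auto simp: lo_def up_def)
    also have "(\<Prod>b\<in>Basis. (up B - lo B) \<bullet> b) = (\<Prod>b\<in>Basis. if b \<in> E then 2 * r B else 1)"
      by (intro prod.cong) (auto simp: lo_def up_def inner_diff_left)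
    also have "\<dots> = (2 * r B) ^ k"
      using E by (simp add: prod.If_cases Int_absorb1)
    finally show ?thesis .
  qed
  have "cbox 0 One \<subseteq> (\<Union>B\<in>C. cbox (lo B) (up B))"
  proof
    fix x :: 'a assume x: "x \<in> cbox 0 One"
    define y where "y = (\<Sum>b\<in>E. (x \<bullet> b) *\<^sub>R b)"
    have xb: "0 \<le> x \<bullet> b" "x \<bullet> b \<le> 1" if "b \<in> Basis" for b
      using x that by (auto simp: mem_box)
    then have "y \<in> cube E"
      using E(1) by (auto simp: cube_def y_def)
    then obtain B where B: "B \<in> C" "y \<in> B"
      using C(1) by (auto simp: coverings_def)
    then have "p B \<in> B"
      unfolding p_def by (metis someI)
    then have "ennreal (dist y (p B)) \<le> ennreal (r B)"
      using ediam_ge[of y B "p B" dist] r B by auto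
    then have d: "dist y (p B) \<le> r B"
      using r_nonneg by simp
    have "\<bar>x \<bullet> b - p B \<bullet> b\<bar> \<le> r B" if b: "b \<in> E" for b
    proof -
      have "x \<bullet> b - p B \<bullet> b = (y - p B) \<bullet> b"
        using b E(1) inner_sum_subset_Basis[OF E(1), of b "\<lambda>b. x \<bullet> b"] by (auto simp: y_def inner_diff_left)
      also have "\<bar>\<dots>\<bar> \<le> norm (y - p B)"
        using b E(1) by (intro Basis_le_norm) auto
      finally show ?thesis
        using d by (simp add: dist_norm)
    qed
    then have "x \<in> cbox (lo B) (up B)"
      using xb by (fastforce simp: mem_box lo_def up_def abs_le_iff)
    then show "x \<in> (\<Union>B\<in>C. cbox (lo B) (up B))"
      using B(1) by blast
  qed
  moreover have cC: "countable C"
    using C(1) by (simp add: coverings_def)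
  ultimately have "emeasure lborel (cbox (0::'a) One) \<le> emeasure lborel (\<Union> ((\<lambda>B. cbox (lo B) (up B)) ` C))"
    by (intro emeasure_mono) auto
  also have "\<dots> \<le> (\<Sum>\<^sub>\<infinity>B\<in>(\<lambda>B. cbox (lo B) (up B)) ` C. emeasure lborel B)"
    using cC by (intro emeasure_Union_le_infsum) auto
  also have "\<dots> \<le> (\<Sum>\<^sub>\<infinity>B\<in>C. emeasure lborel (cbox (lo B) (up B)))"
    by (rule infsum_ennreal_image_le)
  also have "\<dots> \<le> (\<Sum>\<^sub>\<infinity>B\<in>C. ennreal (2 ^ k) * ediam dist B ^ k)"
    using r r_nonneg by (intro infsum_ennreal_mono) (simp add: vol ennreal_power ennreal_mult[symmetric] power_mult_distrib)
  also have "\<dots> \<le> ennreal (2 ^ k) * ennreal (1 / 2 ^ Suc k)"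
    unfolding infsum_ennreal_cmult by (intro mult_left_mono C(2)) auto
  also have "\<dots> = ennreal (1 / 2)"
    by (simp add: ennreal_mult[symmetric])
  also have "emeasure lborel (cbox (0::'a) One) = ennreal 1"
    by (subst emeasure_lborel_cbox) auto
  finally have "ennreal 1 \<le> ennreal (1 / 2)" .
  then have "1 \<le> (1 / 2 :: real)"
    by (subst (asm) ennreal_le_iff) simp_all
  then show False by simp
qed

lemma subspace_cube_isometry:
  fixes V :: "'a::euclidean_space set"
  assumes V: "subspace V" "dim V = k" and E: "E \<subseteq> Basis" "card E = k"
  obtains f g where "linear f" "linear g" "f ` span E = V" "g ` V = span E"
    "\<And>x y. x \<in> span E \<Longrightarrow> y \<in> span E \<Longrightarrow> dist (f x) (f y) = dist x y"
    "\<And>x y. x \<in> V \<Longrightarrow> y \<in> V \<Longrightarrow> dist (g x) (g y) = dist x y"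
    "\<And>x. x \<in> span E \<Longrightarrow> g (f x) = x" "\<And>x. x \<in> V \<Longrightarrow> f (g x) = x"
proof -
  have "dim (span E) = dim V"
    using E V by (simp add: dim_eq_card_independent independent_mono[OF independent_Basis])
  then obtain f g where fg: "linear f" "linear g" "f ` span E = V" "g ` V = span E"
      "\<And>x. x \<in> span E \<Longrightarrow> norm (f x) = norm x" "\<And>x. x \<in> V \<Longrightarrow> norm (g x) = norm x"
      "\<And>x. x \<in> span E \<Longrightarrow> g (f x) = x" "\<And>x. x \<in> V \<Longrightarrow> f (g x) = x"
    using isometries_subspaces[of "span E" V] V(1) by (auto intro: subspace_span)
  have "dist (f x) (f y) = dist x y" if "x \<in> span E" "y \<in> span E" for x y
    using fg(5)[OF span_diff[OF that]] by (simp add: dist_norm linear_diff[OF fg(1)])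
  moreover have "dist (g x) (g y) = dist x y" if "x \<in> V" "y \<in> V" for x y
    using fg(6)[OF subspace_diff[OF V(1) that]] by (simp add: dist_norm linear_diff[OF fg(2)])
  ultimately show ?thesis
    using that[of f g] fg by blast
qed

text \<open>Rescaled by \<open>2 * R\<close> and centred, the cube fills all coordinates in
  \<open>E\<close> of absolute value at most \<open>R\<close>. An isometry onto \<open>V\<close>
  then makes the bounded set part of a Lipschitz image of the cube.\<close>

lemma hausdorff_bounded_finite:
  fixes V :: "'a::euclidean_space set"
  assumes V: "subspace V" "dim V = k" and A: "bounded A" "A \<subseteq> V"
  shows "hausdorff_unnormalized k A < \<infinity>"
proof -
  have "k \<le> DIM('a)"
    using V dim_subset_UNIV by blast
  then obtain E where E: "E \<subseteq> (Basis :: 'a set)" "card E = k"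
    by (metis obtain_subset_with_card_n)
  obtain f g where fg: "linear f" "linear g" "f ` span E = V" "g ` V = span E"
    "\<And>x y. x \<in> span E \<Longrightarrow> y \<in> span E \<Longrightarrow> dist (f x) (f y) = dist x y"
    "\<And>x y. x \<in> V \<Longrightarrow> y \<in> V \<Longrightarrow> dist (g x) (g y) = dist x y"
    "\<And>x. x \<in> span E \<Longrightarrow> g (f x) = x" "\<And>x. x \<in> V \<Longrightarrow> f (g x) = x"
    by (rule subspace_cube_isometry[OF V E], rule that)
  obtain R where R: "0 < R" "\<And>x. x \<in> A \<Longrightarrow> norm x \<le> R"
    using A(1) by (auto simp: bounded_pos)
  define c where "c = (\<Sum>b\<in>E. b)"
  define h where "h x = f ((2 * R) *\<^sub>R x - R *\<^sub>R c)" for x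
  have span: "(2 * R) *\<^sub>R x - R *\<^sub>R c \<in> span E" if "x \<in> cube E" for x
    using that unfolding cube_def c_def by (auto intro!: span_diff span_scale span_sum intro: span_base)
  have "A \<subseteq> h ` cube E"
  proof
    fix a assume a: "a \<in> A"
    then have "g a \<in> span E"
      using A(2) fg(4) by blast
    define t where "t b = (g a \<bullet> b + R) / (2 * R)" for b
    have ga: "g a = (\<Sum>b\<in>E. (g a \<bullet> b) *\<^sub>R b)"
    proof -
      have "g a \<bullet> b = 0" if "b \<in> Basis - E" for b
        using \<open>g a \<in> span E\<close>
      proof (induction rule: span_induct)
        case base
        then show ?case
          using that by (auto simp: subspace_def inner_add_left)
      next
        case (step x)
        then show ?case
          using that E(1) by (auto intro!: inner_not_same_Basis)
      qed
      then have "(\<Sum>b\<in>Basis. (g a \<bullet> b) *\<^sub>R b) = (\<Sum>b\<in>E. (g a \<bullet> b) *\<^sub>R b)"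
        using E(1) by (intro sum.mono_neutral_right) auto
      then show ?thesis
        by (simp add: euclidean_representation)
    qed
    have "norm (g a) \<le> R"
      using fg(6)[of a 0] a A(2) R(2)[OF a] linear_0[OF fg(2)] subspace_0[OF V(1)] by (auto simp: dist_norm)
    then have "\<bar>g a \<bullet> b\<bar> \<le> R" if "b \<in> E" for b
      using Basis_le_norm[of b "g a"] that E(1) by auto
    then have "- R \<le> g a \<bullet> b \<and> g a \<bullet> b \<le> R" if "b \<in> E" for b
      using that by (simp add: abs_le_iff minus_le_iff)
    then have "0 \<le> t b \<and> t b \<le> 1" if "b \<in> E" for b
      using that R(1) by (force simp: t_def field_simps)
    then have "(\<Sum>b\<in>E. t b *\<^sub>R b) \<in> cube E"
      by (auto simp: cube_def)
    moreover have "h (\<Sum>b\<in>E. t b *\<^sub>R b) = a"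
    proof -
      have "(2 * R) *\<^sub>R (\<Sum>b\<in>E. t b *\<^sub>R b) - R *\<^sub>R c = (\<Sum>b\<in>E. (g a \<bullet> b) *\<^sub>R b)"
        unfolding c_def scaleR_sum_right sum_subtractf[symmetric]
      proof (intro sum.cong refl)
        fix b
        have "2 * R * t b - R = g a \<bullet> b"
          using R(1) by (simp add: t_def)
        then show "(2 * R) *\<^sub>R t b *\<^sub>R b - R *\<^sub>R b = (g a \<bullet> b) *\<^sub>R b"
          by (simp flip: scaleR_diff_left)
      qed
      then show ?thesis
        using ga a A(2) fg(8) by (auto simp: h_def)
    qed
    ultimately show "a \<in> h ` cube E"
      by blast
  qed
  then have "hausdorff_unnormalized k A \<le> hausdorff_unnormalized k (h ` cube E)"
    by (rule hausdorff_unnormalized_mono)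
  also have "\<dots> \<le> ennreal (2 * R) ^ k * hausdorff_unnormalized k (cube E)"
  proof (rule hausdorff_unnormalized_image_le)
    fix x y assume "x \<in> cube E" "y \<in> cube E"
    then have "dist (h x) (h y) = dist ((2 * R) *\<^sub>R x - R *\<^sub>R c) ((2 * R) *\<^sub>R y - R *\<^sub>R c)"
      unfolding h_def by (intro fg(5) span)
    also have "\<dots> = norm ((2 * R) *\<^sub>R (x - y))"
      by (simp add: dist_norm scaleR_diff_right)
    also have "\<dots> = 2 * R * dist x y"
      using R(1) by (simp add: dist_norm)
    finally show "dist (h x) (h y) \<le> 2 * R * dist x y" by simp
  qed (use R in auto)
  also have "\<dots> < \<infinity>"
    using hausdorff_cube_finite[OF E] R by (simp add: ennreal_mult_less_top ennreal_power)
  finally show ?thesis .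
qed

text \<open>A small copy of the cube fits into the neighbourhood; mapping it back with Lipschitz
  constant \<open>1 / s\<close> recovers the cube, whose measure is positive.\<close>

lemma hausdorff_neighbourhood_pos:
  fixes V :: "'a::euclidean_space set"
  assumes V: "subspace V" "dim V = k" and U: "0 \<in> interior U"
  shows "0 < hausdorff_unnormalized k (V \<inter> U)"
proof -
  have "k \<le> DIM('a)"
    using V dim_subset_UNIV by blast
  then obtain E where E: "E \<subseteq> (Basis :: 'a set)" "card E = k"
    by (metis obtain_subset_with_card_n)
  obtain f g where fg: "linear f" "linear g" "f ` span E = V" "g ` V = span E"
    "\<And>x y. x \<in> span E \<Longrightarrow> y \<in> span E \<Longrightarrow> dist (f x) (f y) = dist x y"
    "\<And>x y. x \<in> V \<Longrightarrow> y \<in> V \<Longrightarrow> dist (g x) (g y) = dist x y"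
    "\<And>x. x \<in> span E \<Longrightarrow> g (f x) = x" "\<And>x. x \<in> V \<Longrightarrow> f (g x) = x"
    by (rule subspace_cube_isometry[OF V E], rule that)
  obtain \<epsilon> where \<epsilon>: "0 < \<epsilon>" "ball 0 \<epsilon> \<subseteq> U"
    using U by (auto simp: mem_interior)
  \<comment> \<open>Points of the cube have norm at most \<open>k\<close>; the added one gives
    strict inclusion and covers \<open>k = 0\<close>.\<close>
  define s where "s = \<epsilon> / (real k + 1)"
  have s: "0 < s"
    using \<epsilon> by (simp add: s_def)
  define A where "A = (\<lambda>x. s *\<^sub>R f x) ` cube E"
  have span: "cube E \<subseteq> span E"
    unfolding cube_def by (auto intro!: span_sum span_scale intro: span_base)
  have "A \<subseteq> V \<inter> U"
  proof
    fix y assume "y \<in> A"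
    then obtain x where x: "x \<in> cube E" "y = s *\<^sub>R f x"
      by (auto simp: A_def)
    then obtain t where t: "x = (\<Sum>b\<in>E. t b *\<^sub>R b)" "\<forall>b\<in>E. 0 \<le> t b \<and> t b \<le> 1"
      by (auto simp: cube_def)
    have "norm x \<le> (\<Sum>b\<in>E. norm (t b *\<^sub>R b))"
      unfolding t(1) by (rule norm_sum)
    also have "\<dots> \<le> (\<Sum>b\<in>E. 1)"
      using t(2) E(1) by (intro sum_mono) (auto simp: subset_iff)
    finally have "norm x \<le> real k"
      by (simp add: E(2))
    moreover have "norm (f x) = norm x"
      using fg(5)[of x 0] span x(1) linear_0[OF fg(1)] by (auto simp: dist_norm span_zero)
    ultimately have "norm y \<le> s * real k"
      using s x(2) by simp
    also have "\<dots> < \<epsilon>"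
      using \<epsilon>(1) by (simp add: s_def field_simps)
    finally have "y \<in> U"
      using \<epsilon>(2) by auto
    moreover have "y \<in> V"
      using x span fg(3) V(1) by (auto intro: subspace_scale)
    ultimately show "y \<in> V \<inter> U" by simp
  qed
  moreover have "cube E = (\<lambda>y. (1 / s) *\<^sub>R g y) ` A"
  proof -
    have "(1 / s) *\<^sub>R g (s *\<^sub>R f x) = x" if "x \<in> cube E" for x
      using that span s fg(7) by (auto simp: linear_scale[OF fg(2)])
    then show ?thesis
      unfolding A_def image_image by simp
  qed
  then have "hausdorff_unnormalized k (cube E) = hausdorff_unnormalized k ((\<lambda>y. (1 / s) *\<^sub>R g y) ` A)"
    by simp
  also have "\<dots> \<le> ennreal (1 / s) ^ k * hausdorff_unnormalized k A"
  proof (rule hausdorff_unnormalized_image_le)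
    fix x y assume "x \<in> A" "y \<in> A"
    then have "x \<in> V" "y \<in> V"
      using \<open>A \<subseteq> V \<inter> U\<close> by auto
    then have "dist (g x) (g y) = dist x y"
      by (rule fg(6))
    then show "dist ((1 / s) *\<^sub>R g x) ((1 / s) *\<^sub>R g y) \<le> 1 / s * dist x y"
      using s by (simp add: dist_norm flip: scaleR_diff_right)
  qed (use s in simp)
  finally have "hausdorff_unnormalized k A \<noteq> 0"
    using hausdorff_cube_pos[OF E] by auto
  then show ?thesis
    using hausdorff_unnormalized_mono[OF \<open>A \<subseteq> V \<inter> U\<close>, of k] by (auto simp: zero_less_iff_neq_zero)
qed

text \<open>
  The image under \<open>x \<mapsto> x + q x\<close> is approximated by cutting \<open>K\<close> into pieces on which \<open>q\<close> is almost
  constant and translating each of them; the translated pieces stay disjoint because \<open>q\<close> is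
  invariant under \<open>W\<close>.
\<close>

lemma hausdorff_shear_le:
  fixes V :: "'a::euclidean_space set"
  assumes V: "subspace V" "dim V = k" and W: "W \<subseteq> V" "subspace W"
    and K: "compact K" "K \<subseteq> V"
    and q: "continuous_on UNIV q" "\<And>x. q x \<in> W" "\<And>x w. w \<in> W \<Longrightarrow> q (x + w) = q x"
  shows "hausdorff_unnormalized k K \<le> hausdorff_unnormalized k ((\<lambda>x. x + q x) ` K)"
proof (cases "K = {}")
  case False
  define T where "T = (\<lambda>x. x + q x) ` K"
  have T: "compact T" "T \<subseteq> V" "T \<noteq> {}"
    using K V(1) W(1) q(2) False unfolding T_def
    by (auto intro!: compact_continuous_image continuous_intros continuous_on_subset[OF q(1)]
        intro: subspace_add)
  \<comment> \<open>The translated pieces lie only near \<open>T\<close>. They are caught in closed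
    neighbourhoods of \<open>T\<close> within \<open>V\<close>, which shrink to
    \<open>T\<close>.\<close>
  define N where "N m = V \<inter> {x. infdist x T \<le> 1 / real (Suc m)}" for m
  have N_closed: "closed (N m)" for m
    unfolding N_def using closed_subspace[OF V(1)]
    by (intro closed_Int closed_Collect_le continuous_intros) auto
  have N_borel: "N m \<in> sets borel" for m
    by (intro borel_closed N_closed)
  have le: "hausdorff_unnormalized k K \<le> hausdorff_unnormalized k (N m)" for m
  proof -
    define \<epsilon> where "\<epsilon> = 1 / real (Suc m)"
    have "compact (q ` K)"
      by (intro compact_continuous_image continuous_on_subset[OF q(1)] K) auto
    then obtain Z where Z: "finite Z" "Z \<subseteq> q ` K" "q ` K \<subseteq> (\<Union>z\<in>Z. ball z \<epsilon>)"
      using seq_compact_imp_totally_bounded[OF compact_imp_seq_compact, of "q ` K"]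
      by (metis \<epsilon>_def of_nat_0_less_iff zero_less_Suc zero_less_divide_1_iff)
    obtain z n where z: "Z = z ` {..<n::nat}"
      using finite_imp_nat_seg_image_inj_on[OF Z(1)] by (auto simp: lessThan_def)
    \<comment> \<open>Points are sorted by the first net point close to \<open>q x\<close>, which
      makes the pieces Borel and disjoint and lets membership depend on \<open>K\<close> and
      \<open>q x\<close> alone.\<close>
    define c where "c i = {x \<in> K. dist (q x) (z i) < \<epsilon> \<and> (\<forall>j\<in>{..<i}. \<epsilon> \<le> dist (q x) (z j))}" for i
    define c' where "c' i = (\<lambda>x. x + z i) ` c i" for i
    have zW: "z i \<in> W" if "i < n" for i
    proof -
      have "z i \<in> q ` K"
        using Z(2) that unfolding z by auto
      then show ?thesis
        using q(2) by auto
    qed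
    have c_borel: "c i \<in> sets borel" for i
    proof -
      have "c i = K \<inter> {x. dist (q x) (z i) < \<epsilon>} \<inter> (\<Inter>j\<in>{..<i}. {x. \<epsilon> \<le> dist (q x) (z j)})"
        by (auto simp: c_def)
      also have "\<dots> \<in> sets borel"
      proof (intro sets.Int)
        show "K \<in> sets borel"
          using K(1) by (simp add: compact_imp_closed)
        show "{x. dist (q x) (z i) < \<epsilon>} \<in> sets borel"
          by (intro borel_open open_Collect_less continuous_intros q(1))
        have "closed (\<Inter>j\<in>{..<i}. {x. \<epsilon> \<le> dist (q x) (z j)})"
          by (intro closed_INT ballI closed_Collect_le continuous_intros q(1))
        then show "(\<Inter>j\<in>{..<i}. {x. \<epsilon> \<le> dist (q x) (z j)}) \<in> sets borel"
          by (rule borel_closed)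
      qed
      finally show ?thesis .
    qed
    have c'_borel: "c' i \<in> sets borel" for i
    proof -
      have "c' i = (\<lambda>x. x - z i) -` c i"
        by (auto simp: c'_def image_iff) (metis diff_add_cancel)
      also have "\<dots> \<in> sets borel"
        by (rule measurable_sets_borel[OF _ c_borel]) measurable
      finally show ?thesis .
    qed
    have c_disj: "i = j" if "x \<in> c i" "y \<in> c j" "q x = q y" for i j x y
    proof (rule ccontr)
      assume "i \<noteq> j"
      then consider "i < j" | "j < i" by linarith
      then show False
        using that by cases (force simp: c_def)+
    qed
    have c'_disj: "disjoint_family_on c' {..<n}"
      unfolding disjoint_family_on_def
    proof (intro ballI impI)
      fix i j assume ij: "i \<in> {..<n}" "j \<in> {..<n}" "i \<noteq> j"
      show "c' i \<inter> c' j = {}"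
      proof (rule ccontr)
        assume "c' i \<inter> c' j \<noteq> {}"
        then obtain x y where xy: "x \<in> c i" "y \<in> c j" "x + z i = y + z j"
          by (auto simp: c'_def)
        \<comment> \<open>If translates overlap, the two points differ by an element of
          \<open>W\<close>; then \<open>q\<close> agrees at them and both lie in the same
          piece.\<close>
        have "x = y + (z j - z i)"
          using xy(3) by (simp add: algebra_simps)
        moreover have "z j - z i \<in> W"
          using ij zW by (auto intro: subspace_diff[OF W(2)])
        ultimately have "q x = q y"
          using q(3) by simp
        then show False
          using c_disj[OF xy(1,2)] ij(3) by simp
      qed
    qed
    have K_eq: "K = (\<Union>i\<in>{..<n}. c i)"
    proof (intro equalityI subsetI)
      fix x assume x: "x \<in> K"
      then have "\<exists>i. i < n \<and> dist (q x) (z i) < \<epsilon>"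
        using Z(3) z by (force simp: dist_commute)
      then have "\<exists>i. i < n \<and> dist (q x) (z i) < \<epsilon> \<and> (\<forall>j<i. \<not> (j < n \<and> dist (q x) (z j) < \<epsilon>))"
        using exists_least_iff[of "\<lambda>i. i < n \<and> dist (q x) (z i) < \<epsilon>"] by auto
      then obtain i where i: "i < n" "dist (q x) (z i) < \<epsilon>" "\<And>j. j < i \<Longrightarrow> \<not> (j < n \<and> dist (q x) (z j) < \<epsilon>)"
        by blast
      then have "x \<in> c i"
        using x by (force simp: c_def)
      then show "x \<in> (\<Union>i\<in>{..<n}. c i)"
        using i(1) by blast
    qed (auto simp: c_def)
    have "hausdorff_unnormalized k K = emeasure (hausdorff_borel k) (\<Union>i\<in>{..<n}. c i)"
      using K(1) K_eq by (simp add: emeasure_hausdorff_borel compact_imp_closed)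
    also have "\<dots> \<le> (\<Sum>i<n. emeasure (hausdorff_borel k) (c i))"
      using c_borel by (intro emeasure_subadditive_finite) auto
    also have "\<dots> \<le> (\<Sum>i<n. emeasure (hausdorff_borel k) (c' i))"
    proof (rule sum_mono)
      fix i
      have "c i = (\<lambda>x. x - z i) ` c' i"
        by (simp add: c'_def image_image)
      then have "hausdorff_unnormalized k (c i) \<le> ennreal 1 ^ k * hausdorff_unnormalized k (c' i)"
        using hausdorff_unnormalized_image_le[of "c' i" "\<lambda>x. x - z i" 1 k] by (simp add: dist_norm)
      then show "emeasure (hausdorff_borel k) (c i) \<le> emeasure (hausdorff_borel k) (c' i)"
        using c_borel c'_borel by (simp add: emeasure_hausdorff_borel)
    qed
    also have "\<dots> = emeasure (hausdorff_borel k) (\<Union>i\<in>{..<n}. c' i)"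
      using c'_borel c'_disj by (intro sum_emeasure) auto
    also have "\<dots> \<le> emeasure (hausdorff_borel k) (N m)"
    proof (rule emeasure_mono)
      show "(\<Union>i\<in>{..<n}. c' i) \<subseteq> N m"
      proof safe
        fix i y assume i: "i < n" and "y \<in> c' i"
        then obtain x where x: "x \<in> c i" "y = x + z i"
          by (auto simp: c'_def)
        then have "x \<in> K" "dist (q x) (z i) < \<epsilon>"
          by (auto simp: c_def)
        then have "x + q x \<in> T" "dist y (x + q x) \<le> \<epsilon>"
          using x(2) by (auto simp: T_def dist_commute)
        then have "infdist y T \<le> \<epsilon>"
          by (rule infdist_le2)
        moreover have "y \<in> V"
          using x(2) \<open>x \<in> K\<close> K(2) zW[OF i] W(1) V(1) by (auto intro: subspace_add)
        ultimately show "y \<in> N m"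
          by (simp add: N_def \<epsilon>_def)
      qed
    qed (use N_borel in auto)
    also have "\<dots> = hausdorff_unnormalized k (N m)"
      by (rule emeasure_hausdorff_borel[OF N_borel])
    finally show ?thesis .
  qed
  \<comment> \<open>Continuity from above needs a set of finite measure to start with.\<close>
  have N0: "emeasure (hausdorff_borel k) (N 0) \<noteq> \<infinity>"
  proof -
    obtain R where R: "\<And>t. t \<in> T \<Longrightarrow> norm t \<le> R"
      using compact_imp_bounded[OF T(1)] by (auto simp: bounded_iff)
    have "norm x \<le> R + 1" if x: "x \<in> N 0" for x
    proof -
      obtain t where t: "t \<in> T" "infdist x T = dist x t"
        using infdist_attains_inf[OF compact_imp_closed[OF T(1)] T(3), of x] by auto
      have "norm x \<le> norm t + dist x t"
        using norm_triangle_sub[of x t] by (simp add: dist_norm)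
      then show ?thesis
        using R[OF t(1)] t(2) x by (simp add: N_def)
    qed
    then have "bounded (N 0)"
      by (auto simp: bounded_iff)
    then have "hausdorff_unnormalized k (N 0) < \<infinity>"
      by (rule hausdorff_bounded_finite[OF V]) (auto simp: N_def)
    then show ?thesis
      by (simp add: emeasure_hausdorff_borel[OF N_borel])
  qed
  have "(\<Inter>m. N m) = T"
  proof (intro equalityI subsetI)
    fix x assume x: "x \<in> (\<Inter>m. N m)"
    have "infdist x T \<le> 0"
    proof (rule ccontr)
      assume "\<not> infdist x T \<le> 0"
      then obtain m where "1 / real (Suc m) < infdist x T"
        using nat_approx_posE[of "infdist x T"] by auto
      moreover have "x \<in> N m"
        using x by blast
      ultimately show False
        by (simp add: N_def)
    qed
    then have "infdist x T = 0"
      using infdist_nonneg[of x T] by linarith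
    then show "x \<in> T"
      using in_closed_iff_infdist_zero[OF compact_imp_closed[OF T(1)] T(3)] by blast
  next
    fix x assume "x \<in> T"
    then show "x \<in> (\<Inter>m. N m)"
      using T(2) by (auto simp: N_def)
  qed
  moreover have "decseq N"
  proof (rule decseq_SucI)
    fix m
    have "1 / real (Suc (Suc m)) \<le> 1 / real (Suc m)"
      by (intro divide_left_mono) auto
    then show "N (Suc m) \<subseteq> N m"
      by (auto simp: N_def)
  qed
  moreover have "(INF m. emeasure (hausdorff_borel k) (N m)) = emeasure (hausdorff_borel k) (\<Inter>m. N m)"
    using \<open>decseq N\<close> N_borel N0 by (intro INF_emeasure_decseq') auto
  ultimately have "hausdorff_unnormalized k T = (INF m. emeasure (hausdorff_borel k) (N m))"
    using T(1) by (simp add: emeasure_hausdorff_borel compact_imp_closed)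
  also have "\<dots> \<ge> hausdorff_unnormalized k K"
    using le by (intro INF_greatest) (simp add: emeasure_hausdorff_borel[OF N_borel])
  finally show ?thesis
    by (simp add: T_def)
qed (simp add: hausdorff_unnormalized_def)

text \<open>That \<open>R\<close> does not increase norms is what later keeps projected layers
  inside the multiradial ball.\<close>

lemma orthogonal_projection_exists:
  fixes W :: "'a::euclidean_space set"
  assumes "subspace W"
  obtains R where "linear R" "\<And>x. R x \<in> W" "\<And>w. w \<in> W \<Longrightarrow> R w = w" "\<And>x. norm (R x) \<le> norm x"
proof -
  obtain B where B: "B \<subseteq> W" "pairwise orthogonal B" "\<And>x. x \<in> B \<Longrightarrow> norm x = 1"
      "independent B" "span B = W"
    using orthonormal_basis_subspace[OF assms] by metis
  have fB: "finite B"
    using B(4) by (rule independent_imp_finite)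
  define R where "R x = (\<Sum>b\<in>B. (x \<bullet> b) *\<^sub>R b)" for x
  have lin: "linear R"
    unfolding R_def
    by (intro linearI) (simp_all add: inner_add_left scaleR_add_left sum.distrib scaleR_sum_right)
  have Rb: "R x \<bullet> b = x \<bullet> b" if b: "b \<in> B" for x b
  proof -
    have "R x \<bullet> b = (\<Sum>c\<in>B. if c = b then x \<bullet> b else 0)"
      unfolding R_def inner_sum_left
    proof (intro sum.cong refl)
      fix c assume c: "c \<in> B"
      show "(x \<bullet> c) *\<^sub>R c \<bullet> b = (if c = b then x \<bullet> b else 0)"
        using B(2,3) b c by (auto simp: pairwise_def orthogonal_def norm_eq_1)
    qed
    then show ?thesis
      using fB b by simp
  qed
  have R_in: "R x \<in> W" for x
    unfolding R_def using B(1) by (auto intro!: subspace_sum[OF assms] subspace_scale[OF assms])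
  moreover have "R w = w" if "w \<in> W" for w
  proof -
    have "(R w - w) \<bullet> v = 0" if "v \<in> span B" for v
      using that
    proof (induction rule: span_induct)
      case base
      then show ?case
        by (auto simp: subspace_def inner_add_right)
    next
      case (step b)
      then show ?case
        by (simp add: inner_diff_left Rb)
    qed
    moreover have "R w - w \<in> span B"
      using R_in[of w] that B(5) subspace_diff[OF assms] by simp
    ultimately have "(R w - w) \<bullet> (R w - w) = 0"
      by blast
    then show ?thesis by simp
  qed
  moreover have "norm (R x) \<le> norm x" for x
  proof -
    have "R x \<bullet> R x = x \<bullet> R x"
      unfolding R_def[of x] inner_sum_right by (intro sum.cong refl) (simp add: Rb flip: R_def)
    then have "norm (R x) * norm (R x) \<le> norm x * norm (R x)"
      using norm_cauchy_schwarz[of x "R x"] by (simp add: power2_norm_eq_inner[symmetric] power2_eq_square)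
    then show ?thesis
      by (cases "R x = 0") auto
  qed
  ultimately show ?thesis
    using that[of R] lin by blast
qed

section \<open>Spherical factors of multiradial distances\<close>

context multiradial_group
begin

text \<open>Monotonicity is given for one variable at a time, so the coordinates are raised
  successively.\<close>

lemma \<phi>_mono_le:
  assumes "t \<in> orthant (step G)" "s \<in> orthant (step G)" "\<And>i. t i \<le> s i"
  shows "\<phi> t \<le> \<phi> s"
proof -
  have mix: "(\<lambda>i. if i \<in> J then s i else t i) \<in> orthant (step G)" for J
    using assms by (auto simp: orthant_def)
  have "\<phi> t \<le> \<phi> (\<lambda>i. if i \<in> J then s i else t i)" if "finite J" "J \<subseteq> {1..step G}" for J
    using that
  proof (induction J rule: finite_induct)
    case (insert j J)
    let ?u = "\<lambda>i. if i \<in> J then s i else t i"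
    have "?u(j := s j) = (\<lambda>i. if i \<in> insert j J then s i else t i)"
      by auto
    moreover have "\<phi> ?u \<le> \<phi> (?u(j := s j))"
      using insert assms(3) by (intro \<phi>_mono mix) auto
    ultimately show ?case
      using insert by (auto intro: order_trans)
  qed simp
  from this[of "{1..step G}"] have "\<phi> t \<le> \<phi> (\<lambda>i. if i \<in> {1..step G} then s i else t i)"
    by simp
  also have "(\<lambda>i. if i \<in> {1..step G} then s i else t i) = s"
    using assms(1,2) by (auto simp: orthant_def)
  finally show ?thesis .
qed

lemma mem_unit_ball_mono:
  assumes "y \<in> mcball 0 1" "\<And>i. i \<in> {1..step G} \<Longrightarrow> norm (P i x) \<le> norm (P i y)"
  shows "x \<in> mcball 0 1"
proof -
  have "\<phi> (radii x) \<le> \<phi> (radii y)"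
    using assms(2) by (intro \<phi>_mono_le radii_orthant) (auto simp: radii_def)
  then show ?thesis
    using assms(1) unfolding mem_unit_ball by linarith
qed

text \<open>The layers \<open>W i\<close> are extended by the zero space outside the index range, so
  that projections onto them can be chosen for all \<open>i\<close>.\<close>

lemma homogeneous_familyE:
  assumes "V \<in> homogeneous_family G ns"
  obtains W where "\<And>i. subspace (W i)" "\<And>i. W i \<subseteq> layer G i" "\<And>i. i \<in> {1..step G} \<Longrightarrow> dim (W i) = ns i"
    "V = {x. \<forall>i\<in>{1..step G}. P i x \<in> W i}" "subspace V"
proof -
  obtain W0 where W0: "\<forall>i\<in>{1..step G}. subspace (W0 i) \<and> W0 i \<subseteq> layer G i \<and> dim (W0 i) = ns i"
      "V = span (\<Union>i\<in>{1..step G}. W0 i)"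
    using assms unfolding homogeneous_family_def by blast
  define W where "W i = (if i \<in> {1..step G} then W0 i else {0})" for i
  have sub: "subspace (W i)" "W i \<subseteq> layer G i" for i
    using W0(1) by (auto simp: W_def subspace_0[OF subspace_layer])
  have U: "(\<Union>i\<in>{1..step G}. W0 i) = (\<Union>i\<in>{1..step G}. W i)"
    by (auto simp: W_def)
  have "V = {x. \<forall>i\<in>{1..step G}. P i x \<in> W i}"
  proof (intro equalityI subsetI CollectI ballI)
    fix x i assume "x \<in> V" "i \<in> {1..step G}"
    then have "x \<in> span (\<Union>i\<in>{1..step G}. W i)"
      using W0(2) U by simp
    then show "P i x \<in> W i"
    proof (induction rule: span_induct)
      case base
      then show ?case
        using sub(1) by (auto simp: subspace_def)
    next
      case (step x)
      then obtain j where "j \<in> {1..step G}" "x \<in> W j"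
        by blast
      moreover have "x \<in> layer G j"
        using sub(2) \<open>x \<in> W j\<close> by blast
      ultimately show ?case
        by (auto simp: layer_proj_layer subspace_0 sub(1))
    qed
  next
    fix x assume x: "x \<in> {x. \<forall>i\<in>{1..step G}. P i x \<in> W i}"
    have "(\<Sum>i=1..step G. P i x) \<in> span (\<Union>i\<in>{1..step G}. W i)"
      using x by (intro span_sum span_base) blast
    then show "x \<in> V"
      unfolding sum_layer_proj W0(2) U .
  qed
  moreover have "dim (W i) = ns i" if "i \<in> {1..step G}" for i
    using that W0(1) by (auto simp: W_def)
  moreover have "subspace V"
    unfolding W0(2) by (rule subspace_span)
  ultimately show ?thesis
    using that[of W] sub by blast
qed

text \<open>The shear in layer \<open>i\<close> adds the projection to \<open>W i\<close> of the
  difference between layer \<open>i\<close> of the translated point and of \<open>x\<close>. As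
  layer \<open>i\<close> of \<open>x\<close> already lies in \<open>W i\<close>, the result is the
  projection of layer \<open>i\<close> of the translated point, so no layer norm exceeds the one
  found in the unit ball.\<close>

lemma hausdorff_section_le:
  assumes V: "V \<in> homogeneous_family G ns"
  shows "hausdorff_unnormalized (dim V) (V \<inter> mcball z 1) \<le> hausdorff_unnormalized (dim V) (V \<inter> mcball 0 1)"
proof -
  obtain W where W: "\<And>i. subspace (W i)" "\<And>i. W i \<subseteq> layer G i"
      "V = {x. \<forall>i\<in>{1..step G}. P i x \<in> W i}" "subspace V"
  proof (rule homogeneous_familyE[OF V])
    fix W assume "\<And>i. subspace (W i)" "\<And>i. W i \<subseteq> layer G i"
      "V = {x. \<forall>i\<in>{1..step G}. P i x \<in> W i}" "subspace V"
    then show thesis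
      by (rule that)
  qed
  have "\<forall>i. \<exists>R. linear R \<and> (\<forall>x. R x \<in> W i) \<and> (\<forall>w\<in>W i. R w = w) \<and> (\<forall>x. norm (R x) \<le> norm x)"
    using orthogonal_projection_exists[OF W(1)] by metis
  then obtain R where R: "\<And>i. linear (R i)" "\<And>i x. R i x \<in> W i"
      "\<And>i w. w \<in> W i \<Longrightarrow> R i w = w" "\<And>i x. norm (R i x) \<le> norm x"
    by metis
  define q where "q i x = R i (P i (mult G (- z) x) - P i x)" for i x
  \<comment> \<open>The shears act from the top layer downwards, so that each one still sees the original lower
    layers.\<close>
  define Y where "Y j x = x + (\<Sum>i\<in>{step G - j<..step G}. q i x)" for j x
  define K where "K = V \<inter> mcball z 1"
  have P_W: "P l w = (if i = l then w else 0)" if "w \<in> W i" for i l w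
    using that W(2)[of i] by (intro layer_proj_layer) blast
  have W_V: "W i \<subseteq> V" if "i \<in> {1..step G}" for i
    unfolding W(3) by (auto simp: P_W subspace_0[OF W(1)])
  have q_W: "q i x \<in> W i" for i x
    by (simp add: q_def R)
  have q_agree: "q i x = q i y" if "agree_below i x y" for i x y
    using layer_proj_mult[OF that, of "- z"] by (simp add: q_def)
  have q_cont: "continuous_on A (q i)" for A i
    unfolding q_def
    by (intro continuous_on_compose2[OF linear_continuous_on[of "R i" UNIV]] continuous_intros continuous_on_mult)
      (auto simp: R linear_linear)
  have P_Y: "P i (Y j x) = P i x + (if i \<in> {step G - j<..step G} then q i x else 0)" for i j x
  proof -
    have "P i (Y j x) = P i x + (\<Sum>l\<in>{step G - j<..step G}. P i (q l x))"
      by (simp add: Y_def)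
    also have "(\<Sum>l\<in>{step G - j<..step G}. P i (q l x)) = (\<Sum>l\<in>{step G - j<..step G}. if l = i then q i x else 0)"
      by (intro sum.cong) (auto simp: P_W[OF q_W])
    finally show ?thesis by simp
  qed
  have Y_V: "Y j x \<in> V" if "x \<in> V" for j x
    using that q_W W(1) unfolding W(3) by (auto simp: P_Y intro: subspace_add)
  have Y_cont: "continuous_on A (Y j)" for A j
    unfolding Y_def by (intro continuous_intros q_cont)
  have K: "compact K" "K \<subseteq> V"
    using compact_mcball closed_subspace[OF W(4)] by (auto simp: K_def intro: closed_Int_compact)
  have step: "hausdorff_unnormalized (dim V) (Y j ` K) \<le> hausdorff_unnormalized (dim V) (Y (Suc j) ` K)"
    if j: "j < step G" for j
  proof -
    \<comment> \<open>The layer treated next. The shears collected in \<open>Y j\<close> change only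
      layers above \<open>l\<close>, so \<open>q l\<close> takes the same value at
      \<open>Y j x\<close> as at \<open>x\<close>.\<close>
    define l where "l = step G - j"
    have l: "l \<in> {1..step G}" "{step G - Suc j<..step G} = insert l {step G - j<..step G}"
      "l \<notin> {step G - j<..step G}"
      using j by (auto simp: l_def)
    have "Y (Suc j) x = Y j x + q l (Y j x)" for x
    proof -
      have "agree_below l (Y j x) x"
        by (auto simp: agree_below_def P_Y l_def)
      then have "q l (Y j x) = q l x"
        by (rule q_agree)
      then show ?thesis
        using l by (simp add: Y_def algebra_simps)
    qed
    then have eq: "Y (Suc j) ` K = (\<lambda>x. x + q l x) ` (Y j ` K)"
      by (simp add: image_image)
    have q_inv: "q l (x + w) = q l x" if w: "w \<in> W l" for x w
    proof (rule q_agree)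
      show "agree_below l (x + w) x"
        by (auto simp: agree_below_def P_W[OF w])
    qed
    show ?thesis
      unfolding eq
    proof (rule hausdorff_shear_le[OF W(4) refl W_V[OF l(1)] W(1)])
      show "compact (Y j ` K)"
        by (rule compact_continuous_image[OF Y_cont K(1)])
      show "Y j ` K \<subseteq> V"
        using K(2) Y_V by blast
    qed (use q_cont q_W q_inv in auto)
  qed
  have mono: "hausdorff_unnormalized (dim V) K \<le> hausdorff_unnormalized (dim V) (Y j ` K)" if "j \<le> step G" for j
    using that
  proof (induction j)
    case 0
    have "Y 0 x = x" for x
      by (simp add: Y_def)
    then show ?case by simp
  next
    case (Suc j)
    then show ?case
      using step[of j] by (auto intro: order_trans)
  qed
  have "Y (step G) ` K \<subseteq> V \<inter> mcball 0 1"
  proof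
    fix y assume "y \<in> Y (step G) ` K"
    then obtain x where x: "x \<in> V" "x \<in> mcball z 1" "y = Y (step G) x"
      by (auto simp: K_def)
    have "mult G (- z) x \<in> mcball 0 1"
      using x(2) mem_mcball_iff[of 1 x z] by simp
    moreover have "norm (P i y) \<le> norm (P i (mult G (- z) x))" if i: "i \<in> {1..step G}" for i
    proof -
      \<comment> \<open>\<open>R i\<close> fixes the layer of \<open>x\<close>, so the two
        occurrences of \<open>P i x\<close> cancel.\<close>
      have "P i y = P i x + R i (P i (mult G (- z) x) - P i x)"
        using i unfolding x(3) P_Y by (simp add: q_def)
      also have "\<dots> = R i (P i (mult G (- z) x))"
        using x(1) i R(1,3) unfolding W(3) by (simp add: linear_diff)
      finally show ?thesis
        using R(4) by simp
    qed
    ultimately have "y \<in> mcball 0 1"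
      by (rule mem_unit_ball_mono)
    then show "y \<in> V \<inter> mcball 0 1"
      using Y_V x by simp
  qed
  then have "hausdorff_unnormalized (dim V) (Y (step G) ` K) \<le> hausdorff_unnormalized (dim V) (V \<inter> mcball 0 1)"
    by (rule hausdorff_unnormalized_mono)
  then show ?thesis
    using mono[of "step G"] by (simp add: K_def)
qed

text \<open>Layers of equal dimension are linearly isometric. The sum of such isometries preserves
  every layer norm, hence membership in the multiradial unit ball, and is an isometry on
  \<open>V\<close>. Exchanging the two subspaces turns the inequalities into equalities.\<close>

lemma hausdorff_section_isometric:
  assumes V: "V \<in> homogeneous_family G ns" and V': "V' \<in> homogeneous_family G ns"
  shows "dim V' \<le> dim V"
    and "hausdorff_unnormalized k (V' \<inter> mcball 0 1) \<le> hausdorff_unnormalized k (V \<inter> mcball 0 1)"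
proof -
  obtain W where W: "\<And>i. subspace (W i)" "\<And>i. W i \<subseteq> layer G i" "\<And>i. i \<in> {1..step G} \<Longrightarrow> dim (W i) = ns i"
      "V = {x. \<forall>i\<in>{1..step G}. P i x \<in> W i}" "subspace V"
    by (rule homogeneous_familyE[OF V], rule that)
  obtain W' where W': "\<And>i. subspace (W' i)" "\<And>i. W' i \<subseteq> layer G i" "\<And>i. i \<in> {1..step G} \<Longrightarrow> dim (W' i) = ns i"
      "V' = {x. \<forall>i\<in>{1..step G}. P i x \<in> W' i}" "subspace V'"
    by (rule homogeneous_familyE[OF V'], rule that)
  have "\<exists>f. linear f \<and> f ` W i = W' i \<and> (\<forall>x\<in>W i. norm (f x) = norm x)" if "i \<in> {1..step G}" for i
    using isometries_subspaces[OF W(1) W'(1), of i i] W(3)[OF that] W'(3)[OF that] by metis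
  then obtain f where f: "\<And>i. i \<in> {1..step G} \<Longrightarrow> linear (f i)"
      "\<And>i. i \<in> {1..step G} \<Longrightarrow> f i ` W i = W' i"
      "\<And>i x. i \<in> {1..step G} \<Longrightarrow> x \<in> W i \<Longrightarrow> norm (f i x) = norm x"
    by metis
  define T where "T x = (\<Sum>i=1..step G. f i (P i x))" for x
  have linT: "linear T"
    unfolding T_def using f(1)
    by (intro linearI) (auto simp: linear_add linear_scale sum.distrib scaleR_sum_right intro!: sum.cong)
  have PT: "P i (T x) = f i (P i x)" if x: "x \<in> V" and i: "i \<in> {1..step G}" for i x
  proof -
    have "P i (T x) = (\<Sum>j=1..step G. P i (f j (P j x)))"
      by (simp add: T_def)
    also have "\<dots> = (\<Sum>j=1..step G. if j = i then f i (P i x) else 0)"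
    proof (intro sum.cong refl)
      fix j assume j: "j \<in> {1..step G}"
      have "f j (P j x) \<in> layer G j"
        using x j f(2)[OF j] W'(2)[of j] unfolding W(4) by blast
      then show "P i (f j (P j x)) = (if j = i then f i (P i x) else 0)"
        by (simp add: layer_proj_layer)
    qed
    finally show ?thesis
      using i by simp
  qed
  have T_norm: "norm (P i (T x)) = norm (P i x)" if x: "x \<in> V" and i: "i \<in> {1..step G}" for i x
    using PT[OF x i] f(3)[OF i] x i unfolding W(4) by auto
  have T_ex: "\<exists>x\<in>V. y = T x" if y: "y \<in> V'" for y
  proof -
    have "\<forall>i\<in>{1..step G}. \<exists>w\<in>W i. P i y = f i w"
      using y f(2) unfolding W'(4) by blast
    then obtain w where w: "\<And>i. i \<in> {1..step G} \<Longrightarrow> w i \<in> W i \<and> P i y = f i (w i)"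
      by metis
    define w' where "w' i = (if i \<in> {1..step G} then w i else 0)" for i
    define x where "x = (\<Sum>i=1..step G. w' i)"
    have "w' i \<in> layer G i" for i
      using w[of i] W(2)[of i] subspace_0[OF subspace_layer[of i]] by (auto simp: w'_def)
    then have Px: "P i x = w' i" for i
      unfolding x_def by (rule layer_projI)
    then have "x \<in> V"
      using w unfolding W(4) by (auto simp: w'_def)
    moreover have "y = T x"
    proof (rule layer_eqI)
      fix i assume i: "i \<in> {1..step G}"
      show "P i y = P i (T x)"
        using w[OF i] i unfolding PT[OF \<open>x \<in> V\<close> i] Px by (simp add: w'_def)
    qed
    ultimately show ?thesis by blast
  qed
  have "dim V' \<le> dim (T ` V)"
    using T_ex by (intro dim_subset) blast
  also have "\<dots> \<le> dim V"
    by (rule dim_image_le[OF linT])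
  finally show "dim V' \<le> dim V" .
  have "V' \<inter> mcball 0 1 \<subseteq> T ` (V \<inter> mcball 0 1)"
  proof
    fix y assume y: "y \<in> V' \<inter> mcball 0 1"
    then obtain x where x: "x \<in> V" "y = T x"
      using T_ex by blast
    have "x \<in> mcball 0 1"
      using y T_norm[OF x(1)] x(2) by (intro mem_unit_ball_mono[of y x]) auto
    then show "y \<in> T ` (V \<inter> mcball 0 1)"
      using x by blast
  qed
  then have "hausdorff_unnormalized k (V' \<inter> mcball 0 1) \<le> hausdorff_unnormalized k (T ` (V \<inter> mcball 0 1))"
    by (rule hausdorff_unnormalized_mono)
  also have "\<dots> \<le> ennreal 1 ^ k * hausdorff_unnormalized k (V \<inter> mcball 0 1)"
  proof (rule hausdorff_unnormalized_image_le)
    fix x y assume "x \<in> V \<inter> mcball 0 1" "y \<in> V \<inter> mcball 0 1"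
    then have "x - y \<in> V"
      using subspace_diff[OF W(5)] by blast
    then have "norm (T (x - y)) = norm (x - y)"
      using T_norm unfolding norm_eq_L2_set[of "T (x - y)"] norm_eq_L2_set[of "x - y"] by (intro L2_set_cong) auto
    then show "dist (T x) (T y) \<le> 1 * dist x y"
      by (simp add: dist_norm linear_diff[OF linT])
  qed simp
  finally show "hausdorff_unnormalized k (V' \<inter> mcball 0 1) \<le> hausdorff_unnormalized k (V \<inter> mcball 0 1)"
    by simp
qed

lemma spherical_factor_eq:
  assumes V: "V \<in> homogeneous_family G ns"
  shows "spherical_factor d V = hausdorff_measure (dim V) (V \<inter> mcball 0 1)"
proof (rule antisym)
  show "spherical_factor d V \<le> hausdorff_measure (dim V) (V \<inter> mcball 0 1)"
    unfolding spherical_factor_def hausdorff_measure_def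
    by (intro SUP_least divide_right_mono_ennreal hausdorff_section_le[OF V])
  show "hausdorff_measure (dim V) (V \<inter> mcball 0 1) \<le> spherical_factor d V"
    unfolding spherical_factor_def by (rule SUP_upper) simp
qed

lemma spherical_factor_constant:
  assumes V: "V \<in> homogeneous_family G ns" and V': "V' \<in> homogeneous_family G ns"
  shows "spherical_factor d V = spherical_factor d V'"
proof -
  have "dim V = dim V'"
    using hausdorff_section_isometric(1)[OF V V'] hausdorff_section_isometric(1)[OF V' V] by simp
  moreover have "hausdorff_unnormalized k (V \<inter> mcball 0 1) = hausdorff_unnormalized k (V' \<inter> mcball 0 1)" for k
    using hausdorff_section_isometric(2)[OF V V'] hausdorff_section_isometric(2)[OF V' V] by (intro antisym)
  ultimately show ?thesis
    by (simp add: spherical_factor_eq[OF V] spherical_factor_eq[OF V'] hausdorff_measure_def)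
qed

text \<open>The member \<open>V\<close> makes the definite description determinate: on an empty
  family every value would satisfy it.\<close>

lemma spherical_constant_eq:
  assumes V: "V \<in> homogeneous_family G ns"
  shows "spherical_constant G d ns = spherical_factor d V"
  unfolding spherical_constant_def
proof (rule the_equality)
  show "\<forall>V'\<in>homogeneous_family G ns. spherical_factor d V' = spherical_factor d V"
    by (intro ballI spherical_factor_constant[OF _ V])
qed (use V in simp)

text \<open>The section at the unit is a bounded neighbourhood of zero in \<open>V\<close>, and the
  normalizing cube has positive finite measure.\<close>

lemma spherical_factor_pos_finite:
  assumes V: "V \<in> homogeneous_family G ns"
  obtains c where "0 < c" "spherical_factor d V = ennreal c"
proof -
  have sub: "subspace V"
    using V by (simp add: homogeneous_family_def homogeneous_subspace_def)
  let ?h = "hausdorff_unnormalized (dim V) (V \<inter> mcball 0 1)"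
  have h: "0 < ?h" "?h < \<infinity>"
    using hausdorff_neighbourhood_pos[OF sub refl interior_mcball[of 1 0]]
      hausdorff_bounded_finite[OF sub refl, of "V \<inter> mcball 0 1"] compact_imp_bounded[OF compact_mcball[of 0 1]]
    by (auto intro: bounded_subset)
  have "dim V \<le> DIM('a)"
    by (rule dim_subset_UNIV)
  then obtain E where E: "E \<subseteq> (Basis :: 'a set)" "card E = dim V" "(unit_cube (dim V) :: 'a set) = cube E"
    by (rule unit_cubeE)
  have u: "0 < hausdorff_unnormalized (dim V) (cube E)" "hausdorff_unnormalized (dim V) (cube E) < \<infinity>"
    using hausdorff_cube_pos[OF E(1,2)] hausdorff_cube_finite[OF E(1,2)] by auto
  have "0 < spherical_factor d V" "spherical_factor d V < \<infinity>"
    unfolding spherical_factor_eq[OF V] hausdorff_measure_def E(3) using h u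
    by (auto simp: ennreal_zero_less_divide ennreal_divide_eq_top_iff less_top[symmetric])
  then show ?thesis
    using that[of "enn2real (spherical_factor d V)"] by (simp add: enn2real_positive_iff)
qed

end

section \<open>Multivectors in a frame\<close>

text \<open>If the enumerations agree before \<open>i\<close>, then \<open>J i\<close> is some
  \<open>I m\<close> with \<open>m\<close> not below \<open>i\<close>, so
  \<open>I i \<le> J i\<close>; symmetry gives equality.\<close>

lemma strict_mono_range_eq_imp_eq:
  fixes I J :: "'n::{finite,wellorder} \<Rightarrow> nat"
  assumes "strict_mono I" "strict_mono J" "range I = range J"
  shows "I = J"
proof
  fix i
  have le: "I i \<le> J i"
    if IJ: "strict_mono I" "strict_mono J" "range I = range J" "\<And>k. k < i \<Longrightarrow> I k = J k"
    for I J :: "'n \<Rightarrow> nat" and i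
  proof -
    obtain m where m: "J i = I m"
      using IJ(3) by (metis rangeE rangeI)
    have "\<not> m < i"
      using IJ(4)[of m] m strict_monoD[OF IJ(2), of m i] by auto
    then show ?thesis
      using m IJ(1) by (simp add: strict_mono_less_eq)
  qed
  show "I i = J i"
  proof (induction i rule: less_induct)
    case (less i)
    then show ?case
      using le[OF assms] le[OF assms(2,1) assms(3)[symmetric]] by (metis antisym)
  qed
qed

text \<open>The index type is an abstract finite well-order; the rank \<open>r\<close> turns its
  elements into positions in the sorted list.\<close>

lemma strict_mono_enumeration:
  fixes S :: "nat set"
  assumes "finite S" "card S = CARD('n::{finite,wellorder})"
  obtains h :: "'n::{finite,wellorder} \<Rightarrow> nat" where "strict_mono h" "range h = S"
proof -
  define r where "r i = card {k. k < i}" for i :: 'n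
  define h where "h i = sorted_list_of_set S ! r i" for i
  have r_mono: "r i < r j" if "i < j" for i j
    unfolding r_def using that by (intro psubset_card_mono) (auto intro: less_trans)
  have r_bound: "r i < CARD('n)" for i
    unfolding r_def by (intro psubset_card_mono) auto
  have len: "length (sorted_list_of_set S) = CARD('n)"
    using assms by simp
  have mono: "strict_mono h"
  proof (rule strict_monoI)
    fix i j :: 'n assume "i < j"
    then show "h i < h j"
      unfolding h_def using r_mono r_bound[of j] len
      by (intro sorted_wrt_nth_less[OF strict_sorted_list_of_set]) auto
  qed
  have sub: "range h \<subseteq> S"
  proof
    fix y assume "y \<in> range h"
    then obtain i where "y = sorted_list_of_set S ! r i"
      by (auto simp: h_def)
    then have "y \<in> set (sorted_list_of_set S)"
      using nth_mem[of "r i" "sorted_list_of_set S"] r_bound[of i] len by simp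
    then show "y \<in> S"
      using assms(1) by simp
  qed
  have "card (range h) = CARD('n)"
    using strict_mono_imp_inj_on[OF mono] by (simp add: card_image)
  then have "range h = S"
    using card_subset_eq[OF assms(1) sub] assms(2) by simp
  then show ?thesis
    using that mono by blast
qed

text \<open>The sign rule is a clause of its own because determinants satisfy it directly and
  sorting of arguments uses it in this form.\<close>

definition alternating_form :: "('a::euclidean_space ^ 'n \<Rightarrow> real) \<Rightarrow> bool" where
  "alternating_form F \<longleftrightarrow>
     (\<forall>w z. linear (\<lambda>u. F (\<chi> i. if i = z then u else w $ i))) \<and>
     (\<forall>w i j. i \<noteq> j \<longrightarrow> w $ i = w $ j \<longrightarrow> F w = 0) \<and>
     (\<forall>w p. p permutes UNIV \<longrightarrow> F (\<chi> i. w $ p i) = of_int (sign p) * F w)"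

text \<open>Moves the arguments of the form from columns to rows, where the determinant rules
  apply.\<close>

lemma wedge_transpose: "wedge v w = det (\<chi> j i. v $ i \<bullet> w $ j)"
proof -
  have "transpose (\<chi> i j. v $ i \<bullet> w $ j) = (\<chi> j i. v $ i \<bullet> w $ j)"
    by (simp add: transpose_def vec_eq_iff)
  then show ?thesis
    unfolding wedge_def using det_transpose by metis
qed

lemma alternating_form_wedge: "alternating_form (wedge v)"
  unfolding alternating_form_def
proof (intro conjI allI impI)
  fix w :: "'a ^ 'b" and z
  have row: "(\<chi> j. \<chi> i. v $ i \<bullet> (\<chi> i. if i = z then u else w $ i) $ j) =
      (\<chi> j. if j = z then (\<chi> i. v $ i \<bullet> u) else (\<chi> i. v $ i \<bullet> w $ j))" for u
    by (simp add: vec_eq_iff)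
  show "linear (\<lambda>u. wedge v (\<chi> i. if i = z then u else w $ i))"
  proof (rule linearI)
    fix x y :: 'a and c :: real
    have "(\<chi> i. v $ i \<bullet> (x + y)) = (\<chi> i. v $ i \<bullet> x) + (\<chi> i. v $ i \<bullet> y)"
      by (simp add: vec_eq_iff inner_add_right)
    then show "wedge v (\<chi> i. if i = z then x + y else w $ i) =
        wedge v (\<chi> i. if i = z then x else w $ i) + wedge v (\<chi> i. if i = z then y else w $ i)"
      unfolding wedge_transpose row
      using det_row_add[of z "\<lambda>_. \<chi> i. v $ i \<bullet> x" "\<lambda>_. \<chi> i. v $ i \<bullet> y" "\<lambda>j. \<chi> i. v $ i \<bullet> w $ j"]
      by (simp cong: if_cong)
    have "(\<chi> i. v $ i \<bullet> (c *\<^sub>R x)) = c *s (\<chi> i. v $ i \<bullet> x)"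
      by (simp add: vec_eq_iff)
    then show "wedge v (\<chi> i. if i = z then c *\<^sub>R x else w $ i) =
        c *\<^sub>R wedge v (\<chi> i. if i = z then x else w $ i)"
      unfolding wedge_transpose row
      using det_row_mul[of z c "\<lambda>_. \<chi> i. v $ i \<bullet> x" "\<lambda>j. \<chi> i. v $ i \<bullet> w $ j"]
      by (simp cong: if_cong)
  qed
next
  fix w :: "'a ^ 'b" and i j :: 'b
  assume "i \<noteq> j" "w $ i = w $ j"
  then show "wedge v w = 0"
    unfolding wedge_transpose by (intro det_identical_rows[of i j]) (auto simp: row_def)
next
  fix w :: "'a ^ 'b" and p :: "'b \<Rightarrow> 'b"
  assume p: "p permutes UNIV"
  show "wedge v (\<chi> i. w $ p i) = of_int (sign p) * wedge v w"
    unfolding wedge_transpose using det_permute_rows[OF p, of "\<chi> j i. v $ i \<bullet> w $ j"] by simp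
qed

lemma alternating_form_sum:
  fixes F :: "'i \<Rightarrow> 'a::euclidean_space ^ 'n::finite \<Rightarrow> real"
  assumes "\<And>I. I \<in> A \<Longrightarrow> alternating_form (F I)"
  shows "alternating_form (\<lambda>w. \<Sum>I\<in>A. c I * F I w)"
  unfolding alternating_form_def
proof (intro conjI allI impI)
  fix w :: "'a ^ 'n" and z
  show "linear (\<lambda>u. \<Sum>I\<in>A. c I * F I (\<chi> i. if i = z then u else w $ i))"
  proof (rule linear_compose_sum, rule ballI)
    fix I assume "I \<in> A"
    then have "linear (\<lambda>u. F I (\<chi> i. if i = z then u else w $ i))"
      using assms by (auto simp: alternating_form_def)
    then show "linear (\<lambda>u. c I * F I (\<chi> i. if i = z then u else w $ i))"
      using linear_cmul[of "\<lambda>u. F I (\<chi> i. if i = z then u else w $ i)" "c I"]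
      by (simp add: linear_iff algebra_simps)
  qed
next
  fix w :: "'a ^ 'n" and i j assume "i \<noteq> j" "w $ i = w $ j"
  then have "F I w = 0" if "I \<in> A" for I
    using assms[OF that] by (auto simp: alternating_form_def)
  then show "(\<Sum>I\<in>A. c I * F I w) = 0"
    by simp
next
  fix w :: "'a ^ 'n" and p assume "p permutes (UNIV :: 'n set)"
  then have "F I (\<chi> i. w $ p i) = of_int (sign p) * F I w" if "I \<in> A" for I
    using assms[OF that] by (auto simp: alternating_form_def)
  then show "(\<Sum>I\<in>A. c I * F I (\<chi> i. w $ p i)) = of_int (sign p) * (\<Sum>I\<in>A. c I * F I w)"
    by (simp add: sum_distrib_left algebra_simps)
qed

lemma alternating_form_diff:
  assumes "alternating_form F" "alternating_form H"
  shows "alternating_form (\<lambda>w. F w - H w)"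
  using assms unfolding alternating_form_def
  by (auto intro: linear_compose_sub simp: algebra_simps)

text \<open>With \<open>b'\<close> dual to \<open>b\<close> under the inner product, evaluating a
  multivector on increasing tuples of \<open>b'\<close> reads off its coefficients in the basis of
  wedges of \<open>b\<close>.\<close>

locale dual_frame =
  fixes b b' :: "nat \<Rightarrow> 'a::euclidean_space"
  assumes dual: "i \<in> {1..DIM('a)} \<Longrightarrow> j \<in> {1..DIM('a)} \<Longrightarrow> b i \<bullet> b' j = (if i = j then 1 else 0)"
    and span_frame: "span (b ` {1..DIM('a)}) = UNIV"
begin

lemma dual_expansion: "x = (\<Sum>k\<in>{1..DIM('a)}. (x \<bullet> b k) *\<^sub>R b' k)"
proof -
  define y where "y = x - (\<Sum>k\<in>{1..DIM('a)}. (x \<bullet> b k) *\<^sub>R b' k)"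
  have b: "y \<bullet> b i = 0" if i: "i \<in> {1..DIM('a)}" for i
  proof -
    have "(\<Sum>k\<in>{1..DIM('a)}. (x \<bullet> b k) *\<^sub>R b' k) \<bullet> b i = (\<Sum>k\<in>{1..DIM('a)}. if k = i then x \<bullet> b i else 0)"
      unfolding inner_sum_left using dual[OF i] by (intro sum.cong) (auto simp: inner_commute[of "b' _"])
    then show ?thesis
      using i by (simp add: y_def inner_diff_left)
  qed
  have "y \<bullet> v = 0" if "v \<in> span (b ` {1..DIM('a)})" for v
    using that
  proof (induction rule: span_induct)
    case base
    then show ?case
      by (auto simp: subspace_def inner_add_right)
  qed (use b in auto)
  then have "y \<bullet> y = 0"
    unfolding span_frame by blast
  then show ?thesis
    by (simp add: y_def)
qed

text \<open>For equal indices the matrix is the identity. Otherwise the ranges differ while having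
  equal size, so some row vanishes.\<close>

lemma wedge_dual:
  fixes I J :: "'n::{finite,wellorder} \<Rightarrow> nat"
  assumes "I \<in> multi_indices DIM('a)" "J \<in> multi_indices DIM('a)"
  shows "wedge (\<chi> i. b (I i)) (\<chi> j. b' (J j)) = (if I = J then 1 else 0)"
proof -
  have IJ: "strict_mono I" "strict_mono J" "\<And>i. I i \<in> {1..DIM('a)}" "\<And>i. J i \<in> {1..DIM('a)}"
    using assms unfolding multi_indices_def by blast+
  let ?M = "\<chi> i j. if I i = J j then (1 :: real) else 0"
  have M: "wedge (\<chi> i. b (I i)) (\<chi> j. b' (J j)) = det ?M"
    unfolding wedge_def using dual[OF IJ(3,4)] by simp
  show ?thesis
  proof (cases "I = J")
    case True
    then have "?M = mat 1"
      using strict_mono_eq[OF IJ(2)] by (simp add: mat_def vec_eq_iff)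
    then show ?thesis
      unfolding M using True by simp
  next
    case False
    then have "range I \<noteq> range J"
      using strict_mono_range_eq_imp_eq IJ by blast
    moreover have "card (range I) = card (range J)"
      using IJ by (simp add: card_image strict_mono_imp_inj_on)
    ultimately have "\<not> range I \<subseteq> range J"
      using card_subset_eq[of "range J" "range I"] by auto
    then obtain i where "I i \<notin> range J"
      by blast
    then have "row i ?M = 0"
      by (auto simp: row_def vec_eq_iff)
    then have "det ?M = 0"
      by (rule det_zero_row)
    then show ?thesis
      unfolding M using False by simp
  qed
qed

text \<open>Tuples of dual vectors with a repetition give zero and injective ones are sorted by a
  permutation. Multilinearity then frees the arguments from the dual basis one slot at a time;
  \<open>T\<close> is the set of slots already freed.\<close>

lemma alternating_form_eq_0:
  fixes F :: "('a, 'n::{finite,wellorder}) multivector"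
  assumes F: "alternating_form F"
    and zero: "\<And>I. I \<in> multi_indices DIM('a) \<Longrightarrow> F (\<chi> j. b' (I j)) = 0"
  shows "F w = 0"
proof -
  have basis: "F (\<chi> j. b' (f j)) = 0" if f: "\<And>j. f j \<in> {1..DIM('a)}" for f :: "'n \<Rightarrow> nat"
  proof (cases "inj f")
    case False
    then obtain i j where "i \<noteq> j" "f i = f j"
      by (auto simp: inj_def)
    then show ?thesis
      using F unfolding alternating_form_def by (metis vec_lambda_beta)
  next
    case True
    then have "finite (range f)" "card (range f) = CARD('n)"
      by (auto simp: card_image)
    then obtain h :: "'n \<Rightarrow> nat" where h: "strict_mono h" "range h = range f"
      by (rule strict_mono_enumeration)
    define p where "p = inv f \<circ> h"
    have fp: "f (p i) = h i" for i
    proof -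
      have "h i \<in> range f"
        unfolding h(2)[symmetric] by simp
      then show ?thesis
        by (simp add: p_def f_inv_into_f)
    qed
    have "inj p"
      using strict_mono_imp_inj_on[OF h(1)] fp by (metis injD injI)
    then have "surj p"
      by (intro finite_UNIV_inj_surj finite)
    then have "p permutes UNIV"
      using \<open>inj p\<close> by (intro bij_imp_permutes) (simp_all add: bij_betw_def)
    then have "F (\<chi> i. (\<chi> j. b' (f j)) $ p i) = of_int (sign p) * F (\<chi> j. b' (f j))"
      using F unfolding alternating_form_def by blast
    moreover have "F (\<chi> i. b' (h i)) = 0"
      using h f by (intro zero) (auto simp: multi_indices_def)
    ultimately show ?thesis
      by (simp add: fp sign_def split: if_splits)
  qed
  have "\<forall>w. (\<forall>i. i \<notin> T \<longrightarrow> w $ i \<in> b' ` {1..DIM('a)}) \<longrightarrow> F w = 0" if "finite T" for T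
    using that
  proof (induction T rule: finite_induct)
    case empty
    show ?case
    proof (intro allI impI)
      fix w :: "('a, 'n) vec" assume "\<forall>i. i \<notin> {} \<longrightarrow> w $ i \<in> b' ` {1..DIM('a)}"
      then have "\<forall>i. \<exists>k\<in>{1..DIM('a)}. w $ i = b' k"
        by blast
      then obtain f where f: "\<And>i. f i \<in> {1..DIM('a)}" "\<And>i. w $ i = b' (f i)"
        by metis
      then have "w = (\<chi> j. b' (f j))"
        by (simp add: vec_eq_iff)
      then show "F w = 0"
        using basis[OF f(1)] by simp
    qed
  next
    case (insert z T)
    show ?case
    proof (intro allI impI)
      fix w :: "('a, 'n) vec" assume w: "\<forall>i. i \<notin> insert z T \<longrightarrow> w $ i \<in> b' ` {1..DIM('a)}"
      define H where "H u = F (\<chi> i. if i = z then u else w $ i)" for u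
      have lin: "linear H"
        using F unfolding alternating_form_def H_def by blast
      have "H (b' k) = 0" if k: "k \<in> {1..DIM('a)}" for k
      proof -
        have "\<forall>i. i \<notin> T \<longrightarrow> (\<chi> i. if i = z then b' k else w $ i) $ i \<in> b' ` {1..DIM('a)}"
          using w k by auto
        then show ?thesis
          unfolding H_def using insert.IH by blast
      qed
      then have "H (\<Sum>k\<in>{1..DIM('a)}. (w $ z \<bullet> b k) *\<^sub>R b' k) = 0"
        by (simp add: linear_sum[OF lin] linear_scale[OF lin])
      then have "H (w $ z) = 0"
        using dual_expansion[of "w $ z"] by simp
      moreover have "(\<chi> i. if i = z then w $ z else w $ i) = w"
        by (simp add: vec_eq_iff)
      ultimately show "F w = 0"
        by (simp add: H_def)
    qed
  qed
  from this[of UNIV] show ?thesis by simp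
qed

lemma multivector_sum_dual:
  fixes I :: "'n::{finite,wellorder} \<Rightarrow> nat"
  assumes "I \<in> multi_indices DIM('a)"
  shows "multivector_sum b c (\<chi> j. b' (I j)) = c I"
proof -
  have "multivector_sum b c (\<chi> j. b' (I j)) = (\<Sum>J\<in>multi_indices DIM('a). if J = I then c I else 0)"
    unfolding multivector_sum_def using assms by (intro sum.cong) (auto simp: wedge_dual)
  then show ?thesis
    using assms by (simp add: finite_multi_indices)
qed

lemma multivector_coeff_sum:
  assumes "\<And>I. I \<notin> multi_indices DIM('a) \<Longrightarrow> c I = 0"
  shows "multivector_coeff b (multivector_sum b c) = c"
  unfolding multivector_coeff_def
proof (rule the_equality)
  fix c' assume c': "(\<forall>I. I \<notin> multi_indices DIM('a) \<longrightarrow> c' I = 0) \<and> multivector_sum b c' = multivector_sum b c"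
  show "c' = c"
  proof
    fix I
    show "c' I = c I"
    proof (cases "I \<in> multi_indices DIM('a)")
      case True
      then show ?thesis
        using c' multivector_sum_dual[OF True, of c] multivector_sum_dual[OF True, of c'] by simp
    qed (use c' assms in auto)
  qed
qed (use assms in auto)

lemma multivector_sum_eq_0:
  assumes "\<And>I. I \<notin> multi_indices DIM('a) \<Longrightarrow> c I = 0"
  shows "multivector_sum b c = (\<lambda>_. 0) \<longleftrightarrow> (\<forall>I. c I = 0)"
proof
  assume *: "multivector_sum b c = (\<lambda>_. 0)"
  show "\<forall>I. c I = 0"
  proof
    fix I
    show "c I = 0"
      using assms[of I] multivector_sum_dual[of I c] * by (cases "I \<in> multi_indices DIM('a)") auto
  qed
qed (simp add: multivector_sum_def[abs_def])

definition wedge_coeff :: "'a ^ 'n::{finite,wellorder} \<Rightarrow> ('n \<Rightarrow> nat) \<Rightarrow> real" where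
  "wedge_coeff v I = (if I \<in> multi_indices DIM('a) then wedge v (\<chi> j. b' (I j)) else 0)"

text \<open>Both sides are alternating and agree on increasing dual tuples. The scalar
  \<open>s\<close> accommodates tangent multivectors, which are known only up to a factor.\<close>

lemma wedge_eq_sum: "(\<lambda>w. s * wedge v w) = multivector_sum b (\<lambda>I. s * wedge_coeff v I)"
proof
  fix w
  have eq: "multivector_sum b (\<lambda>I. s * wedge_coeff v I) w = s * multivector_sum b (wedge_coeff v) w" for w
    by (simp add: multivector_sum_def sum_distrib_left mult.assoc)
  have "wedge v w - multivector_sum b (wedge_coeff v) w = 0"
  proof (rule alternating_form_eq_0[of "\<lambda>w. wedge v w - multivector_sum b (wedge_coeff v) w"])
    show "alternating_form (\<lambda>w. wedge v w - multivector_sum b (wedge_coeff v) w)"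
      unfolding multivector_sum_def
      by (intro alternating_form_diff alternating_form_sum alternating_form_wedge)
    show "wedge v (\<chi> j. b' (I j)) - multivector_sum b (wedge_coeff v) (\<chi> j. b' (I j)) = 0"
      if "I \<in> multi_indices DIM('a)" for I
      using that by (simp add: multivector_sum_dual wedge_coeff_def)
  qed
  then show "s * wedge v w = multivector_sum b (\<lambda>I. s * wedge_coeff v I) w"
    by (simp add: eq)
qed

lemma multivector_coeff_wedge:
  "multivector_coeff b (\<lambda>w. s * wedge v w) = (\<lambda>I. s * wedge_coeff v I)"
  unfolding wedge_eq_sum by (rule multivector_coeff_sum) (simp add: wedge_coeff_def)

definition frame_norm :: "('a \<Rightarrow> 'a \<Rightarrow> real) \<Rightarrow> (('n::{finite,wellorder} \<Rightarrow> nat) \<Rightarrow> real) \<Rightarrow> real" where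
  "frame_norm \<beta> c = sqrt (\<Sum>I\<in>multi_indices DIM('a). \<Sum>J\<in>multi_indices DIM('a).
     c I * c J * det (\<chi> i j. \<beta> (b (I i)) (b (J j))))"

lemma multivector_norm_sum:
  assumes "\<And>I. I \<notin> multi_indices DIM('a) \<Longrightarrow> c I = 0"
  shows "multivector_norm b \<beta> (multivector_sum b c) = frame_norm \<beta> c"
  unfolding multivector_norm_def frame_norm_def by (simp add: multivector_coeff_sum[OF assms])

lemma frame_norm_scale: "frame_norm \<beta> (\<lambda>I. s * c I) = \<bar>s\<bar> * frame_norm \<beta> c"
proof -
  have "(\<Sum>I\<in>multi_indices DIM('a). \<Sum>J\<in>multi_indices DIM('a).
     s * c I * (s * c J) * det (\<chi> i j. \<beta> (b (I i)) (b (J j)))) =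
     s\<^sup>2 * (\<Sum>I\<in>multi_indices DIM('a). \<Sum>J\<in>multi_indices DIM('a).
     c I * c J * det (\<chi> i j. \<beta> (b (I i)) (b (J j))))"
    by (simp add: sum_distrib_left power2_eq_square algebra_simps)
  then show ?thesis
    by (simp add: frame_norm_def real_sqrt_mult)
qed

end

section \<open>Left invariant frames\<close>

lemma directional_derivative_LIMSEQ:
  fixes f :: "'a::real_normed_vector \<Rightarrow> 'b::real_inner"
  assumes "(f has_derivative f') (at x)"
  shows "(\<lambda>n. (f (x + (1 / real (Suc n)) *\<^sub>R u) \<bullet> c - f x \<bullet> c) / (1 / real (Suc n))) \<longlonglongrightarrow> f' u \<bullet> c"
proof -
  have "((\<lambda>t. x + t *\<^sub>R u) has_derivative (\<lambda>t. t *\<^sub>R u)) (at 0)"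
    by (auto intro!: derivative_eq_intros)
  moreover have "(f has_derivative f') (at (x + 0 *\<^sub>R u))"
    using assms by simp
  ultimately have "((\<lambda>t. f (x + t *\<^sub>R u)) has_derivative (\<lambda>t. f' (t *\<^sub>R u))) (at 0)"
    by (rule has_derivative_compose)
  then have "((\<lambda>t. f (x + t *\<^sub>R u) \<bullet> c) has_derivative (\<lambda>t. f' (t *\<^sub>R u) \<bullet> c)) (at 0)"
    by (rule has_derivative_inner_left)
  then have "((\<lambda>t. f (x + t *\<^sub>R u) \<bullet> c) has_real_derivative (f' u \<bullet> c)) (at 0)"
    using has_derivative_linear[OF assms] by (simp add: has_field_derivative_def linear_scale mult.commute[of _ "f' u \<bullet> c"] mult_commute_abs)
  then have "((\<lambda>t. (f (x + t *\<^sub>R u) \<bullet> c - f x \<bullet> c) / t) \<longlongrightarrow> f' u \<bullet> c) (at 0)"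
    by (simp add: DERIV_def)
  moreover have "filterlim (\<lambda>n. 1 / real (Suc n)) (at 0) sequentially"
    using LIMSEQ_inverse_real_of_nat by (intro filterlim_atI) (auto simp: inverse_eq_divide)
  ultimately show ?thesis
    by (rule filterlim_compose)
qed

locale framed_group = graded_group G
  for G :: "'a::euclidean_space group_data" +
  fixes e :: "nat \<Rightarrow> 'a"
  assumes graded_basis: "graded_basis G e"
begin

lemma inj_on_e: "inj_on e {1..DIM('a)}"
  using graded_basis by (simp add: graded_basis_def)

lemma span_e: "span (e ` {1..DIM('a)}) = UNIV"
proof -
  have "x \<in> span (e ` {1..DIM('a)})" for x
  proof -
    have "P j x \<in> span (e ` {1..DIM('a)})" if j: "j \<in> {1..step G}" for j
    proof -
      have "P j x \<in> span (layer G j \<inter> e ` {1..DIM('a)})"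
        using graded_basis j by (simp add: graded_basis_def)
      then show ?thesis
        using span_mono[of "layer G j \<inter> e ` {1..DIM('a)}" "e ` {1..DIM('a)}"] by blast
    qed
    then have "(\<Sum>j=1..step G. P j x) \<in> span (e ` {1..DIM('a)})"
      by (intro span_sum)
    then show ?thesis
      by (simp only: sum_layer_proj)
  qed
  then show ?thesis by blast
qed

text \<open>The coordinate functionals of the basis are represented as inner products by applying
  their adjoints to one.\<close>

lemma dual_basis_exists: "\<exists>e'. dual_frame e e'"
proof -
  have "independent (e ` {1..DIM('a)})"
    using span_e inj_on_e by (intro card_le_dim_spanning[of _ UNIV]) (auto simp: card_image)
  then have "\<exists>g. linear g \<and> (\<forall>x\<in>e ` {1..DIM('a)}. g x = (if x = e j then 1 else 0 :: real))" for j
    by (rule linear_independent_extend)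
  then obtain g where g: "\<And>j. linear (g j)"
      "\<And>j x. x \<in> e ` {1..DIM('a)} \<Longrightarrow> g j x = (if x = e j then 1 else 0 :: real)"
    by metis
  have "e i \<bullet> adjoint (g j) 1 = (if i = j then 1 else 0)"
    if "i \<in> {1..DIM('a)}" "j \<in> {1..DIM('a)}" for i j
    using that g(2)[of "e i" j] inj_on_eq_iff[OF inj_on_e that] by (simp add: adjoint_works[OF g(1)])
  then have "dual_frame e (\<lambda>j. adjoint (g j) 1)"
    using span_e by (intro dual_frame.intro)
  then show ?thesis by blast
qed

definition dual_basis :: "nat \<Rightarrow> 'a" where
  "dual_basis = (SOME e'. dual_frame e e')"

lemma dual_frame_dual_basis: "dual_frame e dual_basis"
  unfolding dual_basis_def using dual_basis_exists by (rule someI_ex)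

abbreviation left_diff :: "'a \<Rightarrow> 'a \<Rightarrow> 'a" where
  "left_diff p \<equiv> frechet_derivative (mult G p) (at 0)"

abbreviation left_diff_inv :: "'a \<Rightarrow> 'a \<Rightarrow> 'a" where
  "left_diff_inv p \<equiv> frechet_derivative (mult G (- p)) (at p)"

lemma left_diff_deriv: "(mult G p has_derivative left_diff p) (at 0)"
  using mult_differentiable_left by (simp add: frechet_derivative_works)

lemma left_diff_inv_deriv: "(mult G (- p) has_derivative left_diff_inv p) (at p)"
  using mult_differentiable_left by (simp add: frechet_derivative_works)

lemma linear_left_diff: "linear (left_diff p)" and linear_left_diff_inv: "linear (left_diff_inv p)"
  using left_diff_deriv left_diff_inv_deriv has_derivative_linear by blast+

lemma left_diff_inv_left_diff: "left_diff_inv p (left_diff p u) = u"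
proof -
  have "(mult G (- p) has_derivative left_diff_inv p) (at (mult G p 0))"
    using left_diff_inv_deriv by (simp add: mult_0_right)
  from has_derivative_compose[OF left_diff_deriv this]
  have "((\<lambda>x. x) has_derivative (\<lambda>u. left_diff_inv p (left_diff p u))) (at 0)"
    by (simp add: mult_cancel)
  then have "(\<lambda>u. left_diff_inv p (left_diff p u)) = (\<lambda>u. u)"
    by (rule has_derivative_unique) (rule has_derivative_ident)
  then show ?thesis
    by metis
qed

lemma surj_left_diff: "surj (left_diff p)"
  using linear_injective_imp_surjective[OF linear_left_diff] left_diff_inv_left_diff by (metis injI)

text \<open>Covectors are transported by the transpose of the inverse differential, so pairings with
  the left frame at \<open>p\<close> equal pairings at the unit.\<close>

definition dual_left_frame :: "'a \<Rightarrow> nat \<Rightarrow> 'a" where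
  "dual_left_frame p j = adjoint (left_diff_inv p) (dual_basis j)"

lemma dual_frame_left_frame: "dual_frame (left_frame G e p) (dual_left_frame p)"
proof
  fix i j assume "i \<in> {1..DIM('a)}" "j \<in> {1..DIM('a)}"
  then show "left_frame G e p i \<bullet> dual_left_frame p j = (if i = j then 1 else 0)"
    using dual_frame.dual[OF dual_frame_dual_basis, of i j]
    by (simp add: left_frame_def dual_left_frame_def adjoint_works[OF linear_left_diff_inv] left_diff_inv_left_diff)
next
  have "left_frame G e p ` {1..DIM('a)} = left_diff p ` e ` {1..DIM('a)}"
    by (simp add: left_frame_def image_image)
  then show "span (left_frame G e p ` {1..DIM('a)}) = UNIV"
    using surj_left_diff by (simp only: linear_span_image[OF linear_left_diff] span_e)
qed

text \<open>By left invariance the Gram matrix of the frame does not depend on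
  \<open>p\<close>.\<close>

lemma left_metric_left_frame: "left_metric G p (left_frame G e p i) (left_frame G e p j) = e i \<bullet> e j"
  by (simp add: left_metric_def left_frame_def left_diff_inv_left_diff)

lemma wedge_dual_left_frame: "wedge v (\<chi> j. dual_left_frame p (I j)) = det (\<chi> i j. left_diff_inv p (v $ i) \<bullet> dual_basis (I j))"
  unfolding wedge_def dual_left_frame_def by (simp add: adjoint_works[OF linear_left_diff_inv])

lemma measurable_mult:
  assumes "\<And>x. f differentiable (at x)" "\<And>x. h differentiable (at x)"
  shows "(\<lambda>x::'a. mult G (f x) (h x)) \<in> borel_measurable borel"
  using assms
  by (intro borel_measurable_continuous_onI continuous_at_imp_continuous_on ballI
      differentiable_imp_continuous_within mult_differentiable)

text \<open>The differentials are measurable in \<open>p\<close> as limits of difference quotients.\<close>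

lemma measurable_left_diff: "(\<lambda>p. left_diff p u \<bullet> c) \<in> borel_measurable borel"
proof (rule borel_measurable_LIMSEQ_real)
  show "(\<lambda>n. (mult G p (0 + (1 / real (Suc n)) *\<^sub>R u) \<bullet> c - mult G p 0 \<bullet> c) / (1 / real (Suc n))) \<longlonglongrightarrow> left_diff p u \<bullet> c" for p
    by (rule directional_derivative_LIMSEQ[OF left_diff_deriv])
  show "(\<lambda>p. (mult G p (0 + (1 / real (Suc n)) *\<^sub>R u) \<bullet> c - mult G p 0 \<bullet> c) / (1 / real (Suc n))) \<in> borel_measurable borel" for n
    by (intro borel_measurable_divide borel_measurable_diff borel_measurable_inner measurable_mult borel_measurable_const) auto
qed

lemma measurable_left_diff_inv: "(\<lambda>p. left_diff_inv p u \<bullet> c) \<in> borel_measurable borel"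
proof (rule borel_measurable_LIMSEQ_real)
  show "(\<lambda>n. (mult G (- p) (p + (1 / real (Suc n)) *\<^sub>R u) \<bullet> c - mult G (- p) p \<bullet> c) / (1 / real (Suc n))) \<longlonglongrightarrow> left_diff_inv p u \<bullet> c" for p
    by (rule directional_derivative_LIMSEQ[OF left_diff_inv_deriv])
  show "(\<lambda>p. (mult G (- p) (p + (1 / real (Suc n)) *\<^sub>R u) \<bullet> c - mult G (- p) p \<bullet> c) / (1 / real (Suc n))) \<in> borel_measurable borel" for n
    by (intro borel_measurable_divide borel_measurable_diff borel_measurable_inner measurable_mult borel_measurable_const) auto
qed

lemma measurable_left_frame: "(\<lambda>p. left_frame G e p i) \<in> borel_measurable borel"
  by (subst borel_measurable_euclidean_space) (simp add: left_frame_def measurable_left_diff)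

text \<open>Expanding the varying vector in \<open>Basis\<close> leaves differentials applied to
  constant vectors.\<close>

lemma measurable_left_diff_inv_compose:
  assumes "u \<in> borel_measurable M" "f \<in> borel_measurable M"
  shows "(\<lambda>x. left_diff_inv (f x) (u x) \<bullet> c) \<in> borel_measurable M"
proof -
  have "left_diff_inv (f x) (u x) \<bullet> c = (\<Sum>k\<in>Basis. (u x \<bullet> k) * (left_diff_inv (f x) k \<bullet> c))" for x
  proof -
    have "left_diff_inv (f x) (u x) = left_diff_inv (f x) (\<Sum>k\<in>Basis. (u x \<bullet> k) *\<^sub>R k)"
      by (simp add: euclidean_representation)
    then show ?thesis
      by (simp add: linear_sum[OF linear_left_diff_inv] linear_scale[OF linear_left_diff_inv] inner_sum_left)
  qed
  then show ?thesis
    using measurable_compose[OF assms(2) measurable_left_diff_inv] assms(1)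
    by (auto intro!: borel_measurable_sum borel_measurable_times borel_measurable_inner)
qed

end

section \<open>Measurability of determinants and of metrics\<close>

lemma borel_measurable_det:
  fixes M :: "'b \<Rightarrow> real ^ 'n ^ 'n"
  assumes "\<And>i j. (\<lambda>x. M x $ i $ j) \<in> borel_measurable N"
  shows "(\<lambda>x. det (M x)) \<in> borel_measurable N"
  unfolding det_def by (intro borel_measurable_sum borel_measurable_times borel_measurable_prod assms) auto

lemma borel_measurable_bilinear_form:
  fixes g :: "'b \<Rightarrow> 'a::euclidean_space \<Rightarrow> 'a \<Rightarrow> real"
  assumes g: "\<And>x. bilinear (g x)" "\<And>c c'. (\<lambda>x. g x c c') \<in> borel_measurable M"
    and uv: "u \<in> borel_measurable M" "v \<in> borel_measurable M"
  shows "(\<lambda>x. g x (u x) (v x)) \<in> borel_measurable M"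
proof -
  have "g x (u x) (v x) = (\<Sum>(c, c')\<in>Basis \<times> Basis. (u x \<bullet> c) * (v x \<bullet> c') * g x c c')" for x
  proof -
    have "g x (u x) (v x) = g x (\<Sum>c\<in>Basis. (u x \<bullet> c) *\<^sub>R c) (\<Sum>c\<in>Basis. (v x \<bullet> c) *\<^sub>R c)"
      by (simp add: euclidean_representation)
    also have "\<dots> = (\<Sum>(c, c')\<in>Basis \<times> Basis. g x ((u x \<bullet> c) *\<^sub>R c) ((v x \<bullet> c') *\<^sub>R c'))"
      by (rule bilinear_sum[OF g(1)])
    finally show ?thesis
      by (simp add: bilinear_lmul[OF g(1)] bilinear_rmul[OF g(1)] mult_ac)
  qed
  then show ?thesis
    using g(2) uv
    by (auto simp: case_prod_unfold intro!: borel_measurable_sum borel_measurable_times borel_measurable_inner)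
qed

lemma smooth_continuous: "smooth f \<Longrightarrow> continuous_on A f"
  by (erule smooth.cases) (auto intro!: continuous_at_imp_continuous_on intro: has_derivative_continuous)

lemma riemannian_metric_measurable:
  assumes "riemannian_metric g"
  shows "bilinear (g p)" "(\<lambda>p. g p u v) \<in> borel_measurable borel"
  using assms
  by (simp_all add: riemannian_metric_def borel_measurable_continuous_onI smooth_continuous)

section \<open>Tangent spaces in local parametrizations\<close>

lemma frechet_derivative_representation:
  fixes f' :: "(real, 'n::finite) vec \<Rightarrow> 'a::real_vector"
  assumes "linear f'"
  shows "f' h = (\<Sum>i\<in>UNIV. (h $ i) *\<^sub>R f' (axis i 1))"
proof -
  have "h = (\<Sum>i\<in>UNIV. (h $ i) *\<^sub>R axis i 1)"
    using basis_expansion[of h] by (simp add: scalar_mult_eq_scaleR)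
  then show ?thesis
    by (metis (no_types, lifting) assms linear_scale linear_sum sum.cong)
qed

lemma local_parametrization_derivative:
  assumes "local_parametrization S U \<Psi>" "x \<in> U"
  shows "(\<Psi> has_derivative frechet_derivative \<Psi> (at x)) (at x)"
proof -
  have "\<Psi> differentiable (at x)"
    using assms unfolding local_parametrization_def differentiable_on_def
    by (metis at_within_open)
  then show ?thesis
    by (simp add: frechet_derivative_works)
qed

text \<open>Straight lines in the chart give one inclusion. Conversely, the inverse chart is merely
  continuous, so a curve pulled back to the chart need not be visibly differentiable. The lower
  bound on the injective differential makes its displacement at most linear in \<open>t\<close>; the
  differential applied to difference quotients then approximates \<open>v\<close>, and the range is
  closed.\<close>

lemma tangent_space_local_parametrization:
  fixes \<Psi> :: "(real, 'n::{finite,wellorder}) vec \<Rightarrow> 'a::euclidean_space"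
  assumes param: "local_parametrization S U \<Psi>" and x: "x \<in> U"
  shows "tangent_space S (\<Psi> x) = range (frechet_derivative \<Psi> (at x))"
proof (intro equalityI subsetI)
  let ?D = "frechet_derivative \<Psi> (at x)"
  have der: "(\<Psi> has_derivative ?D) (at x)"
    by (rule local_parametrization_derivative[OF assms])
  have lin: "linear ?D"
    using der by (rule has_derivative_linear)
  have U: "open U" and sub: "\<Psi> ` U \<subseteq> S"
    using param by (auto simp: local_parametrization_def openin_subset dest: openin_imp_subset)
  {
    fix v assume "v \<in> range ?D"
    then obtain h where h: "v = ?D h" by blast
    define \<gamma> where "\<gamma> t = \<Psi> (x + t *\<^sub>R h)" for t
    have "((\<lambda>t. x + t *\<^sub>R h) has_derivative (\<lambda>t. t *\<^sub>R h)) (at 0)"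
      by (auto intro!: derivative_eq_intros)
    moreover have "(\<Psi> has_derivative ?D) (at (x + 0 *\<^sub>R h))"
      using der by simp
    ultimately have "(\<gamma> has_derivative (\<lambda>t. ?D (t *\<^sub>R h))) (at 0)"
      unfolding \<gamma>_def by (rule has_derivative_compose)
    then have "(\<gamma> has_vector_derivative v) (at 0)"
      unfolding has_vector_derivative_def h by (simp add: linear_scale[OF lin])
    moreover have "\<forall>\<^sub>F t in nhds 0. \<gamma> t \<in> S"
    proof -
      have "open ((\<lambda>t. x + t *\<^sub>R h) -` U)"
        by (intro open_vimage U continuous_intros)
      then have "\<forall>\<^sub>F t in nhds 0. t \<in> (\<lambda>t. x + t *\<^sub>R h) -` U"
        using x by (intro eventually_nhds_in_open) auto
      then show ?thesis
        by eventually_elim (use sub in \<open>auto simp: \<gamma>_def\<close>)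
    qed
    moreover have "\<gamma> 0 = \<Psi> x"
      by (simp add: \<gamma>_def)
    ultimately show "v \<in> tangent_space S (\<Psi> x)"
      unfolding tangent_space_def by blast
  }
  {
    fix v assume "v \<in> tangent_space S (\<Psi> x)"
    then obtain \<gamma> where \<gamma>: "\<gamma> 0 = \<Psi> x" "\<forall>\<^sub>F t in nhds (0::real). \<gamma> t \<in> S"
        "(\<gamma> has_vector_derivative v) (at 0)"
      by (auto simp: tangent_space_def)
    obtain \<Phi> where \<Phi>: "homeomorphism U (\<Psi> ` U) \<Psi> \<Phi>"
      using param by (auto simp: local_parametrization_def)
    obtain O' where O': "open O'" "\<Psi> ` U = S \<inter> O'"
      using param by (auto simp: local_parametrization_def openin_open)
    have \<gamma>_alt: "\<exists>r>0. \<forall>t. \<bar>t\<bar> < r \<longrightarrow> norm (\<gamma> t - \<Psi> x - t *\<^sub>R v) \<le> \<epsilon> * \<bar>t\<bar>" if "0 < \<epsilon>" for \<epsilon>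
      using \<gamma>(3) that unfolding has_vector_derivative_def has_derivative_at_alt by (auto simp: \<gamma>(1))
    have \<gamma>_lim: "(\<gamma> \<longlongrightarrow> \<Psi> x) (at 0)"
      using has_vector_derivative_continuous[OF \<gamma>(3)] \<gamma>(1) by (simp add: isCont_def)
    \<comment> \<open>The chart image is relatively open in \<open>S\<close>, so the curve stays in
      it for small \<open>t\<close>.\<close>
    have ev: "\<forall>\<^sub>F t in at 0. \<gamma> t \<in> \<Psi> ` U"
    proof -
      have "\<forall>\<^sub>F t in at 0. \<gamma> t \<in> O'"
        using O' x by (intro topological_tendstoD[OF \<gamma>_lim]) auto
      moreover have "\<forall>\<^sub>F t in at 0. \<gamma> t \<in> S"
        using \<gamma>(2) by (auto simp: eventually_at_filter elim: eventually_mono)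
      ultimately show ?thesis
        by eventually_elim (use O' in auto)
    qed
    define \<xi> where "\<xi> t = \<Phi> (\<gamma> t)" for t
    have \<Psi>\<xi>: "\<forall>\<^sub>F t in at 0. \<Psi> (\<xi> t) = \<gamma> t"
      using ev by eventually_elim (use \<Phi> in \<open>auto simp: \<xi>_def homeomorphism_def\<close>)
    have \<xi>_near: "\<forall>\<^sub>F t in at 0. norm (\<xi> t - x) < r" if r: "0 < r" for r
    proof -
      have "continuous_on (\<Psi> ` U) \<Phi>" "\<Phi> (\<Psi> x) = x"
        using \<Phi> x by (auto simp: homeomorphism_def)
      then obtain s where s: "0 < s" "\<forall>y\<in>\<Psi> ` U. dist y (\<Psi> x) < s \<longrightarrow> dist (\<Phi> y) x < r"
        using x r unfolding continuous_on_iff by (metis imageI)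
      from ev tendstoD[OF \<gamma>_lim s(1)] show ?thesis
        by eventually_elim (use s(2) in \<open>auto simp: \<xi>_def dist_norm\<close>)
    qed
    obtain m where m: "0 < m" "\<And>h. m * norm h \<le> norm (?D h)"
      using linear_inj_bounded_below_pos[OF lin] param x by (auto simp: local_parametrization_def)
    have "\<exists>w\<in>range ?D. dist w v < \<epsilon>" if \<epsilon>: "0 < \<epsilon>" for \<epsilon>
    proof -
      \<comment> \<open>The bound \<open>m / 2\<close> lets the remainder be absorbed by the lower
        bound on the differential; the other bound makes the remainder at most
        \<open>\<epsilon> / 2\<close> times the absolute value of \<open>t\<close>.\<close>
      define \<eta> where "\<eta> = min (m / 2) (\<epsilon> * m / (4 * (norm v + 1)))"
      have "0 < norm v + 1"
        using norm_ge_zero[of v] by linarith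
      then have \<eta>': "0 < \<eta>"
        using \<epsilon> m(1) by (simp add: \<eta>_def)
      have "\<eta> * (2 / m * (norm v + 1)) \<le> \<epsilon> * m / (4 * (norm v + 1)) * (2 / m * (norm v + 1))"
        using m(1) \<open>0 < norm v + 1\<close> by (intro mult_right_mono) (auto simp: \<eta>_def)
      also have "\<dots> = \<epsilon> / 2"
        using m(1) \<open>0 < norm v + 1\<close> by (simp add: divide_simps)
      finally have \<eta>: "0 < \<eta>" "\<eta> \<le> m / 2" "\<eta> * (2 / m) * (norm v + 1) \<le> \<epsilon> / 2"
        using \<eta>' min.cobounded1[of "m / 2" "\<epsilon> * m / (4 * (norm v + 1))"] unfolding \<eta>_def
        by (simp_all only: mult.assoc)
      obtain r where r: "0 < r" "\<And>y. norm (y - x) < r \<Longrightarrow> norm (\<Psi> y - \<Psi> x - ?D (y - x)) \<le> \<eta> * norm (y - x)"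
        using der \<eta>(1) unfolding has_derivative_at_alt by blast
      \<comment> \<open>The bound one gives the linear growth of the curve;
        \<open>\<epsilon> / 4\<close> brings the total error to three quarters of
        \<epsilon>.\<close>
      define \<kappa> where "\<kappa> = min 1 (\<epsilon> / 4)"
      have "0 < \<kappa>"
        using \<epsilon> by (simp add: \<kappa>_def)
      then obtain s where s: "0 < s" "\<And>t. \<bar>t\<bar> < s \<Longrightarrow> norm (\<gamma> t - \<Psi> x - t *\<^sub>R v) \<le> \<kappa> * \<bar>t\<bar>"
        using \<gamma>_alt by blast
      have "\<forall>\<^sub>F t in at (0::real). \<bar>t\<bar> < s"
        using s(1) by (auto simp: eventually_at dist_real_def)
      moreover have "\<forall>\<^sub>F t in at (0::real). t \<noteq> 0"
        by (simp add: eventually_at_filter)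
      ultimately have "\<forall>\<^sub>F t in at 0. norm (\<xi> t - x) < r \<and> \<Psi> (\<xi> t) = \<gamma> t \<and> \<bar>t\<bar> < s \<and> t \<noteq> 0"
        using \<xi>_near[OF r(1)] \<Psi>\<xi> by eventually_elim auto
      then obtain t where t: "norm (\<xi> t - x) < r" "\<Psi> (\<xi> t) = \<gamma> t" "\<bar>t\<bar> < s" "t \<noteq> 0"
        using eventually_happens'[OF at_neq_bot] by blast
      define y where "y = \<xi> t - x"
      define n where "n = norm (\<gamma> t - \<Psi> x)"
      have 1: "norm (\<gamma> t - \<Psi> x - ?D y) \<le> \<eta> * norm y"
        using r(2)[OF t(1)] by (simp add: t(2) y_def)
      have 2: "norm (\<gamma> t - \<Psi> x - t *\<^sub>R v) \<le> \<kappa> * \<bar>t\<bar>"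
        by (rule s(2)[OF t(3)])
      have "m * norm y \<le> norm (?D y)"
        by (rule m(2))
      also have "\<dots> \<le> n + \<eta> * norm y"
        using 1 norm_triangle_sub[of "?D y" "\<gamma> t - \<Psi> x"] by (simp add: n_def norm_minus_commute)
      also have "\<eta> * norm y \<le> m / 2 * norm y"
        using \<eta>(2) by (intro mult_right_mono) auto
      finally have y_le: "norm y \<le> 2 / m * n"
        using m(1) by (simp add: field_simps)
      have "n \<le> norm (t *\<^sub>R v) + \<kappa> * \<bar>t\<bar>"
        using 2 norm_triangle_sub[of "\<gamma> t - \<Psi> x" "t *\<^sub>R v"] by (simp add: n_def)
      also have "\<dots> \<le> \<bar>t\<bar> * norm v + 1 * \<bar>t\<bar>"
        by (intro add_mono mult_right_mono) (auto simp: \<kappa>_def)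
      finally have n_le: "n \<le> \<bar>t\<bar> * (norm v + 1)"
        by (simp add: algebra_simps)
      have "\<eta> * norm y \<le> \<eta> * (2 / m * (\<bar>t\<bar> * (norm v + 1)))"
        using y_le n_le \<eta>(1) m(1) by (intro mult_left_mono order_trans[OF y_le]) auto
      also have "\<dots> = \<bar>t\<bar> * (\<eta> * (2 / m) * (norm v + 1))"
        by simp
      also have "\<dots> \<le> \<bar>t\<bar> * (\<epsilon> / 2)"
        by (intro mult_left_mono \<eta>(3)) auto
      finally have 3: "\<eta> * norm y \<le> \<bar>t\<bar> * (\<epsilon> / 2)" .
      have 4: "\<kappa> * \<bar>t\<bar> \<le> \<epsilon> / 4 * \<bar>t\<bar>"
        by (intro mult_right_mono) (auto simp: \<kappa>_def)
      have "norm (?D y - t *\<^sub>R v) \<le> norm (\<gamma> t - \<Psi> x - t *\<^sub>R v) + norm (\<gamma> t - \<Psi> x - ?D y)"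
        using norm_triangle_ineq4[of "\<gamma> t - \<Psi> x - t *\<^sub>R v" "\<gamma> t - \<Psi> x - ?D y"] by (simp add: algebra_simps)
      also have "\<dots> \<le> \<epsilon> / 4 * \<bar>t\<bar> + \<bar>t\<bar> * (\<epsilon> / 2)"
        using 1 2 3 4 by linarith
      also have "\<dots> < \<epsilon> * \<bar>t\<bar>"
        using \<epsilon> t(4) by (simp add: field_simps)
      finally have 5: "norm (?D y - t *\<^sub>R v) < \<epsilon> * \<bar>t\<bar>" .
      have "?D ((1 / t) *\<^sub>R y) - v = (1 / t) *\<^sub>R (?D y - t *\<^sub>R v)"
        using t(4) by (simp add: linear_scale[OF lin] scaleR_diff_right)
      then have "norm (?D ((1 / t) *\<^sub>R y) - v) = norm (?D y - t *\<^sub>R v) / \<bar>t\<bar>"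
        by simp
      also have "\<dots> < \<epsilon>"
        using 5 t(4) by (simp add: field_simps)
      finally show ?thesis
        by (intro bexI[of _ "?D ((1 / t) *\<^sub>R y)"]) (auto simp: dist_norm)
    qed
    then have "v \<in> closure (range ?D)"
      by (simp add: closure_approachable)
    moreover have "closed (range ?D)"
      by (intro closed_subspace linear_subspace_image lin subspace_UNIV)
    ultimately show "v \<in> range ?D"
      by simp
  }
qed

section \<open>Tangent multivectors in charts\<close>

lemma wedge_linear_combination:
  fixes u v :: "('a::euclidean_space, 'n::finite) vec"
  assumes "\<And>i. v $ i = (\<Sum>k\<in>UNIV. a i k *\<^sub>R u $ k)"
  shows "wedge v w = det (\<chi> i k. a i k) * wedge u w"
proof -
  have "(\<chi> i j. v $ i \<bullet> w $ j) = (\<chi> i k. a i k) ** (\<chi> i j. u $ i \<bullet> w $ j)"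
    by (simp add: matrix_matrix_mult_def vec_eq_iff assms inner_sum_left)
  then show ?thesis
    unfolding wedge_def by (simp add: det_mul)
qed

definition chart_tangent :: "((real, 'n) vec \<Rightarrow> 'a::euclidean_space) \<Rightarrow> (real, 'n) vec \<Rightarrow> ('a, 'n::finite) vec" where
  "chart_tangent \<Psi> x = (\<chi> i. frechet_derivative \<Psi> (at x) (axis i 1))"

text \<open>Evaluated on the covectors obtained from a left inverse of the differential, the form is
  the determinant of the identity.\<close>

lemma wedge_chart_tangent_nonzero:
  fixes \<Psi> :: "(real, 'n::{finite,wellorder}) vec \<Rightarrow> 'a::euclidean_space"
  assumes "local_parametrization S U \<Psi>" "x \<in> U"
  shows "wedge (chart_tangent \<Psi> x) \<noteq> (\<lambda>_. 0)"
proof -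
  let ?D = "frechet_derivative \<Psi> (at x)"
  have lin: "linear ?D"
    using local_parametrization_derivative[OF assms] by (rule has_derivative_linear)
  have "inj ?D"
    using assms by (auto simp: local_parametrization_def)
  then obtain L where L: "linear L" "L \<circ> ?D = id"
    using linear_injective_left_inverse[OF lin] by blast
  have LD: "L (?D h) = h" for h
    using L(2) by (metis comp_apply id_apply)
  have "wedge (chart_tangent \<Psi> x) (\<chi> j. adjoint L (axis j 1)) = det (mat 1 :: ((real, 'n) vec, 'n) vec)"
    unfolding wedge_def chart_tangent_def
    by (intro arg_cong[of _ _ det]) (simp add: vec_eq_iff adjoint_works[OF L(1)] LD inner_axis_axis mat_def)
  then show ?thesis
    by (metis det_I zero_neq_one)
qed

text \<open>The chosen multivector spans the same tangent space as the coordinate vectors of the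
  chart, so the two differ by the determinant of the change of vectors.\<close>

lemma tangent_multivector_chart:
  fixes \<Psi> :: "(real, 'n::{finite,wellorder}) vec \<Rightarrow> 'a::euclidean_space"
  assumes "local_parametrization S U \<Psi>" "x \<in> U"
  obtains c where "c \<noteq> 0" "tangent_multivector S (\<Psi> x) = (\<lambda>w. c * wedge (chart_tangent \<Psi> x) w)"
proof -
  let ?D = "frechet_derivative \<Psi> (at x)" and ?u = "chart_tangent \<Psi> x"
  have lin: "linear ?D"
    using local_parametrization_derivative[OF assms] by (rule has_derivative_linear)
  have D: "?D h = (\<Sum>i\<in>UNIV. (h $ i) *\<^sub>R ?u $ i)" for h
    unfolding chart_tangent_def vec_lambda_beta by (rule frechet_derivative_representation[OF lin])
  have tan: "tangent_space S (\<Psi> x) = range ?D"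
    by (rule tangent_space_local_parametrization[OF assms])
  have "span (range (($) ?u)) = range ?D"
  proof (rule span_unique)
    show "range (($) ?u) \<subseteq> range ?D"
      by (auto simp: chart_tangent_def)
    show "subspace (range ?D)"
      by (intro linear_subspace_image lin subspace_UNIV)
    fix T assume T: "range (($) ?u) \<subseteq> T" "subspace T"
    show "range ?D \<subseteq> T"
      unfolding D using T by (auto intro!: subspace_sum subspace_scale)
  qed
  then have "wedge ?u \<noteq> (\<lambda>_. 0) \<and> (\<exists>v. wedge ?u = wedge v \<and> span (range (($) v)) = tangent_space S (\<Psi> x))"
    using wedge_chart_tangent_nonzero[OF assms] tan by metis
  then have "(tangent_multivector S (\<Psi> x) :: ('a, 'n) multivector) \<noteq> (\<lambda>_. 0) \<and>
      (\<exists>v. (tangent_multivector S (\<Psi> x) :: ('a, 'n) multivector) = wedge v \<and> span (range (($) v)) = tangent_space S (\<Psi> x))"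
    unfolding tangent_multivector_def by (rule someI[of _ "wedge ?u"])
  then obtain v where v: "tangent_multivector S (\<Psi> x) = wedge (v :: ('a, 'n) vec)" "wedge v \<noteq> (\<lambda>_. 0)"
      "span (range (($) v)) = range ?D"
    using tan by metis
  have "\<exists>h. v $ i = ?D h" for i
    using v(3) span_base[of "v $ i" "range (($) v)"] by auto
  then obtain h where "\<And>i. v $ i = ?D (h i)"
    by metis
  then have w: "wedge v w = det (\<chi> i k. h i $ k) * wedge ?u w" for w
    by (intro wedge_linear_combination) (simp add: D)
  then have "det (\<chi> i k. h i $ k) \<noteq> 0"
    using v(2) by auto
  then show ?thesis
    using that[of "det (\<chi> i k. h i $ k)"] v(1) w by auto
qed

section \<open>Borel structure of submanifolds\<close>

lemma local_parametrization_borel: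
  fixes \<Psi> :: "(real, 'n::{finite,wellorder}) vec \<Rightarrow> 'a::euclidean_space"
  assumes "local_parametrization S U \<Psi>"
  shows "\<Psi> ` U \<in> sets borel"
proof -
  have "open U" and cont: "continuous_on U \<Psi>"
    using assms by (auto simp: local_parametrization_def homeomorphism_def)
  \<comment> \<open>Exhausting \<open>U\<close> by compact sets writes the chart image as a
    countable union of compact sets.\<close>
  obtain C :: "nat \<Rightarrow> (real, 'n) vec set" where C: "\<And>n. compact (C n)" "\<And>n. C n \<subseteq> U" "\<Union> (range C) = U"
  proof (rule open_Union_compact_subsets[OF \<open>open U\<close>])
    fix C :: "nat \<Rightarrow> (real, 'n) vec set"
    assume "\<And>n. compact (C n)" "\<And>n. C n \<subseteq> U" "\<Union> (range C) = U"
    then show thesis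
      by (rule that)
  qed
  have "\<Psi> ` U = (\<Union>n. \<Psi> ` C n)"
    unfolding C(3)[symmetric] by auto
  also have "\<dots> \<in> sets borel"
    using C cont by (intro sets.countable_UN borel_closed image_subsetI)
      (auto intro!: compact_imp_closed compact_continuous_image intro: continuous_on_subset)
  finally show ?thesis .
qed

lemma C1_submanifold_charts:
  assumes "C1_submanifold TYPE('n::{finite,wellorder}) S"
  obtains \<C> where "countable \<C>" "S = \<Union>\<C>"
    "\<And>\<Omega>. \<Omega> \<in> \<C> \<Longrightarrow> \<exists>U (\<Psi> :: (real, 'n) vec \<Rightarrow> 'a::euclidean_space). local_parametrization S U \<Psi> \<and> \<Omega> = \<Psi> ` U"
proof -
  define \<O> where "\<O> = {T. open T \<and> (\<exists>U (\<Psi> :: (real, 'n) vec \<Rightarrow> 'a). local_parametrization S U \<Psi> \<and> S \<inter> T = \<Psi> ` U)}"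
  have "S \<subseteq> \<Union>\<O>"
  proof
    fix p assume "p \<in> S"
    then obtain U and \<Psi> :: "(real, 'n) vec \<Rightarrow> 'a" where \<Psi>: "local_parametrization S U \<Psi>" "p \<in> \<Psi> ` U"
      using assms unfolding C1_submanifold_def by blast
    then obtain T where "open T" "\<Psi> ` U = S \<inter> T"
      by (auto simp: local_parametrization_def openin_open)
    then show "p \<in> \<Union>\<O>"
      using \<Psi> unfolding \<O>_def by (intro UnionI[of T]) auto
  qed
  obtain \<O>' where \<O>': "\<O>' \<subseteq> \<O>" "countable \<O>'" "\<Union>\<O>' = \<Union>\<O>"
    using Lindelof[of \<O>] by (auto simp: \<O>_def)
  show ?thesis
  proof (rule that[of "(\<lambda>T. S \<inter> T) ` \<O>'"])
    show "S = \<Union> ((\<lambda>T. S \<inter> T) ` \<O>')"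
      using \<open>S \<subseteq> \<Union>\<O>\<close> \<O>'(3) by blast
  qed (use \<O>' in \<open>auto simp: \<O>_def\<close>)
qed

lemma C1_submanifold_borel:
  fixes S :: "'a::euclidean_space set"
  assumes "C1_submanifold TYPE('n::{finite,wellorder}) S"
  shows "S \<in> sets borel"
proof -
  obtain \<C> where \<C>: "countable \<C>" "S = \<Union>\<C>"
    "\<And>\<Omega>. \<Omega> \<in> \<C> \<Longrightarrow> \<exists>U (\<Psi> :: (real, 'n) vec \<Rightarrow> 'a). local_parametrization S U \<Psi> \<and> \<Omega> = \<Psi> ` U"
    using C1_submanifold_charts[OF assms] by blast
  then show ?thesis
    using local_parametrization_borel by (metis sets.countable_Union subsetI)
qed

text \<open>Countably many chart images and the complement of \<open>S\<close> form a Borel cover,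
  so measurability is checked on each of them.\<close>

lemma C1_submanifold_measurable:
  fixes S :: "'a::euclidean_space set" and f :: "'a \<Rightarrow> real"
  assumes S: "C1_submanifold TYPE('n::{finite,wellorder}) S"
    and f: "\<And>U (\<Psi> :: (real, 'n) vec \<Rightarrow> 'a). local_parametrization S U \<Psi> \<Longrightarrow>
      f \<in> borel_measurable (restrict_space borel (\<Psi> ` U))"
  shows "(\<lambda>p. if p \<in> S then f p else 0) \<in> borel_measurable borel"
proof -
  obtain \<C> where \<C>: "countable \<C>" "S = \<Union>\<C>"
    "\<And>\<Omega>. \<Omega> \<in> \<C> \<Longrightarrow> \<exists>U (\<Psi> :: (real, 'n) vec \<Rightarrow> 'a). local_parametrization S U \<Psi> \<and> \<Omega> = \<Psi> ` U"
    using C1_submanifold_charts[OF S] by blast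
  have pieces: "\<Omega> \<inter> space borel \<in> sets borel \<and> (\<lambda>p. if p \<in> S then f p else 0) \<in> borel_measurable (restrict_space borel \<Omega>)"
    if "\<Omega> \<in> insert (- S) \<C>" for \<Omega>
  proof -
    from that consider "\<Omega> = - S" | "\<Omega> \<in> \<C>" by blast
    then show ?thesis
    proof cases
      case 1
      have "(\<lambda>p. if p \<in> S then f p else 0) \<in> borel_measurable (restrict_space borel \<Omega>) \<longleftrightarrow>
          (\<lambda>p. 0 :: real) \<in> borel_measurable (restrict_space borel \<Omega>)"
        by (intro measurable_cong) (auto simp: 1 space_restrict_space)
      then show ?thesis
        using C1_submanifold_borel[OF S] 1 by simp
    next
      case 2
      then obtain U and \<Psi> :: "(real, 'n) vec \<Rightarrow> 'a" where \<Psi>: "local_parametrization S U \<Psi>" "\<Omega> = \<Psi> ` U"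
        using \<C>(3) by blast
      have "(\<lambda>p. if p \<in> S then f p else 0) \<in> borel_measurable (restrict_space borel \<Omega>) \<longleftrightarrow>
          f \<in> borel_measurable (restrict_space borel \<Omega>)"
        using 2 \<C>(2) by (intro measurable_cong) (auto simp: space_restrict_space)
      then show ?thesis
        using f[OF \<Psi>(1)] local_parametrization_borel[OF \<Psi>(1)] \<Psi>(2) by simp
    qed
  qed
  show ?thesis
  proof (rule measurable_piecewise_restrict)
    show "countable (insert (- S) \<C>)"
      using \<C>(1) by simp
    show "space borel \<subseteq> \<Union> (insert (- S) \<C>)"
      using \<C>(2) by blast
  qed (use pieces in blast)+
qed

section \<open>Degrees and the intrinsic density in charts\<close>

context framed_group
begin

abbreviation coeff :: "'a \<Rightarrow> ('a, 'n::{finite,wellorder}) vec \<Rightarrow> ('n \<Rightarrow> nat) \<Rightarrow> real" where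
  "coeff p \<equiv> dual_frame.wedge_coeff (dual_left_frame p)"

abbreviation fnorm where
  "fnorm p \<equiv> dual_frame.frame_norm (left_frame G e p)"

definition degree_part :: "nat \<Rightarrow> (('n::{finite,wellorder} \<Rightarrow> nat) \<Rightarrow> real) \<Rightarrow> ('n \<Rightarrow> nat) \<Rightarrow> real" where
  "degree_part M c I = (if index_degree G e I = M then c I else 0)"

lemma coeff_outside: "I \<notin> multi_indices DIM('a) \<Longrightarrow> coeff p v I = 0"
  by (simp add: dual_frame.wedge_coeff_def[OF dual_frame_left_frame])

lemma degree_proj_wedge:
  "degree_proj G e p M (\<lambda>w. s * wedge v w) =
    multivector_sum (left_frame G e p) (\<lambda>I. s * degree_part M (coeff p v) I)"
proof -
  have "(\<lambda>I. if index_degree G e I = M then s * coeff p v I else 0) = (\<lambda>I. s * degree_part M (coeff p v) I)"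
    by (auto simp: degree_part_def)
  then show ?thesis
    unfolding degree_proj_def dual_frame.multivector_coeff_wedge[OF dual_frame_left_frame] by simp
qed

lemma degree_proj_wedge_eq_0:
  assumes "s \<noteq> 0"
  shows "degree_proj G e p M (\<lambda>w. s * wedge v w) = (\<lambda>_. 0) \<longleftrightarrow> (\<forall>I. degree_part M (coeff p v) I = 0)"
  unfolding degree_proj_wedge
  using assms by (subst dual_frame.multivector_sum_eq_0[OF dual_frame_left_frame])
    (auto simp: degree_part_def coeff_outside)

text \<open>
  The absolute value in the denominator spares a proof that the radicand in \<open>frame_norm\<close> is
  nonnegative: \<open>sqrt\<close> is negative on negative numbers.
\<close>

lemma intrinsic_density_chart:
  fixes \<Psi> :: "(real, 'n::{finite,wellorder}) vec \<Rightarrow> 'a"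
  assumes "local_parametrization S U \<Psi>" "x \<in> U"
  defines "p \<equiv> \<Psi> x" and "v \<equiv> chart_tangent \<Psi> x"
  shows "intrinsic_density TYPE('n) G e g S N p =
    fnorm p (left_metric G p) (degree_part N (coeff p v)) / \<bar>fnorm p (g p) (coeff p v)\<bar>"
proof -
  interpret F: dual_frame "left_frame G e p" "dual_left_frame p"
    by (rule dual_frame_left_frame)
  obtain c where c: "c \<noteq> 0" "tangent_multivector S p = (\<lambda>w. c * wedge v w)"
    using tangent_multivector_chart[OF assms(1,2)] unfolding p_def v_def by blast
  define n where "n = fnorm p (g p) (coeff p v)"
  have "multivector_norm (left_frame G e p) (g p) (tangent_multivector S p :: ('a, 'n) multivector) = \<bar>c\<bar> * n"
    unfolding c(2) F.wedge_eq_sum n_def F.frame_norm_scale[symmetric]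
    by (rule F.multivector_norm_sum) (simp add: coeff_outside)
  then have "(unit_tangent G e g S p :: ('a, 'n) multivector) = (\<lambda>w. (c / (\<bar>c\<bar> * n)) * wedge v w)"
    by (simp add: unit_tangent_def c(2))
  then have "intrinsic_density TYPE('n) G e g S N p =
      \<bar>c / (\<bar>c\<bar> * n)\<bar> * fnorm p (left_metric G p) (degree_part N (coeff p v))"
    unfolding intrinsic_density_def degree_proj_wedge F.frame_norm_scale[symmetric]
    by (simp only: degree_proj_wedge)
      (intro F.multivector_norm_sum, simp add: degree_part_def coeff_outside)
  \<comment> \<open>The arbitrary factor \<open>c\<close> cancels; division by zero being zero, the
    identity holds for every \<open>n\<close>.\<close>
  moreover have "\<bar>c / (\<bar>c\<bar> * n)\<bar> = 1 / \<bar>n\<bar>"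
    using c(1) by (simp add: abs_mult)
  ultimately show ?thesis
    by (simp only: n_def mult_1_left times_divide_eq_left)
qed

text \<open>The nonzero factor relating the chosen multivector to the chart wedge does not affect
  which coefficients vanish.\<close>

lemma degrees_chart:
  fixes \<Psi> :: "(real, 'n::{finite,wellorder}) vec \<Rightarrow> 'a"
  assumes "local_parametrization S U \<Psi>" "x \<in> U"
  defines "p \<equiv> \<Psi> x" and "v \<equiv> chart_tangent \<Psi> x"
  shows "{M. degree_proj G e p M (tangent_multivector S p :: ('a, 'n) multivector) \<noteq> (\<lambda>_. 0)} =
      index_degree G e ` {I. coeff p v I \<noteq> 0}"
    and "{I. coeff p v I \<noteq> 0} \<noteq> {}"
proof -
  interpret F: dual_frame "left_frame G e p" "dual_left_frame p"
    by (rule dual_frame_left_frame)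
  obtain c where c: "c \<noteq> 0" "tangent_multivector S p = (\<lambda>w. c * wedge v w)"
    using tangent_multivector_chart[OF assms(1,2)] unfolding p_def v_def by blast
  show "{M. degree_proj G e p M (tangent_multivector S p :: ('a, 'n) multivector) \<noteq> (\<lambda>_. 0)} =
      index_degree G e ` {I. coeff p v I \<noteq> 0}"
    unfolding c(2) degree_proj_wedge_eq_0[OF c(1)] by (auto simp: degree_part_def)
  show "{I. coeff p v I \<noteq> 0} \<noteq> {}"
  proof
    assume "{I. coeff p v I \<noteq> 0} = {}"
    then have "wedge v = (\<lambda>_. 0)"
      using F.wedge_eq_sum[of 1 v] by (simp add: multivector_sum_def[abs_def])
    then show False
      using wedge_chart_tangent_nonzero[OF assms(1,2)] by (simp add: v_def)
  qed
qed

text \<open>Each coefficient is a determinant of inverse differentials applied to the coordinate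
  vectors, which are continuous on the chart image.\<close>

lemma measurable_coeff_chart:
  fixes \<Psi> :: "(real, 'n::{finite,wellorder}) vec \<Rightarrow> 'a"
  assumes \<Psi>: "local_parametrization S U \<Psi>" and \<Phi>: "homeomorphism U (\<Psi> ` U) \<Psi> \<Phi>"
  shows "(\<lambda>p. coeff p (chart_tangent \<Psi> (\<Phi> p)) I) \<in> borel_measurable (restrict_space borel (\<Psi> ` U))"
proof (cases "I \<in> multi_indices DIM('a)")
  case True
  let ?R = "restrict_space borel (\<Psi> ` U)"
  have v_meas: "(\<lambda>p. chart_tangent \<Psi> (\<Phi> p) $ i) \<in> borel_measurable ?R" for i
  proof (rule borel_measurable_continuous_on_restrict)
    have "continuous_on U (\<lambda>x. frechet_derivative \<Psi> (at x) (axis i 1))"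
      using \<Psi> by (simp add: local_parametrization_def)
    then have "continuous_on (\<Psi> ` U) (\<lambda>p. frechet_derivative \<Psi> (at (\<Phi> p)) (axis i 1))"
      by (rule continuous_on_compose2) (use \<Phi> in \<open>auto simp: homeomorphism_def\<close>)
    then show "continuous_on (\<Psi> ` U) (\<lambda>p. chart_tangent \<Psi> (\<Phi> p) $ i)"
      by (simp add: chart_tangent_def)
  qed
  have id_meas: "(\<lambda>p. p) \<in> borel_measurable ?R"
    by (rule measurable_restrict_space1) simp
  have "coeff p v I = det (\<chi> i j. left_diff_inv p (v $ i) \<bullet> dual_basis (I j))" for p and v :: "('a, 'n) vec"
    using True by (simp add: dual_frame.wedge_coeff_def[OF dual_frame_left_frame] wedge_dual_left_frame)
  then show ?thesis
    using v_meas id_meas by (auto intro!: borel_measurable_det measurable_left_diff_inv_compose)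
qed (simp add: coeff_outside)

lemma measurable_degree_part:
  assumes "\<And>I. (\<lambda>p. c p I) \<in> borel_measurable R"
  shows "(\<lambda>p. degree_part M (c p) I) \<in> borel_measurable R"
  unfolding degree_part_def using assms[of I] by (cases "index_degree G e I = M") auto

lemma measurable_density_chart:
  fixes \<Psi> :: "(real, 'n::{finite,wellorder}) vec \<Rightarrow> 'a"
  assumes \<Psi>: "local_parametrization S U \<Psi>" and g: "riemannian_metric g"
  shows "intrinsic_density TYPE('n) G e g S N \<in> borel_measurable (restrict_space borel (\<Psi> ` U))"
proof -
  let ?R = "restrict_space borel (\<Psi> ` U)"
  obtain \<Phi> where \<Phi>: "homeomorphism U (\<Psi> ` U) \<Psi> \<Phi>"
    using \<Psi> by (auto simp: local_parametrization_def)
  define v where "v p = chart_tangent \<Psi> (\<Phi> p)" for p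
  have \<Phi>_in: "\<Phi> p \<in> U" "\<Psi> (\<Phi> p) = p" if "p \<in> \<Psi> ` U" for p
    using \<Phi> that by (auto simp: homeomorphism_def)
  have coeff_meas: "(\<lambda>p. coeff p (v p) I) \<in> borel_measurable ?R" for I
    unfolding v_def by (rule measurable_coeff_chart[OF \<Psi> \<Phi>])
  have frame_meas: "(\<lambda>p. left_frame G e p i) \<in> borel_measurable ?R" for i
    by (rule measurable_restrict_space1[OF measurable_left_frame])
  have g_meas: "(\<lambda>p. g p (left_frame G e p i) (left_frame G e p j)) \<in> borel_measurable ?R" for i j
    by (rule borel_measurable_bilinear_form[where g = g, OF riemannian_metric_measurable(1)[OF g]
          measurable_restrict_space1[OF riemannian_metric_measurable(2)[OF g]] frame_meas frame_meas])
  have norm_meas: "(\<lambda>p. fnorm p (\<beta> p) (c p)) \<in> borel_measurable ?R"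
    if c: "\<And>I. (\<lambda>p. c p I) \<in> borel_measurable ?R"
      and \<beta>: "\<And>i j. (\<lambda>p. \<beta> p (left_frame G e p i) (left_frame G e p j)) \<in> borel_measurable ?R"
    for \<beta> and c :: "'a \<Rightarrow> ('n \<Rightarrow> nat) \<Rightarrow> real"
  proof -
    have "(\<lambda>p. det (\<chi> i j. \<beta> p (left_frame G e p (I i)) (left_frame G e p (J j)))) \<in> borel_measurable ?R"
      for I J :: "'n \<Rightarrow> nat"
      by (rule borel_measurable_det) (simp add: \<beta>)
    then show ?thesis
      unfolding dual_frame.frame_norm_def[OF dual_frame_left_frame] using c
      by (intro measurable_compose[OF _ borel_measurable_sqrt] borel_measurable_sum borel_measurable_times)
  qed
  have "(\<lambda>p. fnorm p (left_metric G p) (degree_part N (coeff p (v p))) / \<bar>fnorm p (g p) (coeff p (v p))\<bar>) \<in> borel_measurable ?R"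
    by (intro borel_measurable_divide borel_measurable_abs norm_meas measurable_degree_part coeff_meas g_meas)
      (simp add: left_metric_left_frame)
  then show "intrinsic_density TYPE('n) G e g S N \<in> borel_measurable ?R"
  proof (rule measurable_cong[THEN iffD1, rotated])
    fix p assume "p \<in> space ?R"
    then have "p \<in> \<Psi> ` U"
      by (simp add: space_restrict_space)
    from intrinsic_density_chart[OF \<Psi> \<Phi>_in(1)[OF this], of g N]
    show "fnorm p (left_metric G p) (degree_part N (coeff p (v p))) / \<bar>fnorm p (g p) (coeff p (v p))\<bar> =
        intrinsic_density TYPE('n) G e g S N p"
      by (simp add: v_def \<Phi>_in(2)[OF \<open>p \<in> \<Psi> ` U\<close>])
  qed
qed

text \<open>Membership of \<open>N\<close> is written as a function with values zero and one, so
  that measurability can be glued over charts. It detects whether the sum \<open>h\<close> of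
  absolute coefficients of degree \<open>N\<close> is nonzero.\<close>

lemma measurable_degree_chart:
  fixes \<Psi> :: "(real, 'n::{finite,wellorder}) vec \<Rightarrow> 'a"
  assumes \<Psi>: "local_parametrization S U \<Psi>"
  shows "(\<lambda>p. if N \<in> {M. degree_proj G e p M (tangent_multivector S p :: ('a, 'n) multivector) \<noteq> (\<lambda>_. 0)}
      then 1 else 0 :: real) \<in> borel_measurable (restrict_space borel (\<Psi> ` U))"
proof -
  let ?R = "restrict_space borel (\<Psi> ` U)"
  obtain \<Phi> where \<Phi>: "homeomorphism U (\<Psi> ` U) \<Psi> \<Phi>"
    using \<Psi> by (auto simp: local_parametrization_def)
  define v where "v p = chart_tangent \<Psi> (\<Phi> p)" for p
  have \<Phi>_in: "\<Phi> p \<in> U" "\<Psi> (\<Phi> p) = p" if "p \<in> \<Psi> ` U" for p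
    using \<Phi> that by (auto simp: homeomorphism_def)
  define h where "h p = (\<Sum>I\<in>multi_indices DIM('a). \<bar>degree_part N (coeff p (v p)) I\<bar>)" for p
  have h0: "h p = 0 \<longleftrightarrow> (\<forall>I. degree_part N (coeff p (v p)) I = 0)" for p
    unfolding h_def using coeff_outside[of _ p "v p"]
    by (subst sum_nonneg_eq_0_iff) (auto simp: finite_multi_indices degree_part_def)
  have "h \<in> borel_measurable ?R"
    unfolding h_def v_def
    by (intro borel_measurable_sum borel_measurable_abs measurable_degree_part measurable_coeff_chart[OF \<Psi> \<Phi>])
  then have "(\<lambda>p. if h p \<noteq> 0 then 1 else 0 :: real) \<in> borel_measurable ?R"
    by (intro measurable_If) auto
  then show ?thesis
  proof (rule measurable_cong[THEN iffD1, rotated])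
    fix p assume "p \<in> space ?R"
    then have "p \<in> \<Psi> ` U"
      by (simp add: space_restrict_space)
    from degrees_chart(1)[OF \<Psi> \<Phi>_in(1)[OF this]]
    show "(if h p \<noteq> 0 then 1 else 0 :: real) =
        (if N \<in> {M. degree_proj G e p M (tangent_multivector S p :: ('a, 'n) multivector) \<noteq> (\<lambda>_. 0)} then 1 else 0)"
      unfolding h0 by (auto simp: v_def \<Phi>_in(2)[OF \<open>p \<in> \<Psi> ` U\<close>] degree_part_def image_iff)
  qed
qed

section \<open>Points of maximum degree\<close>

context
  fixes S :: "'a set" and N :: nat
  assumes S: "C1_submanifold TYPE('n::{finite,wellorder}) S"
    and N: "manifold_degree TYPE('n) G e S = N"
begin

definition degrees :: "'a \<Rightarrow> nat set" where
  "degrees p = {M. degree_proj G e p M (tangent_multivector S p :: ('a, 'n) multivector) \<noteq> (\<lambda>_. 0)}"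

lemma point_degree_eq: "point_degree TYPE('n) G e S p = Max (degrees p)"
  by (simp add: point_degree_def degrees_def)

lemma chart_exists:
  assumes "p \<in> S"
  obtains U and \<Psi> :: "(real, 'n) vec \<Rightarrow> 'a" and x where "local_parametrization S U \<Psi>" "x \<in> U" "p = \<Psi> x"
  using S assms unfolding C1_submanifold_def by blast

lemma degrees_bound:
  assumes "p \<in> S"
  shows "degrees p \<subseteq> index_degree G e ` (multi_indices DIM('a) :: ('n \<Rightarrow> nat) set)" "degrees p \<noteq> {}"
proof -
  obtain U and \<Psi> :: "(real, 'n) vec \<Rightarrow> 'a" and x where x: "local_parametrization S U \<Psi>" "x \<in> U" "p = \<Psi> x"
    using chart_exists[OF assms] .
  have "{I. coeff p (chart_tangent \<Psi> x) I \<noteq> 0} \<subseteq> multi_indices DIM('a)"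
    using coeff_outside by blast
  then show "degrees p \<subseteq> index_degree G e ` (multi_indices DIM('a) :: ('n \<Rightarrow> nat) set)"
    unfolding degrees_def using degrees_chart(1)[OF x(1,2)] x(3) by blast
  show "degrees p \<noteq> {}"
    unfolding degrees_def using degrees_chart[OF x(1,2)] x(3) by simp
qed

lemma finite_degrees: "p \<in> S \<Longrightarrow> finite (degrees p)"
  using degrees_bound(1) finite_multi_indices finite_subset by blast

text \<open>\<open>Max\<close> is informative only on finite sets: all point degrees come from the
  finitely many multi-indices.\<close>

lemma point_degree_le:
  assumes "p \<in> S"
  shows "point_degree TYPE('n) G e S p \<le> N"
proof -
  let ?F = "index_degree G e ` (multi_indices DIM('a) :: ('n \<Rightarrow> nat) set)"
  have "point_degree TYPE('n) G e S ` S \<subseteq> ?F"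
    using degrees_bound finite_degrees Max_in unfolding point_degree_eq by blast
  then have "finite (point_degree TYPE('n) G e S ` S)"
    using finite_multi_indices finite_subset by blast
  then show ?thesis
    using N assms unfolding manifold_degree_def by (metis Max_ge imageI)
qed

text \<open>Since no point degree exceeds \<open>N\<close>, the maximum can be replaced by the
  occurrence of \<open>N\<close>, a condition on coefficients.\<close>

lemma point_degree_eq_iff:
  assumes "p \<in> S"
  shows "point_degree TYPE('n) G e S p = N \<longleftrightarrow> N \<in> degrees p"
  using Max_in[OF finite_degrees degrees_bound(2), OF assms assms]
    Max_ge[OF finite_degrees[OF assms], of N] point_degree_le[OF assms]
  unfolding point_degree_eq by auto

lemma intrinsic_density_eq_0:
  assumes "p \<in> S" "point_degree TYPE('n) G e S p \<noteq> N"
  shows "intrinsic_density TYPE('n) G e g S N p = 0"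
proof -
  obtain U and \<Psi> :: "(real, 'n) vec \<Rightarrow> 'a" and x where x: "local_parametrization S U \<Psi>" "x \<in> U" "p = \<Psi> x"
    using chart_exists[OF assms(1)] .
  have "N \<notin> degrees p"
    using assms point_degree_eq_iff by blast
  then have "degree_part N (coeff p (chart_tangent \<Psi> x)) = (\<lambda>_. 0)"
    unfolding degrees_def x(3) degrees_chart(1)[OF x(1,2)] by (auto simp: degree_part_def fun_eq_iff image_iff)
  then show ?thesis
    unfolding x(3) intrinsic_density_chart[OF x(1,2)]
    by (simp add: dual_frame.frame_norm_def[OF dual_frame_left_frame])
qed

lemma measurable_intrinsic_density:
  assumes "riemannian_metric g"
  shows "(\<lambda>p. if p \<in> S then intrinsic_density TYPE('n) G e g S N p else 0) \<in> borel_measurable borel"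
  using measurable_density_chart[OF _ assms] by (rule C1_submanifold_measurable[OF S])

lemma borel_max_degree: "{p \<in> S. point_degree TYPE('n) G e S p = N} \<in> sets borel"
proof -
  have *: "(\<lambda>p. if p \<in> S then (if N \<in> degrees p then 1 else 0 :: real) else 0) \<in> borel_measurable borel"
    using measurable_degree_chart unfolding degrees_def
    by (rule C1_submanifold_measurable[OF S])
  have "{p \<in> S. point_degree TYPE('n) G e S p = N} = {p \<in> S. N \<in> degrees p}"
    by (intro Collect_cong conj_cong refl point_degree_eq_iff)
  also have "\<dots> =
      (\<lambda>p. if p \<in> S then (if N \<in> degrees p then 1 else 0 :: real) else 0) -` {1} \<inter> space borel"
    by (auto split: if_splits)
  also have "\<dots> \<in> sets borel"
    by (rule measurable_sets[OF *]) simp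
  finally show ?thesis .
qed

end

end

lemma multiradial_imp_multiradial_group:
  assumes "graded_group G" "multiradial G d"
  shows "\<exists>\<phi>. multiradial_group G d \<phi>"
proof -
  obtain \<phi> :: "(nat \<Rightarrow> real) \<Rightarrow> real" where \<phi>: "homogeneous_distance G d" "continuous_on (orthant (step G)) \<phi>"
      "\<forall>t\<in>orthant (step G). \<forall>i\<in>{1..step G}. \<forall>s\<ge>t i. \<phi> t \<le> \<phi> (t(i := s))"
      "\<phi> (\<lambda>_. 0) = 0" "\<forall>C. \<exists>R. \<forall>t\<in>orthant (step G). R \<le> L2_set t {1..step G} \<longrightarrow> C \<le> \<phi> t"
      "closed_ball d 0 1 = {x. \<phi> (\<lambda>i. if i \<in> {1..step G} then norm (layer_proj G i x) else 0) \<le> 1}"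
    using assms(2) unfolding multiradial_def by blast
  have "multiradial_group_axioms G d \<phi>"
    using \<phi>(3,5) by (intro multiradial_group_axioms.intro \<phi>(1,2,4,6)) simp_all
  then show ?thesis
    using assms(1) by (auto simp: multiradial_group_def)
qed

theorem theorem1p5:
  fixes G :: "'a::euclidean_space group_data"
    and e :: "nat \<Rightarrow> 'a"
    and d :: "'a \<Rightarrow> 'a \<Rightarrow> real"
    and g :: "'a \<Rightarrow> 'a \<Rightarrow> 'a \<Rightarrow> real"
    and S :: "'a set"
    and \<sigma> :: "'a measure"
    and ns :: "nat \<Rightarrow> nat"
    and N :: nat
  assumes "graded_group G"
    and "graded_basis G e"
    and "multiradial G d"
    and "C1_submanifold TYPE('n::{finite,wellorder}) S"
    and "manifold_degree TYPE('n) G e S = N"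
    and "riemannian_metric g"
    and "surface_measure TYPE('n) g S \<sigma>"
    and I: "\<forall>p\<in>S. point_degree TYPE('n) G e S p = N \<longrightarrow>
              federer_density d N (intrinsic_measure TYPE('n) G e g \<sigma> S N) p
                = spherical_factor d (homogeneous_tangent_space TYPE('n) G e S N p)"
    and II: "spherical_measure d N {p \<in> S. point_degree TYPE('n) G e S p < N} = 0"
    and III: "\<forall>p\<in>S. point_degree TYPE('n) G e S p = N \<longrightarrow>
                homogeneous_tangent_space TYPE('n) G e S N p \<in> homogeneous_family G ns"
  shows "\<forall>B\<in>sets borel. B \<subseteq> S \<longrightarrow>
           spherical_constant G d ns * spherical_measure d N B
             = (\<integral>\<^sup>+p\<in>B. ennreal (intrinsic_density TYPE('n) G e g S N p) \<partial>\<sigma>)"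
proof (intro ballI impI)
  fix B :: "'a set" assume B: "B \<in> sets borel" "B \<subseteq> S"
  interpret graded_group G by fact
  interpret framed_group G e
    by unfold_locales fact
  obtain \<phi> where "multiradial_group G d \<phi>"
    using multiradial_imp_multiradial_group[OF \<open>graded_group G\<close> \<open>multiradial G d\<close>] by blast
  then interpret multiradial_group G d \<phi> .
  define f where "f p = intrinsic_density TYPE('n) G e g S N p" for p
  \<comment> \<open>Extension by zero off \<open>S\<close> makes the density a Borel function on the
    whole group.\<close>
  define \<nu> where "\<nu> = density \<sigma> (\<lambda>p. ennreal (if p \<in> S then f p else 0))"
  have \<sigma>: "sets \<sigma> = sets borel"
    using assms(7) by (simp add: surface_measure_def)
  have f_meas: "(\<lambda>p. ennreal (if p \<in> S then f p else 0)) \<in> borel_measurable \<sigma>"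
    using measurable_intrinsic_density[OF assms(4,5,6)] unfolding f_def measurable_cong_sets[OF \<sigma> refl]
    by simp
  have \<nu>_sets: "sets \<nu> = sets borel"
    by (simp add: \<nu>_def \<sigma>)
  have \<nu>_eq: "emeasure \<nu> X = intrinsic_measure TYPE('n) G e g \<sigma> S N X" if "X \<in> sets borel" for X
    unfolding \<nu>_def intrinsic_measure_def f_def[symmetric]
    by (subst emeasure_density) (use f_meas that \<sigma> in \<open>auto intro!: nn_integral_cong simp: indicator_def\<close>)
  define M where "M = {p \<in> S. point_degree TYPE('n) G e S p = N}"
  have M: "M \<in> sets borel"
    unfolding M_def by (rule borel_max_degree[OF assms(4,5)])
  have "B - M \<subseteq> {p \<in> S. point_degree TYPE('n) G e S p < N}"
    using B(2) point_degree_le[OF assms(4,5)] by (auto simp: M_def le_less)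
  then have "spherical_measure d N (B - M) \<le> 0"
    unfolding II[symmetric] spherical_measure_def by (rule covering_measure_mono)
  then have S_null: "spherical_measure d N (B - M) = 0"
    by simp
  have "spherical_measure d N B \<le> spherical_measure d N (B \<inter> M) + spherical_measure d N (B - M)"
    using covering_measure_Un_le[of d "closed_balls d" _ "B \<inter> M" "B - M"]
    unfolding spherical_measure_def by (simp add: Int_Diff_Un)
  moreover have "spherical_measure d N (B \<inter> M) \<le> spherical_measure d N B"
    unfolding spherical_measure_def by (intro covering_measure_mono) auto
  ultimately have S_eq: "spherical_measure d N B = spherical_measure d N (B \<inter> M)"
    using S_null by simp
  have f_eq_0: "f p = 0" if "p \<in> B - M" for p
    using that B(2) intrinsic_density_eq_0[OF assms(4,5)] by (auto simp: f_def M_def)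
  have "(\<integral>\<^sup>+p\<in>B. ennreal (f p) \<partial>\<sigma>) = (\<integral>\<^sup>+p\<in>B \<inter> M \<inter> S. ennreal (f p) \<partial>\<sigma>)"
    using f_eq_0 B(2) by (intro nn_integral_cong) (auto simp: indicator_def)
  also have "\<dots> = emeasure \<nu> (B \<inter> M)"
    using \<nu>_eq[of "B \<inter> M"] B(1) M by (simp add: intrinsic_measure_def f_def)
  finally have rhs: "(\<integral>\<^sup>+p\<in>B. ennreal (f p) \<partial>\<sigma>) = emeasure \<nu> (B \<inter> M)" .
  have "spherical_constant G d ns * spherical_measure d N (B \<inter> M) = emeasure \<nu> (B \<inter> M)"
  proof (cases "M = {}")
    \<comment> \<open>The family may be empty here and \<open>spherical_constant\<close>
      indeterminate; both sides vanish on the empty set.\<close>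
    case True
    then show ?thesis
      by (simp add: spherical_measure_def)
  next
    case False
    then obtain p0 where "p0 \<in> S" "point_degree TYPE('n) G e S p0 = N"
      by (auto simp: M_def)
    then have fam: "homogeneous_tangent_space TYPE('n) G e S N p0 \<in> homogeneous_family G ns"
      using III by blast
    obtain c where c: "0 < c" "spherical_factor d (homogeneous_tangent_space TYPE('n) G e S N p0) = ennreal c"
      using spherical_factor_pos_finite[OF fam] .
    have "emeasure \<nu> (B \<inter> M) = ennreal c * spherical_measure d N (B \<inter> M)"
    proof (rule measure_eq_spherical_measure[OF \<nu>_sets _ _ c(1)])
      fix p assume p: "p \<in> B \<inter> M"
      \<comment> \<open>The density evaluates measures on closed balls only; these are Borel, and
        there \<nu> is the intrinsic measure.\<close>
      have "federer_density d N (emeasure \<nu>) p = federer_density d N (intrinsic_measure TYPE('n) G e g \<sigma> S N) p"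
        unfolding federer_density_def using \<nu>_eq[OF closed_balls_borel]
        by (intro INF_cong SUP_cong refl) auto
      also have "\<dots> = spherical_factor d (homogeneous_tangent_space TYPE('n) G e S N p)"
        using I p by (auto simp: M_def)
      also have "\<dots> = ennreal c"
        using spherical_factor_constant[OF _ fam] III p c(2) by (auto simp: M_def)
      finally show "federer_density d N (emeasure \<nu>) p = ennreal c" .
    qed (use B M in auto)
    then show ?thesis
      using spherical_constant_eq[OF fam] c(2) by simp
  qed
  then show "spherical_constant G d ns * spherical_measure d N B
             = (\<integral>\<^sup>+p\<in>B. ennreal (intrinsic_density TYPE('n) G e g S N p) \<partial>\<sigma>)"
    using S_eq rhs by (simp add: f_def)
qed

end
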